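(* There is a measure-preserving system $(X,\mathscr{B},\mu,T)$, functions $F_0,F_1,F_2\in L^\infty(\mu)$ and an $\varepsilon>0$ such that the correlation sequence \[ C_{F_0,F_1,F_2}(n) := \int_X F_0\cdot T^nF_1\cdot T^{2n}F_2\, d\mu \] cannot be written as $a(n)+b(n)$, where $\Vert b\Vert_\infty\leq\varepsilon$ and $a$ is an integral combination of $2$-step nilsequences.
   Context: A measure-preserving system $(X,\mathscr{B},\mu,T)$ is a probability space $(X,\mathscr{B},\mu)$ with a measure-preserving transformation $T$; $T^nF$ denotes $F\circ T^n$. $\Vert b\Vert_\infty=\sup_n|b(n)|$. Nilsequence: for an integer $k\geq 1$, a $k$-step nilsequence is a sequence $(\phi(g^nx_0))_{n\in\mathbb{Z}}$, where $\phi:G\to\mathbb{C}$ is a continuous function satisfying the automorphy condition $\phi(x\gamma)=\phi(x)$ for all $x\in G$ and all $\gamma\in\Gamma$, where $G$ is a simply-connected $k$-step nilpotent Lie group with discrete and cocompact subgroup $\Gamma$, and $g,x_0$ are fixed elements of $G$. Integral combination: an integral combination of $k$-step nilsequences is a sequence of the form \[ a(n)=\int_M a_m(n)\, d\sigma(m), \] where $M$ is a compact metric space, $\sigma$ is a complex Borel measure of bounded variation (on $M$), the $a_m$ are $k$-step nilsequences, and the map $m\mapsto a_m(n)$ is measurable for each $n$.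
   Formalization: "Integral combination" here also requires that ‖a_m‖_∞ be integrable against |σ| (as when all ‖a_m‖_∞ ≤ 1). Without such a bound every sequence is one (masses 2^-j, a_j of period 2j+1 supported on ±j mod 2j+1), so the claim as printed fails. *)

theory Defs
  imports "HOL-Probability.Probability" "HOL-Algebra.Coset" "HOL-Algebra.Generated_Groups"
begin

section \<open>Measure-preserving systems and correlation sequences\<close>

text \<open>\<open>T\<close> need not be invertible, so correlation sequences are indexed by \<^typ>\<open>nat\<close>.\<close>

definition measure_preserving_system :: "'x measure \<Rightarrow> ('x \<Rightarrow> 'x) \<Rightarrow> bool" where
  "measure_preserving_system M T \<longleftrightarrow>
     prob_space M \<and> T \<in> measurable M M \<and>
     (\<forall>A\<in>sets M. emeasure M (T -` A \<inter> space M) = emeasure M A)"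

definition L_infinity :: "'x measure \<Rightarrow> ('x \<Rightarrow> complex) set" where
  "L_infinity M = {F \<in> borel_measurable M. \<exists>C. AE x in M. cmod (F x) \<le> C}"

definition correlation ::
    "'x measure \<Rightarrow> ('x \<Rightarrow> 'x) \<Rightarrow> ('x \<Rightarrow> complex) \<Rightarrow> ('x \<Rightarrow> complex) \<Rightarrow> ('x \<Rightarrow> complex) \<Rightarrow> nat \<Rightarrow> complex"
  where
  "correlation M T F0 F1 F2 n =
     (LINT x|M. F0 x * F1 ((T ^^ n) x) * F2 ((T ^^ (2 * n)) x))"


section \<open>Lie groups\<close>

text \<open>The dimension is existentially quantified in the definition of a Lie group below, so
  \<open>\<real>\<^sup>d\<close> is the library's \<^const>\<open>Euclidean_space\<close> \<open>d\<close>: the functions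
  \<^typ>\<open>nat \<Rightarrow> real\<close> that vanish at all indices \<open>\<ge> d\<close>.

  \<open>Ck_on d k S f\<close> means that \<open>f\<close> is of class \<open>C\<^sup>k\<close> on \<open>S\<close>, i.e. all its iterated partial
  derivatives of order at most \<open>k\<close> exist and are continuous on \<open>S\<close>.
  It is only used for \<open>S\<close> open in \<^term>\<open>Euclidean_space d\<close>.\<close>

primrec Ck_on :: "nat \<Rightarrow> nat \<Rightarrow> (nat \<Rightarrow> real) set \<Rightarrow> ((nat \<Rightarrow> real) \<Rightarrow> real) \<Rightarrow> bool" where
  "Ck_on d 0 S f \<longleftrightarrow> continuous_map (subtopology (Euclidean_space d) S) euclideanreal f"
| "Ck_on d (Suc k) S f \<longleftrightarrow>
     continuous_map (subtopology (Euclidean_space d) S) euclideanreal f \<and>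
     (\<forall>i<d. \<exists>g. (\<forall>x\<in>S. ((\<lambda>t. f (x(i := t))) has_real_derivative g x) (at (x i))) \<and> Ck_on d k S g)"

definition smooth_map_on ::
    "nat \<Rightarrow> nat \<Rightarrow> (nat \<Rightarrow> real) set \<Rightarrow> ((nat \<Rightarrow> real) \<Rightarrow> (nat \<Rightarrow> real)) \<Rightarrow> bool" where
  "smooth_map_on d e S f \<longleftrightarrow> (\<forall>j<e. \<forall>k. Ck_on d k S (\<lambda>x. f x j))"

text \<open>A chart is a pair \<open>(U, \<psi>)\<close> of an open set and a homeomorphism of it onto an open subset
  of \<open>\<real>\<^sup>d\<close>.\<close>

definition smooth_atlas :: "nat \<Rightarrow> 'a topology \<Rightarrow> ('a set \<times> ('a \<Rightarrow> nat \<Rightarrow> real)) set \<Rightarrow> bool" where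
  "smooth_atlas d X \<A> \<longleftrightarrow>
     (\<Union>(U, \<psi>)\<in>\<A>. U) = topspace X \<and>
     (\<forall>(U, \<psi>)\<in>\<A>. openin X U \<and> openin (Euclidean_space d) (\<psi> ` U) \<and>
        homeomorphic_map (subtopology X U) (subtopology (Euclidean_space d) (\<psi> ` U)) \<psi>) \<and>
     (\<forall>(U, \<psi>)\<in>\<A>. \<forall>(V, \<eta>)\<in>\<A>.
        smooth_map_on d d (\<psi> ` (U \<inter> V)) (\<lambda>x. \<eta> (inv_into U \<psi> x)))"

text \<open>The two projections of \<open>\<real>\<^sup>2\<^sup>d = \<real>\<^sup>d \<times> \<real>\<^sup>d\<close>, used for charts of \<open>G \<times> G\<close>.\<close>

definition left_half :: "nat \<Rightarrow> (nat \<Rightarrow> real) \<Rightarrow> nat \<Rightarrow> real" where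
  "left_half d z = (\<lambda>i. if i < d then z i else 0)"

definition right_half :: "nat \<Rightarrow> (nat \<Rightarrow> real) \<Rightarrow> nat \<Rightarrow> real" where
  "right_half d z = (\<lambda>i. if i < d then z (d + i) else 0)"

definition lie_group :: "('a, 'b) monoid_scheme \<Rightarrow> 'a topology \<Rightarrow> bool" where
  "lie_group G X \<longleftrightarrow>
     group G \<and> topspace X = carrier G \<and> Hausdorff_space X \<and> second_countable X \<and>
     continuous_map (prod_topology X X) X (\<lambda>(x, y). x \<otimes>\<^bsub>G\<^esub> y) \<and>
     continuous_map X X (\<lambda>x. inv\<^bsub>G\<^esub> x) \<and>
     (\<exists>d \<A>. smooth_atlas d X \<A> \<and>
        (\<forall>(U, \<psi>)\<in>\<A>. \<forall>(V, \<eta>)\<in>\<A>. \<forall>(W, \<omega>)\<in>\<A>.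
           smooth_map_on (2 * d) d
             {z \<in> topspace (Euclidean_space (2 * d)).
                left_half d z \<in> \<psi> ` U \<and> right_half d z \<in> \<eta> ` V \<and>
                inv_into U \<psi> (left_half d z) \<otimes>\<^bsub>G\<^esub> inv_into V \<eta> (right_half d z) \<in> W}
             (\<lambda>z. \<omega> (inv_into U \<psi> (left_half d z) \<otimes>\<^bsub>G\<^esub> inv_into V \<eta> (right_half d z)))) \<and>
        (\<forall>(U, \<psi>)\<in>\<A>. \<forall>(W, \<omega>)\<in>\<A>.
           smooth_map_on d d
             {x \<in> \<psi> ` U. inv\<^bsub>G\<^esub> (inv_into U \<psi> x) \<in> W}
             (\<lambda>x. \<omega> (inv\<^bsub>G\<^esub> (inv_into U \<psi> x)))))"

definition simply_connected_space :: "'a topology \<Rightarrow> bool" where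
  "simply_connected_space X \<longleftrightarrow>
     path_connected_space X \<and>
     (\<forall>p. pathin X p \<and> p 0 = p 1 \<longrightarrow>
        homotopic_with (\<lambda>h. h 0 = p 0 \<and> h 1 = p 0) (top_of_set {0..1}) X p (\<lambda>_. p 0))"

text \<open>\<open>lower_central G j\<close> is \<open>G\<^sub>j\<^sub>+\<^sub>1\<close> in the usual numbering \<open>G\<^sub>1 = G\<close>, \<open>G\<^sub>i\<^sub>+\<^sub>1 = [G\<^sub>i, G]\<close>;
  \<open>k\<close>-step nilpotent means \<open>G\<^sub>k\<^sub>+\<^sub>1 = {1}\<close>, i.e. nilpotent of class at most \<open>k\<close>.\<close>

primrec lower_central :: "('a, 'b) monoid_scheme \<Rightarrow> nat \<Rightarrow> 'a set" where
  "lower_central G 0 = carrier G"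
| "lower_central G (Suc j) =
     generate G (\<Union>x\<in>lower_central G j. \<Union>y\<in>carrier G.
       {x \<otimes>\<^bsub>G\<^esub> y \<otimes>\<^bsub>G\<^esub> inv\<^bsub>G\<^esub> x \<otimes>\<^bsub>G\<^esub> inv\<^bsub>G\<^esub> y})"

definition nilpotent_step :: "nat \<Rightarrow> ('a, 'b) monoid_scheme \<Rightarrow> bool" where
  "nilpotent_step k G \<longleftrightarrow> group G \<and> lower_central G k = {\<one>\<^bsub>G\<^esub>}"

definition discrete_cocompact_subgroup ::
    "('a, 'b) monoid_scheme \<Rightarrow> 'a topology \<Rightarrow> 'a set \<Rightarrow> bool" where
  "discrete_cocompact_subgroup G X \<Gamma> \<longleftrightarrow>
     subgroup \<Gamma> G \<and> subtopology X \<Gamma> = discrete_topology \<Gamma> \<and>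
     (\<exists>Y. quotient_map X Y (\<lambda>x. x <#\<^bsub>G\<^esub> \<Gamma>) \<and> compact_space Y)"


section \<open>Nilsequences\<close>

text \<open>A quantifier cannot range over types, so the underlying set of \<open>G\<close> is taken to be a set of
  reals, with an arbitrary topology and group law unrelated to those of \<^typ>\<open>real\<close>. This is no
  restriction: a connected Lie group has at most the cardinality of the continuum, and the structure
  can be transported along any injection into \<^typ>\<open>real\<close>.\<close>

definition nilsequence :: "nat \<Rightarrow> (int \<Rightarrow> complex) \<Rightarrow> bool" where
  "nilsequence k a \<longleftrightarrow>
     (\<exists>(G :: real monoid) X \<Gamma> \<phi> g x0.
        lie_group G X \<and> simply_connected_space X \<and> nilpotent_step k G \<and>
        discrete_cocompact_subgroup G X \<Gamma> \<and>
        continuous_map X euclidean \<phi> \<and>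
        (\<forall>x\<in>carrier G. \<forall>\<gamma>\<in>\<Gamma>. \<phi> (x \<otimes>\<^bsub>G\<^esub> \<gamma>) = \<phi> x) \<and>
        g \<in> carrier G \<and> x0 \<in> carrier G \<and>
        (\<forall>n. a n = \<phi> (g [^]\<^bsub>G\<^esub> n \<otimes>\<^bsub>G\<^esub> x0)))"


section \<open>Complex measures\<close>

text \<open>Set functions are only considered on the \<open>\<sigma>\<close>-algebra of a measure space \<open>N\<close>, whose own
  measure plays no role.\<close>

definition complex_measure :: "'m measure \<Rightarrow> ('m set \<Rightarrow> complex) \<Rightarrow> bool" where
  "complex_measure N \<sigma> \<longleftrightarrow>
     \<sigma> {} = 0 \<and>
     (\<forall>A :: nat \<Rightarrow> 'm set. range A \<subseteq> sets N \<and> disjoint_family A \<longrightarrow>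
        (\<lambda>i. \<sigma> (A i)) sums \<sigma> (\<Union>i. A i))"

definition variation_measure :: "'m measure \<Rightarrow> ('m set \<Rightarrow> complex) \<Rightarrow> 'm measure" where
  "variation_measure N \<sigma> = measure_of (space N) (sets N)
     (\<lambda>A. SUP P\<in>{P. finite P \<and> P \<subseteq> sets N \<and> disjoint P \<and> \<Union>P \<subseteq> A}.
        \<Sum>B\<in>P. ennreal (cmod (\<sigma> B)))"

text \<open>The positive part \<open>\<nu>\<^sup>+\<close> of the Jordan decomposition \<open>\<nu> = \<nu>\<^sup>+ - \<nu>\<^sup>-\<close> of a signed measure \<open>\<nu>\<close>,
  where \<open>\<nu>\<^sup>- = (-\<nu>)\<^sup>+\<close>. Note that \<^const>\<open>ennreal\<close> sends negative numbers to \<open>0\<close>.\<close>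

definition positive_part :: "'m measure \<Rightarrow> ('m set \<Rightarrow> real) \<Rightarrow> 'm measure" where
  "positive_part N \<nu> = measure_of (space N) (sets N)
     (\<lambda>A. SUP B\<in>{B \<in> sets N. B \<subseteq> A}. ennreal (\<nu> B))"

definition signed_integral :: "'m measure \<Rightarrow> ('m set \<Rightarrow> real) \<Rightarrow> ('m \<Rightarrow> complex) \<Rightarrow> complex" where
  "signed_integral N \<nu> f =
     (LINT m|positive_part N \<nu>. f m) - (LINT m|positive_part N (\<lambda>A. - \<nu> A). f m)"

definition complex_integral :: "'m measure \<Rightarrow> ('m set \<Rightarrow> complex) \<Rightarrow> ('m \<Rightarrow> complex) \<Rightarrow> complex" where
  "complex_integral N \<sigma> f =
     signed_integral N (\<lambda>A. Re (\<sigma> A)) f + \<i> * signed_integral N (\<lambda>A. Im (\<sigma> A)) f"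


section \<open>Integral combinations of nilsequences\<close>

definition borel_sigma :: "'m topology \<Rightarrow> 'm measure" where
  "borel_sigma X = sigma (topspace X) {U. openin X U}"

text \<open>As for \<^const>\<open>nilsequence\<close>, a compact metric space has at most the cardinality of the continuum,
  so its underlying set may be taken to be a set of reals (with an arbitrary metric \<open>d\<close>).

  The condition \<open>\<integral> \<parallel>a\<^sub>m\<parallel>\<^sub>\<infinity> d\<bar>\<sigma>\<bar>(m) < \<infinity>\<close> says that the integral converges absolutely in
  \<open>\<ell>\<^sup>\<infinity>\<close>; up to rescaling the \<open>a\<^sub>m\<close> and \<open>\<sigma>\<close> it is the same as requiring \<open>\<parallel>a\<^sub>m\<parallel>\<^sub>\<infinity> \<le> 1\<close>
  for all \<open>m\<close>. Absolute convergence for each \<open>n\<close> separately would not do: take \<open>\<sigma>\<close> with an atom of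
  mass \<open>2\<^sup>-\<^sup>j\<close> at \<open>m\<^sub>j\<close> (\<open>j \<ge> 0\<close>) and let \<open>a\<^sub>m\<close> for \<open>m = m\<^sub>j\<close> have period \<open>2j + 1\<close> and support
  \<open>\<plusminus>j + (2j + 1)\<int>\<close>. Choosing the values successively, every sequence arises in this way.\<close>

definition integral_combination :: "nat \<Rightarrow> (int \<Rightarrow> complex) \<Rightarrow> bool" where
  "integral_combination k a \<longleftrightarrow>
     (\<exists>(M :: real set) d N \<sigma> A.
        Metric_space M d \<and> compact_space (Metric_space.mtopology M d) \<and>
        N = borel_sigma (Metric_space.mtopology M d) \<and>
        complex_measure N \<sigma> \<and> emeasure (variation_measure N \<sigma>) M < \<infinity> \<and>
        (\<forall>m\<in>M. nilsequence k (A m)) \<and>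
        (\<forall>n. (\<lambda>m. A m n) \<in> borel_measurable N) \<and>
        (\<integral>\<^sup>+ m. (SUP n. ennreal (cmod (A m n))) \<partial>variation_measure N \<sigma>) < \<infinity> \<and>
        (\<forall>n. a n = complex_integral N \<sigma> (\<lambda>m. A m n)))"

end

theory Submission
  imports Defs "HOL-Real_Asymp.Real_Asymp"
begin

text \<open>The system is a skew product over the odometer \<open>x \<mapsto> x + 1\<close> on sequences of digits in base \<open>B = 32\<close>.
  For coefficients \<open>c\<^sub>i\<^sub>j \<in> {0, 1}\<close> let \<open>Q(x) = \<Sum> c\<^sub>i\<^sub>j x\<^sub>i x\<^sub>j\<close>. This is only a formal sum, but
  \<open>Q(x + 1) - Q(x)\<close> is almost surely finite if each digit interacts with finitely many others, so
  \<open>T(x, u) = (x + 1, u \<i>\<^bsup>Q(x+1)-Q(x)\<^esup>)\<close> makes sense for \<open>u\<close> a fourth root of unity. With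
  \<open>F\<^sub>0 = F\<^sub>2 = u\<close> and \<open>F\<^sub>1 = u\<^sup>2 = u\<^sup>-\<^sup>2\<close> the integrand of the correlation at \<open>d\<close> is \<open>\<i>\<close> to the power
  \<open>Q(x) - 2 Q(x + d) + Q(x + 2 d)\<close>. For \<open>d = B\<^sup>i + B\<^sup>j\<close> this exponent is \<open>2 c\<^sub>i\<^sub>j\<close> unless one of the two
  digits is within \<open>2\<close> of a carry. Hence the correlation sequence takes, up to an error of \<open>1/4\<close>,
  arbitrarily prescribed signs \<open>s\<^sub>i\<^sub>j\<close> at the numbers \<open>B\<^sup>i + B\<^sup>j\<close>. The pairs \<open>(i, j)\<close> are taken from
  blocks, the \<open>n\<close>-th of which is the product of \<open>n\<close> rows and \<open>n\<close> columns, so that it has \<open>n\<^sup>2\<close> free signs.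

  A two-step nilsequence \<open>a(m) = \<phi>(g\<^sup>m x\<^sub>0)\<close> carries much less information on a block. One may assume
  \<open>x\<^sub>0 = 1\<close>. Write \<open>G = K \<Gamma>\<close> with \<open>K\<close> compact, and \<open>g\<close> to the power \<open>B\<^sup>i\<close> as \<open>k\<^sub>i \<gamma>\<^sub>i\<close>. Since commutators
  are central and bilinear,
  \<open>g\<close> to the power \<open>B\<^bsup>i+h\<^esup> + B\<^sup>j\<close> lies in \<open>k\<^sub>j k\<^bsub>i+h\<^esub> [k\<^sub>i, k\<^sub>j]\<^sup>b [\<gamma>\<^sub>i, k\<^bsub>j+h\<^esub>] \<Gamma>\<close> with \<open>b = B\<^sup>h\<close>
  (lemma \<open>product_mod_subgroup\<close>). The factors before the last one depend continuously on three points of the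
  compact set \<open>K\<close>, one attached to the row \<open>i + h\<close>, one to the column \<open>j\<close> and one to \<open>i\<close>. The last factor
  is central, so the precision with which it must be known does not depend on \<open>h\<close>; and it depends only on
  \<open>(i, j + h)\<close>. So if \<open>i\<close> runs through the multiples of \<open>H\<close> and \<open>h < H\<close>, then \<open>a\<close> is determined on the
  block, up to a small error, by \<open>O(n)\<close> labels from a set of size \<open>q(H)\<close> and about \<open>n\<^sup>2/H\<close> labels from a set
  whose size \<open>r\<close> does not depend on \<open>H\<close> (lemma \<open>nilsequence_low_complexity\<close>).

  The number of such patterns is \<open>exp(o(n\<^sup>2) + (n\<^sup>2/H) log r)\<close>, and \<open>H\<close> may be as large as one likes. By Hoeffding's
  inequality and a union bound there are signs which have small correlation with all of them
  (lemma \<open>exists_universal_signs\<close>), and then for every two-step nilsequence the average of \<open>s\<^sub>i\<^sub>j a(B\<^sup>i + B\<^sup>j)\<close> over the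
  \<open>n\<close>-th block tends to \<open>0\<close> (lemma \<open>low_complexity_average_tendsto_0\<close>). Dominated convergence with respect to
  the variation of the complex measure extends this to integral combinations
  (lemma \<open>integral_combination_weighted_sums\<close>). For the correlation sequence, however, these averages stay
  within \<open>1/4\<close> of \<open>1\<close> (lemma \<open>skew_correlation\<close>), and a perturbation of supremum norm at most
  \<open>1/4\<close> changes them by at most \<open>1/4\<close>.\<close>

section \<open>Commutators in two-step nilpotent groups\<close>

definition commutator :: "('a, 'b) monoid_scheme \<Rightarrow> 'a \<Rightarrow> 'a \<Rightarrow> 'a" where
  "commutator G x y = x \<otimes>\<^bsub>G\<^esub> y \<otimes>\<^bsub>G\<^esub> inv\<^bsub>G\<^esub> x \<otimes>\<^bsub>G\<^esub> inv\<^bsub>G\<^esub> y"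

locale two_step_group = group G for G (structure) +
  assumes commutator_central:
    "\<lbrakk>x \<in> carrier G; y \<in> carrier G; z \<in> carrier G\<rbrakk> \<Longrightarrow> z \<otimes> commutator G x y = commutator G x y \<otimes> z"
begin

lemma commutator_closed [simp]: "\<lbrakk>x \<in> carrier G; y \<in> carrier G\<rbrakk> \<Longrightarrow> commutator G x y \<in> carrier G"
  by (simp add: commutator_def)

lemma commutator_swap: "\<lbrakk>x \<in> carrier G; y \<in> carrier G\<rbrakk> \<Longrightarrow> x \<otimes> y = commutator G x y \<otimes> (y \<otimes> x)"
  by (simp add: commutator_def m_assoc inv_solve_left' flip: m_assoc) (simp add: m_assoc)

lemma commutator_eqI:
  assumes "x \<in> carrier G" "y \<in> carrier G" "w \<in> carrier G" "x \<otimes> y = w \<otimes> (y \<otimes> x)"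
  shows "commutator G x y = w"
proof -
  have "commutator G x y \<otimes> (y \<otimes> x) = w \<otimes> (y \<otimes> x)"
    using assms commutator_swap by metis
  then show ?thesis using assms by simp
qed

lemma commutator_mult_left:
  assumes [simp]: "x \<in> carrier G" "y \<in> carrier G" "z \<in> carrier G"
  shows "commutator G (x \<otimes> y) z = commutator G x z \<otimes> commutator G y z"
proof (rule commutator_eqI)
  have "x \<otimes> y \<otimes> z = x \<otimes> (commutator G y z \<otimes> (z \<otimes> y))"
    using commutator_swap[of y z] by (simp add: m_assoc)
  also have "\<dots> = commutator G y z \<otimes> (x \<otimes> z) \<otimes> y"
    using commutator_central[of y z x] by (simp flip: m_assoc)
  also have "\<dots> = commutator G y z \<otimes> (commutator G x z \<otimes> (z \<otimes> x)) \<otimes> y"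
    using commutator_swap[of x z] by simp
  also have "\<dots> = commutator G x z \<otimes> commutator G y z \<otimes> (z \<otimes> (x \<otimes> y))"
    using commutator_central[of x z "commutator G y z"] by (simp flip: m_assoc)
  finally show "x \<otimes> y \<otimes> z = commutator G x z \<otimes> commutator G y z \<otimes> (z \<otimes> (x \<otimes> y))" .
qed auto

lemma commutator_mult_right:
  assumes [simp]: "x \<in> carrier G" "y \<in> carrier G" "z \<in> carrier G"
  shows "commutator G z (x \<otimes> y) = commutator G z x \<otimes> commutator G z y"
proof (rule commutator_eqI)
  have "z \<otimes> (x \<otimes> y) = commutator G z x \<otimes> (x \<otimes> z) \<otimes> y"
    using commutator_swap[of z x] by (simp flip: m_assoc)
  also have "\<dots> = commutator G z x \<otimes> (x \<otimes> (commutator G z y \<otimes> (y \<otimes> z)))"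
    using commutator_swap[of z y] by (simp add: m_assoc)
  also have "\<dots> = commutator G z x \<otimes> commutator G z y \<otimes> (x \<otimes> y \<otimes> z)"
    using commutator_central[of z y x] by (simp add: m_assoc) (simp flip: m_assoc)
  finally show "z \<otimes> (x \<otimes> y) = commutator G z x \<otimes> commutator G z y \<otimes> (x \<otimes> y \<otimes> z)" .
qed auto

lemma commutator_pow_left:
  assumes [simp]: "x \<in> carrier G" "y \<in> carrier G"
  shows "commutator G (x [^] (n::nat)) y = commutator G x y [^] n"
proof (induction n)
  case 0 then show ?case by (intro commutator_eqI) auto
next
  case (Suc n) then show ?case by (simp add: commutator_mult_left)
qed

lemma commutator_pow_right:
  assumes [simp]: "x \<in> carrier G" "y \<in> carrier G"
  shows "commutator G y (x [^] (n::nat)) = commutator G y x [^] n"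
proof (induction n)
  case 0 then show ?case by (intro commutator_eqI) auto
next
  case (Suc n) then show ?case by (simp add: commutator_mult_right)
qed

lemma commutator_in_subgroup:
  "subgroup \<Gamma> G \<Longrightarrow> x \<in> \<Gamma> \<Longrightarrow> y \<in> \<Gamma> \<Longrightarrow> commutator G x y \<in> \<Gamma>"
  by (simp add: commutator_def subgroup.m_closed subgroup.m_inv_closed)

lemma pow_in_subgroup:
  "subgroup \<Gamma> G \<Longrightarrow> x \<in> \<Gamma> \<Longrightarrow> x [^] (n::nat) \<in> \<Gamma>"
  by (induction n) (auto simp: subgroup.one_closed subgroup.m_closed)

text \<open>The identity behind the low complexity of nilsequences; it will be used with \<open>g1\<close>, \<open>g2\<close> powers of one element.
  From \<open>g1\<^sup>b = k' \<gamma>'\<close> and \<open>g2 = l \<mu>\<close> one gets \<open>g1\<^sup>b g2 \<in> k' l [\<gamma>', l] \<Gamma> = l k' [k' \<gamma>', l] \<Gamma> = l k' [k \<gamma>, l]\<^sup>b \<Gamma>\<close>, and by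
  bilinearity \<open>[\<gamma>, l]\<^sup>b\<close> is congruent to \<open>[\<gamma>, g2\<^sup>b]\<close>, hence to \<open>[\<gamma>, l']\<close>, modulo commutators of elements of \<open>\<Gamma>\<close>.
  The point is that the unbounded element \<open>\<gamma>\<close> of \<open>\<Gamma>\<close> occurs only in the central factor \<open>[\<gamma>, l']\<close>, and that
  this factor involves \<open>g2\<close> only through \<open>g2\<^sup>b\<close>.\<close>

lemma product_mod_subgroup:
  assumes \<Gamma>: "subgroup \<Gamma> G" and g12: "g1 \<otimes> g2 = g2 \<otimes> g1"
    and [simp]: "k \<in> carrier G" "l \<in> carrier G" "k' \<in> carrier G" "l' \<in> carrier G"
    and gam: "\<gamma> \<in> \<Gamma>" "\<mu> \<in> \<Gamma>" "\<gamma>' \<in> \<Gamma>" "\<mu>' \<in> \<Gamma>"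
    and g1: "g1 = k \<otimes> \<gamma>" and g2: "g2 = l \<otimes> \<mu>"
    and g1b: "g1 [^] (b::nat) = k' \<otimes> \<gamma>'" and g2b: "g2 [^] b = l' \<otimes> \<mu>'"
  shows "\<exists>\<rho>\<in>\<Gamma>. g1 [^] b \<otimes> g2 = l \<otimes> k' \<otimes> commutator G k l [^] b \<otimes> commutator G \<gamma> l' \<otimes> \<rho>"
proof -
  have [simp]: "\<gamma> \<in> carrier G" "\<mu> \<in> carrier G" "\<gamma>' \<in> carrier G" "\<mu>' \<in> carrier G"
    using gam subgroup.mem_carrier[OF \<Gamma>] by auto
  have [simp]: "g1 \<in> carrier G" "g2 \<in> carrier G" by (auto simp: g1 g2)
  \<comment> \<open>The exponent \<open>b\<close> moves from \<open>[\<gamma>, l]\<close> onto \<open>g2\<close>; what is lost lies in \<open>\<Gamma>\<close>.\<close>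
  have "commutator G \<gamma> l [^] b \<otimes> commutator G \<gamma> \<mu> [^] b = commutator G \<gamma> g2 [^] b"
    by (simp add: g2 commutator_mult_right pow_mult_distrib[OF commutator_central])
  also have "\<dots> = commutator G \<gamma> l' \<otimes> commutator G \<gamma> \<mu>'"
    using commutator_pow_right[of g2 \<gamma> b] commutator_mult_right[of l' \<mu>' \<gamma>] by (simp add: g2b)
  finally have v: "commutator G \<gamma> l [^] b = commutator G \<gamma> l' \<otimes> (commutator G \<gamma> \<mu>' \<otimes> inv (commutator G \<gamma> \<mu> [^] b))"
    by (simp add: inv_solve_right flip: m_assoc)
  have "commutator G g1 g2 = \<one>" using g12 by (intro commutator_eqI) auto
  have e: "commutator G k' l \<otimes> commutator G \<gamma>' l = commutator G k l [^] b \<otimes> commutator G \<gamma> l [^] b"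
  proof -
    have "commutator G k' l \<otimes> commutator G \<gamma>' l = commutator G (g1 [^] b) l"
      by (simp add: g1b commutator_mult_left)
    also have "\<dots> = (commutator G k l \<otimes> commutator G \<gamma> l) [^] b"
      by (simp only: commutator_pow_left \<open>g1 \<in> carrier G\<close> \<open>l \<in> carrier G\<close>) (simp add: g1 commutator_mult_left)
    also have "\<dots> = commutator G k l [^] b \<otimes> commutator G \<gamma> l [^] b"
      by (simp add: pow_mult_distrib[OF commutator_central])
    finally show ?thesis .
  qed
  let ?\<rho> = "(commutator G \<gamma> \<mu>' \<otimes> inv (commutator G \<gamma> \<mu> [^] b)) \<otimes> (\<gamma>' \<otimes> \<mu>)"
  have "g1 [^] b \<otimes> g2 = k' \<otimes> (\<gamma>' \<otimes> l) \<otimes> \<mu>"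
    by (simp only: g1b g2) (simp add: m_assoc)
  also have "\<dots> = k' \<otimes> (commutator G \<gamma>' l \<otimes> (l \<otimes> \<gamma>')) \<otimes> \<mu>"
    using commutator_swap[of \<gamma>' l] by simp
  also have "\<dots> = (k' \<otimes> l) \<otimes> commutator G \<gamma>' l \<otimes> \<gamma>' \<otimes> \<mu>"
    using commutator_central[of \<gamma>' l l] by (simp add: m_assoc)
  also have "\<dots> = (l \<otimes> k') \<otimes> (commutator G k' l \<otimes> commutator G \<gamma>' l) \<otimes> \<gamma>' \<otimes> \<mu>"
  proof -
    have "k' \<otimes> l = (l \<otimes> k') \<otimes> commutator G k' l"
      using commutator_swap[of k' l] commutator_central[of k' l "l \<otimes> k'"] by simp
    then show ?thesis by (simp add: m_assoc)
  qed
  also have "\<dots> = l \<otimes> k' \<otimes> commutator G k l [^] b \<otimes> commutator G \<gamma> l' \<otimes> ?\<rho>"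
    unfolding e v by (simp add: m_assoc)
  finally have "g1 [^] b \<otimes> g2 = l \<otimes> k' \<otimes> commutator G k l [^] b \<otimes> commutator G \<gamma> l' \<otimes> ?\<rho>" .
  moreover have "?\<rho> \<in> \<Gamma>"
    using gam \<Gamma> by (auto intro!: subgroup.m_closed subgroup.m_inv_closed commutator_in_subgroup pow_in_subgroup)
  ultimately show ?thesis by blast
qed

end

lemma nilpotent_step_2_imp_two_step:
  assumes "nilpotent_step 2 G" shows "two_step_group G"
proof -
  interpret group G using assms by (simp add: nilpotent_step_def)
  have lc1: "commutator G x y \<in> lower_central G 1" if "x \<in> carrier G" "y \<in> carrier G" for x y
    using that by (auto simp: commutator_def intro!: generate.incl)
  show ?thesis
  proof
    fix x y z assume xyz: "x \<in> carrier G" "y \<in> carrier G" "z \<in> carrier G"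
    let ?c = "commutator G x y"
    have c: "?c \<in> carrier G" using xyz by (simp add: commutator_def)
    have "?c \<otimes>\<^bsub>G\<^esub> z \<otimes>\<^bsub>G\<^esub> inv\<^bsub>G\<^esub> ?c \<otimes>\<^bsub>G\<^esub> inv\<^bsub>G\<^esub> z \<in> lower_central G (Suc 1)"
      unfolding lower_central.simps(2)[of G 1] using lc1[OF xyz(1,2)] xyz(3) by (intro generate.incl) blast
    then have "?c \<otimes>\<^bsub>G\<^esub> z \<otimes>\<^bsub>G\<^esub> inv\<^bsub>G\<^esub> ?c \<otimes>\<^bsub>G\<^esub> inv\<^bsub>G\<^esub> z = \<one>\<^bsub>G\<^esub>"
      using assms by (simp add: nilpotent_step_def numeral_2_eq_2)
    then show "z \<otimes>\<^bsub>G\<^esub> ?c = ?c \<otimes>\<^bsub>G\<^esub> z"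
      using c xyz by (metis inv_equality inv_inv inv_closed inv_solve_right m_closed m_assoc r_one)
  qed
qed

section \<open>Finite labellings of compact sets\<close>

lemma finite_labels_nat:
  fixes f :: "'x \<Rightarrow> 'b"
  assumes "finite (range f)"
  shows "\<exists>(q::nat) u. (\<forall>x. u x < q) \<and> (\<forall>x y. u x = u y \<longleftrightarrow> f x = f y)"
proof -
  obtain g :: "'b \<Rightarrow> nat" and n where g: "g ` range f = {i. i < n}" "inj_on g (range f)"
    using finite_imp_inj_to_nat_seg[OF assms] by blast
  have "g (f x) < n" for x using g(1) by auto
  moreover have "g (f x) = g (f y) \<longleftrightarrow> f x = f y" for x y using g(2) by (auto dest: inj_onD)
  ultimately show ?thesis by (intro exI[of _ n] exI[of _ "\<lambda>x. g (f x)"]) auto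
qed

lemma openin_prod_topologyE:
  assumes "openin (prod_topology X Y) S" "(x, y) \<in> S"
  obtains U V where "openin X U" "openin Y V" "x \<in> U" "y \<in> V" "U \<times> V \<subseteq> S"
proof -
  have "\<exists>U V. openin X U \<and> openin Y V \<and> x \<in> U \<and> y \<in> V \<and> U \<times> V \<subseteq> S"
    using assms(1)[unfolded openin_prod_topology_alt] assms(2) by simp
  then show ?thesis using that by (elim exE conjE)
qed

text \<open>Uniform continuity in a form that needs no metric on the domain: cover the product of compact sets by finitely
  many boxes on which \<open>F\<close> oscillates by less than \<open>\<delta>\<close>, and label a point of a factor by the set of the boxes
  whose projection contains it. Points with equal labels lie in a common box. Labelling the factors
  separately is essential: below, the factors belong to the row and to the column of a matrix entry, and only
  linearly many labels may be used for quadratically many entries.\<close>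

lemma finite_labelling:
  fixes F :: "'a \<times> 'b \<times> 'c \<Rightarrow> 'm::metric_space"
  assumes F: "continuous_map (prod_topology X (prod_topology Y Z)) euclidean F"
    and K: "compactin X K" and L: "compactin Y L" and M: "compactin Z M" and \<delta>: "\<delta> > 0"
  shows "\<exists>(p::nat) f g h. (\<forall>x. f x < p) \<and> (\<forall>y. g y < p) \<and> (\<forall>z. h z < p) \<and>
    (\<forall>x\<in>K. \<forall>y\<in>L. \<forall>z\<in>M. \<forall>x'\<in>K. \<forall>y'\<in>L. \<forall>z'\<in>M.
       f x = f x' \<longrightarrow> g y = g y' \<longrightarrow> h z = h z' \<longrightarrow> dist (F (x, y, z)) (F (x', y', z')) < \<delta>)"
proof -
  let ?P = "prod_topology X (prod_topology Y Z)"
  have comp: "compactin ?P (K \<times> L \<times> M)"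
    using K L M by (simp add: compactin_Times)
  have sub: "K \<times> L \<times> M \<subseteq> topspace ?P"
    using comp by (rule compactin_subset_topspace)
  define \<B> where "\<B> = {(U, V, W). openin X U \<and> openin Y V \<and> openin Z W \<and>
      (\<forall>w\<in>U \<times> V \<times> W. \<forall>w'\<in>U \<times> V \<times> W. dist (F w) (F w') < \<delta>)}"
  let ?box = "\<lambda>(U, V, W). U \<times> V \<times> W"
  have cover: "\<exists>D\<in>\<B>. (x, y, z) \<in> ?box D" if w: "(x, y, z) \<in> K \<times> L \<times> M" for x y z
  proof -
    let ?S = "{w' \<in> topspace ?P. F w' \<in> ball (F (x, y, z)) (\<delta> / 2)}"
    have *: "openin ?P ?S"
      using F by (rule openin_continuous_map_preimage) simp
    have "(x, y, z) \<in> ?S"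
      using w sub \<delta> by auto
    with * obtain U Q where UQ: "openin X U" "openin (prod_topology Y Z) Q" "x \<in> U" "(y, z) \<in> Q"
        "U \<times> Q \<subseteq> ?S"
      by (rule openin_prod_topologyE)
    obtain V W where VW: "openin Y V" "openin Z W" "y \<in> V" "z \<in> W" "V \<times> W \<subseteq> Q"
      using UQ(2,4) by (rule openin_prod_topologyE)
    have close: "dist (F (x, y, z)) (F w) < \<delta> / 2" if "w \<in> U \<times> V \<times> W" for w
    proof -
      have "w \<in> ?S" using that UQ(5) VW(5) by auto
      then show ?thesis by simp
    qed
    have "dist (F w) (F w') < \<delta>" if "w \<in> U \<times> V \<times> W" "w' \<in> U \<times> V \<times> W" for w w'
      using close[OF that(1)] close[OF that(2)] by (rule dist_triangle_half_r)
    then have "(U, V, W) \<in> \<B>" using UQ VW by (simp add: \<B>_def)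
    then show ?thesis using UQ VW by (intro bexI[of _ "(U, V, W)"]) auto
  qed
  have "\<exists>\<F>. finite \<F> \<and> \<F> \<subseteq> ?box ` \<B> \<and> K \<times> L \<times> M \<subseteq> \<Union>\<F>"
  proof (intro compactinD[OF comp])
    show "openin ?P U" if "U \<in> ?box ` \<B>" for U
      using that by (auto simp: \<B>_def openin_prod_Times_iff)
    show "K \<times> L \<times> M \<subseteq> \<Union>(?box ` \<B>)"
    proof
      fix w assume "w \<in> K \<times> L \<times> M"
      then show "w \<in> \<Union>(?box ` \<B>)"
        by (cases w rule: prod_cases3) (use cover in \<open>simp only: UN_iff\<close>)
    qed
  qed
  then obtain \<F> where \<F>: "finite \<F>" "\<F> \<subseteq> ?box ` \<B>" "K \<times> L \<times> M \<subseteq> \<Union>\<F>" by (elim exE conjE)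
  from finite_subset_image[OF \<F>(1,2)] \<F>(3)
  obtain S where S: "finite S" "S \<subseteq> \<B>" "K \<times> L \<times> M \<subseteq> \<Union>(?box ` S)" by (elim exE conjE) simp
  have fin: "finite (range (\<lambda>x. {w\<in>S. P x w}))" for P :: "'x \<Rightarrow> _"
    by (rule finite_subset[of _ "Pow S"]) (use S in auto)
  obtain q1 and f where f: "\<And>x. f x < (q1::nat)"
      "\<And>x y. f x = f y \<longleftrightarrow> {w\<in>S. x \<in> fst w} = {w\<in>S. y \<in> fst w}"
    using finite_labels_nat[OF fin[of "\<lambda>x w. x \<in> fst w"]] by blast
  obtain q2 and g where g: "\<And>x. g x < (q2::nat)"
      "\<And>x y. g x = g y \<longleftrightarrow> {w\<in>S. x \<in> fst (snd w)} = {w\<in>S. y \<in> fst (snd w)}"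
    using finite_labels_nat[OF fin[of "\<lambda>x w. x \<in> fst (snd w)"]] by blast
  obtain q3 and h where h: "\<And>x. h x < (q3::nat)"
      "\<And>x y. h x = h y \<longleftrightarrow> {w\<in>S. x \<in> snd (snd w)} = {w\<in>S. y \<in> snd (snd w)}"
    using finite_labels_nat[OF fin[of "\<lambda>x w. x \<in> snd (snd w)"]] by blast
  show ?thesis
  proof (rule exI[of _ "q1 + q2 + q3"], rule exI[of _ f], rule exI[of _ g], rule exI[of _ h], intro conjI allI ballI impI)
    show "f x < q1 + q2 + q3" for x using f(1)[of x] by simp
    show "g x < q1 + q2 + q3" for x using g(1)[of x] by simp
    show "h x < q1 + q2 + q3" for x using h(1)[of x] by simp
    fix x y z x' y' z'
    assume *: "x \<in> K" "y \<in> L" "z \<in> M" "x' \<in> K" "y' \<in> L" "z' \<in> M" "f x = f x'" "g y = g y'" "h z = h z'"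
    then have "(x, y, z) \<in> \<Union>(?box ` S)" using S(3) by blast
    then obtain D where D: "D \<in> S" "(x, y, z) \<in> ?box D" by (rule UN_E)
    obtain U V W where "D = (U, V, W)" by (rule prod_cases3)
    with D have w: "(U, V, W) \<in> S" "x \<in> U" "y \<in> V" "z \<in> W"
      by simp_all
    have "(U, V, W) \<in> {w \<in> S. x' \<in> fst w}" using w *(7) unfolding f(2) by (metis (mono_tags, lifting) CollectI fst_conv)
    moreover have "(U, V, W) \<in> {w \<in> S. y' \<in> fst (snd w)}" using w *(8) unfolding g(2) by (metis (mono_tags, lifting) CollectI fst_conv snd_conv)
    moreover have "(U, V, W) \<in> {w \<in> S. z' \<in> snd (snd w)}" using w *(9) unfolding h(2) by (metis (mono_tags, lifting) CollectI snd_conv)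
    ultimately have w': "(x', y', z') \<in> U \<times> V \<times> W" by simp
    have "\<forall>w\<in>U \<times> V \<times> W. \<forall>w'\<in>U \<times> V \<times> W. dist (F w) (F w') < \<delta>"
      using w(1) S(2) by (auto simp: \<B>_def)
    then have "\<forall>w'\<in>U \<times> V \<times> W. dist (F (x, y, z)) (F w') < \<delta>"
      by (rule bspec) (use w in simp)
    then show "dist (F (x, y, z)) (F (x', y', z')) < \<delta>"
      using w' by (rule bspec)
  qed
qed

section \<open>Compact transversals of cocompact subgroups\<close>

lemma lie_group_locally_compact:
  assumes "lie_group G X" "x \<in> carrier G"
  shows "\<exists>U C. openin X U \<and> compactin X C \<and> x \<in> U \<and> U \<subseteq> C"
proof -
  obtain d \<A> where top: "topspace X = carrier G" and \<A>: "smooth_atlas d X \<A>"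
    using assms(1) unfolding lie_group_def by blast
  have "x \<in> (\<Union>(U, \<psi>)\<in>\<A>. U)"
    using assms(2) \<A> top unfolding smooth_atlas_def by simp
  then obtain U \<psi> where U: "(U, \<psi>) \<in> \<A>" "x \<in> U" by blast
  from \<A> U have op: "openin X U" "openin (Euclidean_space d) (\<psi> ` U)"
    and hom: "homeomorphic_map (subtopology X U) (subtopology (Euclidean_space d) (\<psi> ` U))  \<psi>"
    unfolding smooth_atlas_def by auto
  have "locally_compact_space (subtopology (Euclidean_space d) (\<psi> ` U))"
    by (rule locally_compact_space_open_subset)
       (use op in \<open>auto simp: locally_compact_Euclidean_space Hausdorff_Euclidean_space\<close>)
  then have "locally_compact_space (subtopology X U)"
    using hom homeomorphic_locally_compact_space homeomorphic_map_imp_homeomorphic_space by blast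
  moreover have "x \<in> topspace (subtopology X U)" using U(2) assms(2) top by simp
  ultimately obtain V C where "openin (subtopology X U) V" "compactin (subtopology X U) C" "x \<in> V" "V \<subseteq> C"
    unfolding locally_compact_space_def by blast
  then show ?thesis
    using op(1) by (metis openin_open_subtopology compactin_subtopology)
qed

lemma (in group) l_coset_eq_iff:
  assumes "subgroup \<Gamma> G" "x \<in> carrier G" "y \<in> carrier G"
  shows "x <# \<Gamma> = y <# \<Gamma> \<longleftrightarrow> (\<exists>\<gamma>\<in>\<Gamma>. y = x \<otimes> \<gamma>)"
proof
  assume "x <# \<Gamma> = y <# \<Gamma>"
  moreover have "y \<in> y <# \<Gamma>"
    using assms by (auto simp: l_coset_def intro!: bexI[of _ \<one>] subgroup.one_closed)
  ultimately show "\<exists>\<gamma>\<in>\<Gamma>. y = x \<otimes> \<gamma>" by (auto simp: l_coset_def)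
next
  assume "\<exists>\<gamma>\<in>\<Gamma>. y = x \<otimes> \<gamma>"
  then have "y \<in> x <# \<Gamma>" by (auto simp: l_coset_def)
  then show "x <# \<Gamma> = y <# \<Gamma>" using l_repr_independence assms by blast
qed

text \<open>The projection \<open>G \<rightarrow> G/\<Gamma>\<close> is open, because the saturation of an open set is a union of translates of it. So the images of
  relatively compact open sets form an open cover of the compact quotient.\<close>

lemma lie_group_compact_transversal:
  assumes lie: "lie_group G X" and cc: "discrete_cocompact_subgroup G X \<Gamma>"
  obtains K where "compactin X K" "\<And>g. g \<in> carrier G \<Longrightarrow> \<exists>k\<in>K. \<exists>\<gamma>\<in>\<Gamma>. g = k \<otimes>\<^bsub>G\<^esub> \<gamma>"
proof -
  have top: "topspace X = carrier G" and "group G"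
    and mult: "continuous_map (prod_topology X X) X (\<lambda>(x, y). x \<otimes>\<^bsub>G\<^esub> y)"
    using lie unfolding lie_group_def by auto
  interpret group G by fact
  obtain Y where \<Gamma>: "subgroup \<Gamma> G" and quot: "quotient_map X Y (\<lambda>x. x <#\<^bsub>G\<^esub> \<Gamma>)" and Y: "compact_space Y"
    using cc unfolding discrete_cocompact_subgroup_def by blast
  let ?\<pi> = "\<lambda>x. x <#\<^bsub>G\<^esub> \<Gamma>"
  have surj: "?\<pi> ` carrier G = topspace Y"
    using quot top by (simp add: quotient_map_def)
  have opn: "openin Y (?\<pi> ` U)" if U: "openin X U" for U
  proof -
    have UG: "U \<subseteq> carrier G" using U top openin_subset by blast
    have "{x \<in> topspace X. ?\<pi> x \<in> ?\<pi> ` U} = (\<Union>\<gamma>\<in>\<Gamma>. {x \<in> topspace X. x \<otimes>\<^bsub>G\<^esub> \<gamma> \<in> U})"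
    proof (intro subset_antisym subsetI)
      fix x assume "x \<in> {x \<in> topspace X. ?\<pi> x \<in> ?\<pi> ` U}"
      then obtain y where "x \<in> carrier G" "y \<in> U" "?\<pi> x = ?\<pi> y" using top by auto
      then show "x \<in> (\<Union>\<gamma>\<in>\<Gamma>. {x \<in> topspace X. x \<otimes>\<^bsub>G\<^esub> \<gamma> \<in> U})"
        using l_coset_eq_iff[OF \<Gamma>, of x y] UG top by auto
    next
      fix x assume "x \<in> (\<Union>\<gamma>\<in>\<Gamma>. {x \<in> topspace X. x \<otimes>\<^bsub>G\<^esub> \<gamma> \<in> U})"
      then obtain \<gamma> where *: "x \<in> carrier G" "\<gamma> \<in> \<Gamma>" "x \<otimes>\<^bsub>G\<^esub> \<gamma> \<in> U" using top by auto
      then have "?\<pi> x = ?\<pi> (x \<otimes>\<^bsub>G\<^esub> \<gamma>)"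
        using l_coset_eq_iff[OF \<Gamma>, of x "x \<otimes>\<^bsub>G\<^esub> \<gamma>"] UG by blast
      with * show "x \<in> {x \<in> topspace X. ?\<pi> x \<in> ?\<pi> ` U}" using top by auto
    qed
    moreover have "openin X {x \<in> topspace X. x \<otimes>\<^bsub>G\<^esub> \<gamma> \<in> U}" if "\<gamma> \<in> \<Gamma>" for \<gamma>
    proof -
      have "continuous_map X (prod_topology X X) (\<lambda>x. (x, \<gamma>))"
        using subgroup.mem_carrier[OF \<Gamma> that] top by (simp add: continuous_map_pairedI)
      from continuous_map_compose[OF this mult]
      have "continuous_map X X (\<lambda>x. x \<otimes>\<^bsub>G\<^esub> \<gamma>)" by (simp add: o_def)
      then show ?thesis using U by (rule openin_continuous_map_preimage)
    qed
    ultimately have "openin X {x \<in> topspace X. ?\<pi> x \<in> ?\<pi> ` U}" by auto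
    moreover have "?\<pi> ` U \<subseteq> topspace Y" using surj UG by blast
    ultimately show ?thesis using quot by (simp add: quotient_map_def)
  qed
  have "\<forall>x\<in>carrier G. \<exists>U C. openin X U \<and> compactin X C \<and> x \<in> U \<and> U \<subseteq> C"
    using lie_group_locally_compact[OF lie] by blast
  then obtain U C where UC: "\<And>x. x \<in> carrier G \<Longrightarrow> openin X (U x) \<and> compactin X (C x) \<and> x \<in> U x \<and> U x \<subseteq> C x"
    by metis
  have "\<exists>\<F>. finite \<F> \<and> \<F> \<subseteq> (\<lambda>x. ?\<pi> ` U x) ` carrier G \<and> topspace Y \<subseteq> \<Union>\<F>"
  proof (rule compactinD)
    show "compactin Y (topspace Y)" using Y by (simp add: compact_space_def)
    show "topspace Y \<subseteq> \<Union>((\<lambda>x. ?\<pi> ` U x) ` carrier G)"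
      unfolding surj[symmetric] using UC by blast
  qed (use UC opn in auto)
  then obtain S where S: "finite S" "S \<subseteq> carrier G" "topspace Y \<subseteq> \<Union>((\<lambda>x. ?\<pi> ` U x) ` S)"
    by (metis (no_types, lifting) finite_subset_image)
  show ?thesis
  proof (rule that[of "\<Union>(C ` S)"])
    show "compactin X (\<Union>(C ` S))" using S UC by (intro compactin_Union) auto
    fix g assume g: "g \<in> carrier G"
    then have "?\<pi> g \<in> topspace Y" using surj by blast
    then obtain x y where xy: "x \<in> S" "y \<in> U x" "?\<pi> y = ?\<pi> g" using S by blast
    then have x: "x \<in> carrier G" using S by blast
    then have y: "y \<in> C x" "y \<in> carrier G"
      using UC[OF x] xy openin_subset[of X "U x"] top by auto
    then obtain \<gamma> where "\<gamma> \<in> \<Gamma>" "g = y \<otimes>\<^bsub>G\<^esub> \<gamma>"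
      using l_coset_eq_iff[OF \<Gamma> y(2) g] xy(3) by auto
    with y(1) xy(1) show "\<exists>k\<in>\<Union>(C ` S). \<exists>\<gamma>\<in>\<Gamma>. g = k \<otimes>\<^bsub>G\<^esub> \<gamma>"
      by blast
  qed
qed

locale topological_two_step_group = two_step_group +
  fixes X
  assumes topspace: "topspace X = carrier G"
    and continuous_mult: "continuous_map (prod_topology X X) X (\<lambda>(x, y). x \<otimes> y)"
    and continuous_inv: "continuous_map X X (\<lambda>x. inv x)"
begin

lemma continuous_map_mult:
  assumes "continuous_map P X f" "continuous_map P X g"
  shows "continuous_map P X (\<lambda>w. f w \<otimes> g w)"
  using continuous_map_compose[OF continuous_map_pairedI[OF assms] continuous_mult] by (simp add: o_def)

lemma continuous_map_inv:
  assumes "continuous_map P X f" shows "continuous_map P X (\<lambda>w. inv (f w))"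
  using continuous_map_compose[OF assms continuous_inv] by (simp add: o_def)

lemma continuous_map_pow:
  assumes "continuous_map P X f" shows "continuous_map P X (\<lambda>w. f w [^] (n::nat))"
  by (induction n) (auto simp: topspace intro!: continuous_map_mult assms)

lemma continuous_map_commutator:
  assumes "continuous_map P X f" "continuous_map P X g"
  shows "continuous_map P X (\<lambda>w. commutator G (f w) (g w))"
  unfolding commutator_def by (intro continuous_map_mult continuous_map_inv assms)

end

section \<open>Nilsequences along sums of two powers\<close>

text \<open>On the grid of the numbers \<open>b\<^bsup>i+h\<^esup> + b\<^sup>j\<close>, the label \<open>u\<close> belongs to the row \<open>i\<close>, the label \<open>v\<close> to the column \<open>j\<close>, and the label
  \<open>t\<close> is shared by all pairs \<open>(i + h, j)\<close> with given \<open>i\<close> and \<open>j + h\<close>. The order of the quantifiers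
  matters: the number \<open>r\<close> of values of \<open>t\<close> is fixed before \<open>H\<close>, while \<open>q\<close> may grow with \<open>H\<close>. With \<open>i\<close> restricted to multiples
  of \<open>H\<close>, an \<open>n \<times> n\<close> block needs about \<open>n\<^sup>2/H\<close> labels \<open>t\<close>.\<close>

definition low_complexity :: "nat \<Rightarrow> (int \<Rightarrow> complex) \<Rightarrow> bool" where
  "low_complexity b a \<longleftrightarrow>
     (\<exists>C. \<forall>n. cmod (a n) \<le> C) \<and>
     (\<forall>\<delta>>0. \<exists>r::nat. \<forall>H::nat. \<exists>(q::nat) (u::nat\<Rightarrow>nat) (v::nat\<Rightarrow>nat) (t::nat\<Rightarrow>nat\<Rightarrow>nat).
        (\<forall>i. u i < q) \<and> (\<forall>j. v j < q) \<and> (\<forall>i j. t i j < r) \<and>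
        (\<forall>h<H. \<forall>i j i' j'. u i = u i' \<and> v j = v j' \<and> t i (j + h) = t i' (j' + h) \<longrightarrow>
           cmod (a (int (b ^ (i + h) + b ^ j)) - a (int (b ^ (i' + h) + b ^ j'))) \<le> \<delta>))"

context topological_two_step_group
begin

text \<open>By \<open>product_mod_subgroup\<close> the point \<open>g\<close> to the power \<open>b\<^bsup>i+h\<^esup> + b\<^sup>j\<close> is \<open>p c\<close> modulo \<open>\<Gamma>\<close>, where \<open>p\<close> is a word in \<open>k\<^sub>i\<close>, \<open>k\<^bsub>i+h\<^esub>\<close>, \<open>k\<^sub>j\<close> and
  \<open>c = [\<gamma>\<^sub>i, k\<^bsub>j+h\<^esub>]\<close>. The word \<open>p\<close> depends on \<open>h\<close> and may leave every compact set as \<open>h\<close> grows. But \<open>c\<close> is central, so \<open>p c \<Gamma> = k c \<Gamma>\<close>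
  for a representative \<open>k \<in> K\<close> of \<open>p \<Gamma>\<close>, and likewise \<open>k c \<Gamma> = k \<kappa> \<Gamma>\<close> for a representative \<open>\<kappa> \<in> K\<close> of \<open>c \<Gamma>\<close>. Therefore the
  precision with which \<open>\<kappa>\<close> must be known does not depend on \<open>h\<close>, which makes \<open>r\<close> independent of \<open>H\<close>.\<close>

lemma nil_orbit_low_complexity:
  fixes \<phi> :: "'a \<Rightarrow> complex"
  assumes \<Gamma>: "subgroup \<Gamma> G"
    and K: "compactin X K" and K\<Gamma>: "\<And>g. g \<in> carrier G \<Longrightarrow> \<exists>k\<in>K. \<exists>\<gamma>\<in>\<Gamma>. g = k \<otimes> \<gamma>"
    and \<phi>: "continuous_map X euclidean \<phi>" and inv: "\<And>x \<gamma>. \<lbrakk>x \<in> carrier G; \<gamma> \<in> \<Gamma>\<rbrakk> \<Longrightarrow> \<phi> (x \<otimes> \<gamma>) = \<phi> x"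
    and g: "g \<in> carrier G" and \<delta>: "\<delta> > 0"
  shows "\<exists>r::nat. \<forall>H::nat. \<exists>(q::nat) (u::nat\<Rightarrow>nat) (v::nat\<Rightarrow>nat) (t::nat\<Rightarrow>nat\<Rightarrow>nat).
        (\<forall>i. u i < q) \<and> (\<forall>j. v j < q) \<and> (\<forall>i j. t i j < r) \<and>
        (\<forall>h<H. \<forall>i j i' j'. u i = u i' \<and> v j = v j' \<and> t i (j + h) = t i' (j' + h) \<longrightarrow>
           cmod (\<phi> (g [^] (b ^ (i + h) + b ^ j :: nat)) - \<phi> (g [^] (b ^ (i' + h) + b ^ j' :: nat))) \<le> \<delta>)"
proof -
  have KG: "K \<subseteq> carrier G" using compactin_subset_topspace[OF K] topspace by simp
  have \<Gamma>G: "\<Gamma> \<subseteq> carrier G" using \<Gamma> by (rule subgroup.subset)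
  have [simp]: "g [^] (n::nat) \<in> carrier G" for n using g by simp
  obtain k \<gamma> where k: "\<And>i. k i \<in> K" and \<gamma>: "\<And>i. \<gamma> i \<in> \<Gamma>" and k\<gamma>: "\<And>i. g [^] (b ^ i) = k i \<otimes> \<gamma> i"
    using K\<Gamma>[of "g [^] (b ^ i)" for i] by simp metis
  have [simp]: "k i \<in> carrier G" "\<gamma> i \<in> carrier G" for i
    using k \<gamma> KG \<Gamma>G by auto
  define c where "c = (\<lambda>i m. commutator G (\<gamma> i) (k m))"
  have [simp]: "c i m \<in> carrier G" for i m by (simp add: c_def)
  obtain \<kappa> \<rho> where \<kappa>: "\<And>i m. \<kappa> i m \<in> K" and \<rho>: "\<And>i m. \<rho> i m \<in> \<Gamma>" and \<kappa>\<rho>: "\<And>i m. c i m = \<kappa> i m \<otimes> \<rho> i m"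
    using K\<Gamma>[of "c i m" for i m] by simp metis
  have [simp]: "\<kappa> i m \<in> carrier G" "\<rho> i m \<in> carrier G" for i m
    using \<kappa> \<rho> KG \<Gamma>G by auto
  have \<phi>\<kappa>: "\<phi> (x \<otimes> c i m) = \<phi> (x \<otimes> \<kappa> i m)" if "x \<in> carrier G" for x i m
    using inv[of "x \<otimes> \<kappa> i m" "\<rho> i m"] that \<rho> by (simp add: \<kappa>\<rho> m_assoc)
  \<comment> \<open>Labels for the central factors: chosen before \<open>H\<close>, from the restriction of \<open>\<phi>\<close> to \<open>K K\<close>.\<close>
  have "continuous_map (prod_topology X (prod_topology X X)) euclidean (\<phi> \<circ> (\<lambda>w. fst w \<otimes> fst (snd w)))"
    by (rule continuous_map_compose[OF _ \<phi>])
       (intro continuous_map_mult continuous_map_fst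
         continuous_map_compose[OF continuous_map_snd continuous_map_fst, unfolded o_def])
  from finite_labelling[OF this K K K half_gt_zero[OF \<delta>]]
  obtain r f l f' where lr: "\<forall>x. l x < (r::nat)"
    and *: "\<forall>x\<in>K. \<forall>y\<in>K. \<forall>z\<in>K. \<forall>x'\<in>K. \<forall>y'\<in>K. \<forall>z'\<in>K.
      f x = (f x' :: nat) \<longrightarrow> l y = l y' \<longrightarrow> f' z = (f' z' :: nat) \<longrightarrow>
      dist ((\<phi> \<circ> (\<lambda>w. fst w \<otimes> fst (snd w))) (x, y, z)) ((\<phi> \<circ> (\<lambda>w. fst w \<otimes> fst (snd w))) (x', y', z')) < \<delta> / 2"
    by (elim exE conjE)
  have l': "cmod (\<phi> (x \<otimes> y) - \<phi> (x \<otimes> y')) < \<delta> / 2" if "x \<in> K" "y \<in> K" "y' \<in> K" "l y = l y'" for x y y'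
    using *[rule_format, of x y x x y' x] that by (simp add: dist_norm)
  have vert: "cmod (\<phi> (x \<otimes> c i m) - \<phi> (x \<otimes> c i' m')) \<le> \<delta> / 2"
    if x: "x \<in> carrier G" and eq: "l (\<kappa> i m) = l (\<kappa> i' m')" for x i m i' m'
  proof -
    obtain x0 \<gamma>0 where x0: "x0 \<in> K" "\<gamma>0 \<in> \<Gamma>" "x = x0 \<otimes> \<gamma>0" using K\<Gamma>[OF x] by blast
    then have [simp]: "x0 \<in> carrier G" "\<gamma>0 \<in> carrier G" using KG \<Gamma>G by auto
    have "\<phi> (x \<otimes> c i m) = \<phi> (x0 \<otimes> \<kappa> i m)" for i m
    proof -
      have "x \<otimes> c i m = x0 \<otimes> c i m \<otimes> \<gamma>0"
        using commutator_central[of "\<gamma> i" "k m" \<gamma>0] by (simp add: x0 c_def m_assoc)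
      then show ?thesis using inv[of "x0 \<otimes> c i m" \<gamma>0] x0 \<phi>\<kappa>[of x0 i m] by simp
    qed
    then show ?thesis using l'[OF x0(1) \<kappa> \<kappa> eq] by simp
  qed
  show ?thesis
  proof (rule exI[of _ r], rule allI)
    fix H :: nat
    \<comment> \<open>Labels for the factors before the central one: for each \<open>h < H\<close> separately, then combined.\<close>
    define p where "p = (\<lambda>h k k' l. l \<otimes> k' \<otimes> commutator G k l [^] (b ^ h))"
    have pG: "p h (k i) (k i') (k j) \<in> carrier G" for h i i' j by (simp add: p_def)
    define good where "good = (\<lambda>h (q::nat) f f'. (\<forall>x. f x < q) \<and> (\<forall>x. f' x < q) \<and>
      (\<forall>x\<in>K \<times> K. \<forall>x'\<in>K \<times> K. \<forall>y\<in>K. \<forall>y'\<in>K. \<forall>z\<in>K. f x = f x' \<and> f' y = f' y' \<longrightarrow>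
        cmod (\<phi> (p h (fst x) (snd x) y \<otimes> z) - \<phi> (p h (fst x') (snd x') y' \<otimes> z)) \<le> \<delta> / 2))"
    have "\<exists>q f f'. good h q f f'" for h
    proof -
      let ?P = "prod_topology (prod_topology X X) (prod_topology X X)"
      have 1: "continuous_map ?P X (\<lambda>w. fst (fst w))" "continuous_map ?P X (\<lambda>w. snd (fst w))"
           "continuous_map ?P X (\<lambda>w. fst (snd w))" "continuous_map ?P X (\<lambda>w. snd (snd w))"
        by (rule continuous_map_compose[OF continuous_map_fst continuous_map_fst, unfolded o_def]
              continuous_map_compose[OF continuous_map_fst continuous_map_snd, unfolded o_def]
              continuous_map_compose[OF continuous_map_snd continuous_map_fst, unfolded o_def]
              continuous_map_compose[OF continuous_map_snd continuous_map_snd, unfolded o_def])+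
      have cont: "continuous_map ?P euclidean (\<phi> \<circ> (\<lambda>w. p h (fst (fst w)) (snd (fst w)) (fst (snd w)) \<otimes> snd (snd w)))"
        unfolding p_def by (rule continuous_map_compose[OF _ \<phi>])
          (intro continuous_map_mult continuous_map_pow continuous_map_commutator 1)
      have KK: "compactin (prod_topology X X) (K \<times> K)" using K by (simp add: compactin_Times)
      from finite_labelling[OF cont KK K K half_gt_zero[OF \<delta>]]
      obtain q f f' f'' where f: "\<forall>x. f x < (q::nat)" "\<forall>x. f' x < q"
        and *: "\<forall>x\<in>K \<times> K. \<forall>y\<in>K. \<forall>z\<in>K. \<forall>x'\<in>K \<times> K. \<forall>y'\<in>K. \<forall>z'\<in>K.
          f x = f x' \<longrightarrow> f' y = f' y' \<longrightarrow> f'' z = (f'' z' :: nat) \<longrightarrow>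
          dist ((\<phi> \<circ> (\<lambda>w. p h (fst (fst w)) (snd (fst w)) (fst (snd w)) \<otimes> snd (snd w))) (x, y, z))
               ((\<phi> \<circ> (\<lambda>w. p h (fst (fst w)) (snd (fst w)) (fst (snd w)) \<otimes> snd (snd w))) (x', y', z')) < \<delta> / 2"
        by (elim exE conjE)
      have close: "cmod (\<phi> (p h (fst x) (snd x) y \<otimes> z) - \<phi> (p h (fst x') (snd x') y' \<otimes> z)) \<le> \<delta> / 2"
        if "x \<in> K \<times> K" "x' \<in> K \<times> K" "y \<in> K" "y' \<in> K" "z \<in> K" "f x = f x'" "f' y = f' y'" for x x' y y' z
        using *[rule_format, of x y z x' y' z] that by (simp add: dist_norm)
      have "good h q f f'"
        unfolding good_def by (intro conjI f ballI impI close; (elim conjE)?; assumption)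
      then show ?thesis by blast
    qed
    then obtain Q f f' where *: "\<And>h. good h (Q h) (f h) (f' h)"
      by metis
    then have f: "f h x < Q h" "f' h y < Q h" for h x y using *[of h] unfolding good_def by blast+
    have p: "cmod (\<phi> (p h (fst x) (snd x) y \<otimes> z) - \<phi> (p h (fst x') (snd x') y' \<otimes> z)) \<le> \<delta> / 2"
      if "x \<in> K \<times> K" "x' \<in> K \<times> K" "y \<in> K" "y' \<in> K" "z \<in> K" "f h x = f h x'" "f' h y = f' h y'" for h x x' y y' z
      by (rule *[of h, unfolded good_def, THEN conjunct2, THEN conjunct2, THEN bspec, OF that(1), THEN bspec, OF that(2),
            THEN bspec, OF that(3), THEN bspec, OF that(4), THEN bspec, OF that(5), THEN mp, OF conjI[OF that(6,7)]])
    have fin: "finite (range (\<lambda>i. \<lambda>h\<in>{..<H}. F h i))" if "\<And>h i. F h i < Q h" for F :: "nat \<Rightarrow> nat \<Rightarrow> nat"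
    proof (rule finite_subset)
      show "range (\<lambda>i. \<lambda>h\<in>{..<H}. F h i) \<subseteq> PiE {..<H} (\<lambda>h. {..<Q h})"
        using that by (intro image_subsetI) (simp add: restrict_PiE_iff)
    qed (simp add: finite_PiE)
    from finite_labels_nat[OF fin[of "\<lambda>h i. f h (k i, k (i + h))", OF f(1)]]
    obtain q1 u where u: "\<forall>i. u i < (q1::nat)"
      "\<forall>i i'. u i = u i' \<longleftrightarrow> (\<lambda>h\<in>{..<H}. f h (k i, k (i + h))) = (\<lambda>h\<in>{..<H}. f h (k i', k (i' + h)))"
      by (elim exE conjE)
    from finite_labels_nat[OF fin[of "\<lambda>h j. f' h (k j)", OF f(2)]]
    obtain q2 v where v: "\<forall>j. v j < (q2::nat)"
      "\<forall>j j'. v j = v j' \<longleftrightarrow> (\<lambda>h\<in>{..<H}. f' h (k j)) = (\<lambda>h\<in>{..<H}. f' h (k j'))"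
      by (elim exE conjE)
    have val: "\<phi> (g [^] (b ^ (i + h) + b ^ j)) = \<phi> (p h (k i) (k (i + h)) (k j) \<otimes> c i (j + h))" for i j h
    proof -
      have comm: "g [^] (b ^ i) \<otimes> g [^] (b ^ j) = g [^] (b ^ j) \<otimes> g [^] (b ^ i)"
        using g by (simp add: nat_pow_mult add.commute)
      have p1: "(g [^] (b ^ i)) [^] (b ^ h) = k (i + h) \<otimes> \<gamma> (i + h)"
           and p2: "(g [^] (b ^ j)) [^] (b ^ h) = k (j + h) \<otimes> \<gamma> (j + h)"
        using g by (simp_all add: nat_pow_pow flip: k\<gamma> power_add)
      obtain \<sigma> where \<sigma>: "\<sigma> \<in> \<Gamma>" "(g [^] (b ^ i)) [^] (b ^ h) \<otimes> g [^] (b ^ j) =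
          k j \<otimes> k (i + h) \<otimes> commutator G (k i) (k j) [^] (b ^ h) \<otimes> commutator G (\<gamma> i) (k (j + h)) \<otimes> \<sigma>"
        using product_mod_subgroup[OF \<Gamma> comm _ _ _ _ \<gamma> \<gamma> \<gamma> \<gamma> k\<gamma> k\<gamma> p1 p2] by auto
      have "g [^] (b ^ (i + h) + b ^ j) = (g [^] (b ^ i)) [^] (b ^ h) \<otimes> g [^] (b ^ j)"
        using g by (simp add: nat_pow_pow nat_pow_mult power_add)
      also have "\<dots> = p h (k i) (k (i + h)) (k j) \<otimes> c i (j + h) \<otimes> \<sigma>"
        unfolding \<sigma>(2) p_def c_def ..
      finally show ?thesis using inv[OF _ \<sigma>(1)] pG by simp
    qed
    have main: "cmod (\<phi> (g [^] (b ^ (i + h) + b ^ j)) - \<phi> (g [^] (b ^ (i' + h) + b ^ j'))) \<le> \<delta>"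
      if h: "h < H" and eq: "u i = u i'" "v j = v j'" "l (\<kappa> i (j + h)) = l (\<kappa> i' (j' + h))" for h i j i' j'
    proof -
      let ?c = "c i (j + h)" and ?c' = "c i' (j' + h)"
      let ?p = "p h (k i) (k (i + h)) (k j)" and ?p' = "p h (k i') (k (i' + h)) (k j')"
      have "f h (k i, k (i + h)) = f h (k i', k (i' + h))"
        using fun_cong[OF u(2)[rule_format, THEN iffD1, OF eq(1)], of h] h by simp
      moreover have "f' h (k j) = f' h (k j')"
        using fun_cong[OF v(2)[rule_format, THEN iffD1, OF eq(2)], of h] h by simp
      ultimately have "cmod (\<phi> (?p \<otimes> \<kappa> i' (j' + h)) - \<phi> (?p' \<otimes> \<kappa> i' (j' + h))) \<le> \<delta> / 2"
        using p[of "(k i, k (i + h))" "(k i', k (i' + h))" "k j" "k j'" "\<kappa> i' (j' + h)" h] k \<kappa> by simp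
      then have "cmod (\<phi> (?p \<otimes> ?c') - \<phi> (?p' \<otimes> ?c')) \<le> \<delta> / 2"
        using \<phi>\<kappa> pG by simp
      moreover have "cmod (\<phi> (?p \<otimes> ?c) - \<phi> (?p \<otimes> ?c')) \<le> \<delta> / 2"
        using vert[OF pG eq(3)] .
      ultimately have "cmod (\<phi> (?p \<otimes> ?c) - \<phi> (?p' \<otimes> ?c')) \<le> \<delta> / 2 + \<delta> / 2"
        using norm_triangle_mono[of "\<phi> (?p \<otimes> ?c) - \<phi> (?p \<otimes> ?c')" "\<delta> / 2" "\<phi> (?p \<otimes> ?c') - \<phi> (?p' \<otimes> ?c')" "\<delta> / 2"]
        by simp
      then show ?thesis by (simp add: val)
    qed
    show "\<exists>(q::nat) u v t. (\<forall>i. u i < q) \<and> (\<forall>j. v j < q) \<and> (\<forall>i j. t i j < r) \<and>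
        (\<forall>h<H. \<forall>i j i' j'. u i = u i' \<and> v j = v j' \<and> t i (j + h) = t i' (j' + h) \<longrightarrow>
           cmod (\<phi> (g [^] (b ^ (i + h) + b ^ j)) - \<phi> (g [^] (b ^ (i' + h) + b ^ j'))) \<le> \<delta>)"
      by (rule exI[of _ "q1 + q2"], rule exI[of _ u], rule exI[of _ v], rule exI[of _ "\<lambda>i m. l (\<kappa> i m)"])
         (use u(1) v(1) lr main in \<open>auto intro: trans_less_add1 trans_less_add2\<close>)
  qed
qed

end

text \<open>The base point is absorbed by conjugation: \<open>g\<^sup>n x\<^sub>0 = x\<^sub>0 (x\<^sub>0\<^sup>-\<^sup>1 g x\<^sub>0)\<^sup>n\<close>, and \<open>x \<mapsto> \<phi>(x\<^sub>0 x)\<close> is again automorphic.\<close>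

lemma nilsequence_low_complexity:
  assumes "nilsequence 2 a"
  shows "low_complexity b a"
proof -
  obtain G :: "real monoid" and X \<Gamma> \<phi> g x0 where lie: "lie_group G X" and nil: "nilpotent_step 2 G"
    and cc: "discrete_cocompact_subgroup G X \<Gamma>" and \<phi>: "continuous_map X euclidean \<phi>"
    and inv: "\<And>x \<gamma>. \<lbrakk>x \<in> carrier G; \<gamma> \<in> \<Gamma>\<rbrakk> \<Longrightarrow> \<phi> (x \<otimes>\<^bsub>G\<^esub> \<gamma>) = \<phi> x"
    and g: "g \<in> carrier G" and x0: "x0 \<in> carrier G"
    and a: "\<And>n. a n = \<phi> (g [^]\<^bsub>G\<^esub> n \<otimes>\<^bsub>G\<^esub> x0)"
    using assms unfolding nilsequence_def by blast
  interpret two_step_group G using nil by (rule nilpotent_step_2_imp_two_step)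
  interpret topological_two_step_group G X
    using lie by unfold_locales (auto simp: lie_group_def)
  have \<Gamma>: "subgroup \<Gamma> G" using cc by (simp add: discrete_cocompact_subgroup_def)
  obtain K where K: "compactin X K" and K\<Gamma>: "\<And>g. g \<in> carrier G \<Longrightarrow> \<exists>k\<in>K. \<exists>\<gamma>\<in>\<Gamma>. g = k \<otimes>\<^bsub>G\<^esub> \<gamma>"
    using lie_group_compact_transversal[OF lie cc] by blast
  have KG: "K \<subseteq> carrier G" using compactin_subset_topspace[OF K] topspace by simp
  have "bounded (\<phi> ` K)"
    using image_compactin[OF K \<phi>] by (simp add: compact_imp_bounded)
  then obtain C where C: "\<And>k. k \<in> K \<Longrightarrow> cmod (\<phi> k) \<le> C" by (auto simp: bounded_iff)
  have "cmod (a n) \<le> C" for n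
  proof -
    have "g [^]\<^bsub>G\<^esub> n \<otimes>\<^bsub>G\<^esub> x0 \<in> carrier G" using g x0 by simp
    then obtain k \<gamma> where "k \<in> K" "\<gamma> \<in> \<Gamma>" "g [^]\<^bsub>G\<^esub> n \<otimes>\<^bsub>G\<^esub> x0 = k \<otimes>\<^bsub>G\<^esub> \<gamma>" using K\<Gamma> by blast
    then show ?thesis using a inv[of k \<gamma>] C KG by auto
  qed
  then have bd: "\<exists>C. \<forall>n. cmod (a n) \<le> C" by blast
  define h where "h = inv\<^bsub>G\<^esub> x0 \<otimes>\<^bsub>G\<^esub> g \<otimes>\<^bsub>G\<^esub> x0"
  define \<psi> where "\<psi> = (\<lambda>x. \<phi> (x0 \<otimes>\<^bsub>G\<^esub> x))"
  have h: "h \<in> carrier G" and x0h: "x0 \<otimes>\<^bsub>G\<^esub> h = g \<otimes>\<^bsub>G\<^esub> x0"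
    using g x0 by (simp_all add: h_def flip: m_assoc)
  have gh: "g [^]\<^bsub>G\<^esub> n \<otimes>\<^bsub>G\<^esub> x0 = x0 \<otimes>\<^bsub>G\<^esub> h [^]\<^bsub>G\<^esub> n" for n :: nat
  proof (induction n)
    case (Suc n)
    have "x0 \<otimes>\<^bsub>G\<^esub> h [^]\<^bsub>G\<^esub> Suc n = x0 \<otimes>\<^bsub>G\<^esub> h [^]\<^bsub>G\<^esub> n \<otimes>\<^bsub>G\<^esub> h"
      using h x0 by (simp add: m_assoc)
    also have "\<dots> = g [^]\<^bsub>G\<^esub> n \<otimes>\<^bsub>G\<^esub> (x0 \<otimes>\<^bsub>G\<^esub> h)"
      unfolding Suc[symmetric] using g h x0 by (simp add: m_assoc)
    also have "\<dots> = g [^]\<^bsub>G\<^esub> Suc n \<otimes>\<^bsub>G\<^esub> x0" unfolding x0h using g x0 by (simp add: m_assoc)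
    finally show ?case ..
  qed (use x0 in simp)
  have a\<psi>: "a (int n) = \<psi> (h [^]\<^bsub>G\<^esub> n)" for n :: nat
    by (simp add: a int_pow_int gh \<psi>_def)
  have "continuous_map X X (\<lambda>x. x0 \<otimes>\<^bsub>G\<^esub> x)"
    using x0 topspace by (intro continuous_map_mult) auto
  from continuous_map_compose[OF this \<phi>] have c\<psi>: "continuous_map X euclidean \<psi>"
    by (simp add: o_def \<psi>_def)
  have inv\<psi>: "\<psi> (x \<otimes>\<^bsub>G\<^esub> \<gamma>) = \<psi> x" if "x \<in> carrier G" "\<gamma> \<in> \<Gamma>" for x \<gamma>
    using inv[of "x0 \<otimes>\<^bsub>G\<^esub> x" \<gamma>] that x0 subgroup.mem_carrier[OF \<Gamma>] by (simp add: m_assoc \<psi>_def)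
  show ?thesis
    unfolding low_complexity_def
  proof (rule conjI[OF bd], rule allI, rule impI)
    fix \<delta> :: real assume \<delta>: "\<delta> > 0"
    show "\<exists>r::nat. \<forall>H::nat. \<exists>(q::nat) (u::nat\<Rightarrow>nat) (v::nat\<Rightarrow>nat) (t::nat\<Rightarrow>nat\<Rightarrow>nat).
        (\<forall>i. u i < q) \<and> (\<forall>j. v j < q) \<and> (\<forall>i j. t i j < r) \<and>
        (\<forall>h<H. \<forall>i j i' j'. u i = u i' \<and> v j = v j' \<and> t i (j + h) = t i' (j' + h) \<longrightarrow>
           cmod (a (int (b ^ (i + h) + b ^ j)) - a (int (b ^ (i' + h) + b ^ j'))) \<le> \<delta>)"
      unfolding a\<psi>
      by (rule nil_orbit_low_complexity[where \<phi> = \<psi> and g = h and b = b and \<Gamma> = \<Gamma> and K = K])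
         (fact \<Gamma> K K\<Gamma> c\<psi> inv\<psi> h \<delta>)+
  qed
qed

section \<open>Signs that correlate with no pattern of low complexity\<close>

text \<open>Hoeffding's lemma for a fair sign.\<close>

lemma exp_plus_exp_minus_le: "exp t + exp (- t) \<le> 2 * exp (t\<^sup>2 / 2)" for t :: real
proof -
  have *: "exp t + exp (- t) \<le> 2 * exp (t\<^sup>2 / 2)" if "t \<ge> 0" for t :: real
  proof -
    have pos: "1 + exp (2 * t) > 0" by (simp add: add_pos_pos)
    have "- (2 * t) * (1 / 2) + ln (1 + 1 / 2 * (exp (2 * t) - 1)) \<le> (2 * t)\<^sup>2 / 8"
      using that by (intro Hoeffdings_lemma_aux) auto
    then have "ln ((1 + exp (2 * t)) / 2) \<le> t + t\<^sup>2 / 2"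
      by (simp add: field_simps)
    then have "exp (ln ((1 + exp (2 * t)) / 2)) \<le> exp (t + t\<^sup>2 / 2)"
      by simp
    then have "(1 + exp (2 * t)) / 2 \<le> exp (t + t\<^sup>2 / 2)"
      using pos by (subst (asm) exp_ln) auto
    then have "exp (- t) * (1 + exp (2 * t)) \<le> exp (- t) * (2 * exp (t + t\<^sup>2 / 2))"
      by (intro mult_left_mono) auto
    then show ?thesis by (simp add: algebra_simps flip: exp_add)
  qed
  show ?thesis
  proof (cases "t \<ge> 0")
    case False then show ?thesis using *[of "- t"] by (simp add: add.commute)
  qed (rule *)
qed

text \<open>Hoeffding's inequality and the union bound for uniformly random signs, in terms of counting: a choice of signs is encoded by the set
  \<open>Y\<close> where they are \<open>1\<close>, and the exponential moment factorizes over \<open>X\<close>.\<close>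

lemma exists_signs_small_sums:
  fixes \<Q> :: "('a set \<times> real) set"
  assumes X: "finite X" and \<Q>: "finite \<Q>" "\<And>P \<eta>. (P, \<eta>) \<in> \<Q> \<Longrightarrow> P \<subseteq> X \<and> \<eta> \<ge> 0"
    and small: "(\<Sum>(P, \<eta>)\<in>\<Q>. 2 * exp (- (\<eta>\<^sup>2 * card X / 2))) < 1"
  shows "\<exists>s :: 'a \<Rightarrow> real. (\<forall>x. s x = 1 \<or> s x = -1) \<and> (\<forall>(P, \<eta>)\<in>\<Q>. \<bar>\<Sum>x\<in>P. s x\<bar> \<le> \<eta> * card X)"
proof -
  define N where "N = real (card X)"
  define s :: "'a set \<Rightarrow> 'a \<Rightarrow> real" where "s = (\<lambda>Y x. if x \<in> Y then 1 else -1)"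
  define S where "S = (\<lambda>P Y. \<Sum>x\<in>P. s Y x)"
  have mgf: "(\<Sum>Y\<in>Pow X. exp (c * S P Y)) \<le> 2 ^ card X * exp (c\<^sup>2 * N / 2)" if P: "P \<subseteq> X" for P c
  proof -
    define f where "f = (\<lambda>x. exp (if x \<in> P then c else 0))"
    define g where "g = (\<lambda>x. exp (if x \<in> P then - c else 0))"
    have "exp (c * S P Y) = prod f Y * prod g (X - Y)" if Y: "Y \<in> Pow X" for Y
    proof -
      have "c * S P Y = (\<Sum>x\<in>X. if x \<in> P then c * s Y x else 0)"
        using P X by (simp add: S_def sum_distrib_left sum.inter_restrict[symmetric] Int_absorb1)
      also have "\<dots> = (\<Sum>x\<in>Y. if x \<in> P then c * s Y x else 0) + (\<Sum>x\<in>X-Y. if x \<in> P then c * s Y x else 0)"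
        using Y X by (subst sum.subset_diff[of Y X]) (auto simp: finite_subset)
      also have "\<dots> = (\<Sum>x\<in>Y. if x \<in> P then c else 0) + (\<Sum>x\<in>X-Y. if x \<in> P then - c else 0)"
        by (intro arg_cong2[where f = "(+)"] sum.cong) (auto simp: s_def)
      finally show ?thesis
        using X Y by (simp add: exp_add exp_sum f_def g_def finite_subset)
    qed
    then have "(\<Sum>Y\<in>Pow X. exp (c * S P Y)) = (\<Sum>Y\<in>Pow X. prod f Y * prod g (X - Y))"
      by (intro sum.cong) auto
    also have "\<dots> = (\<Prod>x\<in>X. f x + g x)" using X by (simp add: prod_add)
    also have "\<dots> \<le> (\<Prod>x\<in>X. 2 * exp (c\<^sup>2 / 2))"
    proof (intro prod_mono conjI)
      fix x show "f x + g x \<le> 2 * exp (c\<^sup>2 / 2)"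
        using exp_plus_exp_minus_le[of c] by (auto simp: f_def g_def)
    qed (auto simp: f_def g_def intro: add_nonneg_nonneg)
    also have "\<dots> = 2 ^ card X * exp (c\<^sup>2 * N / 2)"
      by (simp add: power_mult_distrib N_def flip: exp_of_nat_mult)
    finally show ?thesis .
  qed
  define bad where "bad = (\<lambda>(P, \<eta>). {Y \<in> Pow X. \<bar>S P Y\<bar> > \<eta> * N})"
  have card_bad: "card (bad (P, \<eta>)) \<le> 2 ^ card X * (2 * exp (- (\<eta>\<^sup>2 * N / 2)))" if P: "(P, \<eta>) \<in> \<Q>" for P \<eta>
  proof -
    have True: "\<eta> \<ge> 0" using \<Q>(2)[OF P] by simp
    have "card (bad (P, \<eta>)) * exp (\<eta> * (\<eta> * N)) = (\<Sum>Y\<in>bad (P, \<eta>). exp (\<eta> * (\<eta> * N)))" by simp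
    also have "\<dots> \<le> (\<Sum>Y\<in>bad (P, \<eta>). exp (\<eta> * S P Y) + exp (- \<eta> * S P Y))"
    proof (intro sum_mono)
      fix Y assume "Y \<in> bad (P, \<eta>)"
      then have "\<eta> * N \<le> \<bar>S P Y\<bar>" by (simp add: bad_def)
      then have "\<eta> * (\<eta> * N) \<le> \<eta> * \<bar>S P Y\<bar>" using True by (intro mult_left_mono)
      then have "exp (\<eta> * (\<eta> * N)) \<le> exp (\<eta> * \<bar>S P Y\<bar>)" by simp
      also have "\<dots> \<le> exp (\<eta> * S P Y) + exp (- \<eta> * S P Y)"
        by (cases "S P Y \<ge> 0") auto
      finally show "exp (\<eta> * (\<eta> * N)) \<le> exp (\<eta> * S P Y) + exp (- \<eta> * S P Y)" .
    qed
    also have "\<dots> \<le> (\<Sum>Y\<in>Pow X. exp (\<eta> * S P Y) + exp (- \<eta> * S P Y))"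
      using X by (intro sum_mono2) (auto simp: bad_def intro: add_nonneg_nonneg)
    also have "\<dots> \<le> 2 ^ card X * exp (\<eta>\<^sup>2 * N / 2) + 2 ^ card X * exp ((- \<eta>)\<^sup>2 * N / 2)"
      unfolding sum.distrib using \<Q>(2)[OF P] by (intro add_mono mgf) auto
    finally have "card (bad (P, \<eta>)) * exp (\<eta> * (\<eta> * N)) * exp (- (\<eta> * (\<eta> * N))) \<le>
        2 ^ card X * (2 * exp (\<eta>\<^sup>2 * N / 2)) * exp (- (\<eta> * (\<eta> * N)))"
      by (intro mult_right_mono) auto
    then show ?thesis
      by (simp add: mult_ac power2_eq_square flip: exp_add)
  qed
  have "real (card (\<Union>(bad ` \<Q>))) \<le> (\<Sum>p\<in>\<Q>. real (card (bad p)))"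
    using card_UN_le[OF \<Q>(1), of bad] by (simp flip: of_nat_sum)
  also have "\<dots> \<le> (\<Sum>p\<in>\<Q>. 2 ^ card X * (case p of (P, \<eta>) \<Rightarrow> 2 * exp (- (\<eta>\<^sup>2 * N / 2))))"
    using card_bad by (intro sum_mono) (auto split: prod.split)
  also have "\<dots> < 2 ^ card X * 1"
    unfolding sum_distrib_left[symmetric] using small by (intro mult_strict_left_mono) (auto simp: N_def)
  finally have "card (\<Union>(bad ` \<Q>)) < card (Pow X)"
    using X by (simp add: card_Pow)
  then have "\<not> Pow X \<subseteq> \<Union>(bad ` \<Q>)"
    using card_mono[of "\<Union>(bad ` \<Q>)" "Pow X"] \<Q>(1) X by (force simp: bad_def intro!: finite_subset[of _ "Pow X"])
  then obtain Y where Y: "Y \<in> Pow X" "\<And>p. p \<in> \<Q> \<Longrightarrow> Y \<notin> bad p" by blast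
  show ?thesis
  proof (intro exI[of _ "s Y"] conjI allI ballI)
    show "s Y x = 1 \<or> s Y x = -1" for x by (simp add: s_def)
    fix p assume "p \<in> \<Q>"
    then show "case p of (P, \<eta>) \<Rightarrow> \<bar>\<Sum>x\<in>P. s Y x\<bar> \<le> \<eta> * card X"
      using Y by (cases p) (force simp: bad_def S_def N_def)
  qed
qed

text \<open>If \<open>a\<close> is nearly constant on the cells of a partition, it suffices that the signs have small sums over all unions of
  cells: taking the union of the cells with nonnegative sums, and that of the others, bounds the sum of the
  absolute values over all cells at once, so that the number of cells does not enter.\<close>

lemma weighted_sum_le_of_patterns:
  fixes a :: "'x \<Rightarrow> complex" and s :: "'x \<Rightarrow> real" and key :: "'x \<Rightarrow> 'k"
  assumes X: "finite X" and Z: "finite Z" "key ` X \<subseteq> Z"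
    and s: "\<And>x. \<bar>s x\<bar> \<le> 1" and a: "\<And>x. cmod (a x) \<le> C"
    and close: "\<And>x y. \<lbrakk>x \<in> X; y \<in> X; key x = key y\<rbrakk> \<Longrightarrow> cmod (a x - a y) \<le> \<delta>"
    and cut: "\<And>W. W \<subseteq> Z \<Longrightarrow> \<bar>\<Sum>x\<in>{x\<in>X. key x \<in> W}. s x\<bar> \<le> \<eta>"
  shows "cmod (\<Sum>x\<in>X. complex_of_real (s x) * a x) \<le> 2 * C * \<eta> + \<delta> * card X"
proof -
  have C: "C \<ge> 0" using a norm_ge_zero order_trans by blast
  define cell where "cell = (\<lambda>z. {x \<in> X. key x = z})"
  define A where "A = (\<lambda>z. a (SOME x. x \<in> cell z))"
  define S where "S = (\<lambda>z. \<Sum>x\<in>cell z. s x)"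
  have A_close: "cmod (a x - A (key x)) \<le> \<delta>" if "x \<in> X" for x
  proof -
    have "x \<in> cell (key x)" using that by (simp add: cell_def)
    then have "(SOME y. y \<in> cell (key x)) \<in> cell (key x)" by (rule someI)
    then show ?thesis unfolding A_def using close[OF that] by (simp add: cell_def)
  qed
  have sub: "(\<Sum>x\<in>{x\<in>X. key x \<in> W}. s x) = (\<Sum>z\<in>W. S z)" if "W \<subseteq> Z" for W
  proof -
    have "(\<Sum>z\<in>W. S z) = (\<Sum>z\<in>W. \<Sum>x\<in>{x. x \<in> {x\<in>X. key x \<in> W} \<and> key x = z}. s x)"
      unfolding S_def cell_def by (intro sum.cong refl) auto
    also have "\<dots> = (\<Sum>x\<in>{x\<in>X. key x \<in> W}. s x)"
      using X Z that by (intro sum.group) (auto intro: finite_subset)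
    finally show ?thesis ..
  qed
  have abs_S: "(\<Sum>z\<in>Z. \<bar>S z\<bar>) \<le> 2 * \<eta>"
  proof -
    let ?P = "{z\<in>Z. S z \<ge> 0}" and ?M = "{z\<in>Z. S z < 0}"
    have "(\<Sum>z\<in>Z. \<bar>S z\<bar>) = (\<Sum>z\<in>?P. \<bar>S z\<bar>) + (\<Sum>z\<in>?M. \<bar>S z\<bar>)"
      using Z(1) by (subst sum.union_disjoint[symmetric]) (auto intro!: sum.cong)
    also have "\<dots> = (\<Sum>z\<in>?P. S z) - (\<Sum>z\<in>?M. S z)"
      by (simp add: sum_negf flip: add_uminus_conv_diff)
    also have "\<dots> \<le> \<eta> + \<eta>"
      using cut[of ?P] cut[of ?M] sub[of ?P] sub[of ?M] by (auto simp: abs_le_iff)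
    finally show ?thesis by simp
  qed
  have "(\<Sum>x\<in>X. s x * A (key x)) = (\<Sum>z\<in>Z. \<Sum>x\<in>{x. x \<in> X \<and> key x = z}. s x * A (key x))"
    using X Z by (intro sum.group[symmetric])
  also have "\<dots> = (\<Sum>z\<in>Z. S z * A z)"
    unfolding S_def cell_def of_real_sum sum_distrib_right by (intro sum.cong) auto
  finally have "cmod (\<Sum>x\<in>X. s x * A (key x)) \<le> (\<Sum>z\<in>Z. \<bar>S z\<bar> * C)"
    by (auto simp: norm_mult A_def intro!: sum_norm_le mult_left_mono a)
  also have "\<dots> \<le> 2 * \<eta> * C"
    unfolding sum_distrib_right[symmetric] using abs_S C by (intro mult_right_mono)
  finally have 1: "cmod (\<Sum>x\<in>X. s x * A (key x)) \<le> 2 * C * \<eta>" by (simp add: mult_ac)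
  have 2: "cmod (\<Sum>x\<in>X. s x * (a x - A (key x))) \<le> (\<Sum>x\<in>X. \<delta>)"
  proof (rule sum_norm_le)
    fix x assume "x \<in> X"
    then have "\<bar>s x\<bar> * cmod (a x - A (key x)) \<le> 1 * \<delta>"
      using s A_close by (intro mult_mono) auto
    then show "cmod (s x * (a x - A (key x))) \<le> \<delta>" by (simp add: norm_mult)
  qed
  have "(\<Sum>x\<in>X. s x * a x) = (\<Sum>x\<in>X. s x * A (key x)) + (\<Sum>x\<in>X. s x * (a x - A (key x)))"
    by (simp add: algebra_simps flip: sum.distrib)
  then show ?thesis using norm_triangle_mono[OF 1 2] by (simp add: mult.commute)
qed

text \<open>The index set of the \<open>n\<close>-th block. All indices lie in the interval from \<open>n\<^sup>2\<close> to \<open>n\<^sup>2 + 2 n\<close>, so that different blocks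
  use different digits.\<close>

definition block_rows :: "nat \<Rightarrow> nat set" where "block_rows n = {n\<^sup>2..<n\<^sup>2 + n}"
definition block_cols :: "nat \<Rightarrow> nat set" where "block_cols n = {n\<^sup>2 + n..<n\<^sup>2 + 2 * n}"

text \<open>The unions of cells of the partitions that arise from \<open>low_complexity\<close>: the row \<open>i\<close> is split as
  \<open>(i - i mod H) + i mod H\<close>, a multiple of \<open>H\<close> plus the shift \<open>h\<close>.\<close>

definition patterns :: "nat set \<Rightarrow> nat set \<Rightarrow> nat \<Rightarrow> nat \<Rightarrow> nat \<Rightarrow> (nat \<times> nat) set set" where
  "patterns I J H q r =
     {{(i, j) \<in> I \<times> J. (i mod H, u (i - i mod H), v j, t (i - i mod H) (j + i mod H)) \<in> W} | u v t W.
        (\<forall>i. u i < q) \<and> (\<forall>j. v j < q) \<and> (\<forall>i j. t i j < r) \<and>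
        W \<subseteq> {..<H} \<times> {..<q} \<times> {..<q} \<times> {..<r}}"

lemma patterns_mono:
  assumes q: "q \<le> q'"
  shows "patterns I J H q r \<subseteq> patterns I J H q' r"
proof -
  show ?thesis
  proof
    fix P assume "P \<in> patterns I J H q r"
    then obtain u v t W where "P = {(i, j) \<in> I \<times> J. (i mod H, u (i - i mod H), v j, t (i - i mod H) (j + i mod H)) \<in> W}"
      and *: "\<forall>i. u i < q" "\<forall>j. v j < q" "\<forall>i j. t i j < r" "W \<subseteq> {..<H} \<times> {..<q} \<times> {..<q} \<times> {..<r}"
      unfolding patterns_def by (elim CollectE exE conjE)
    moreover have "\<forall>i. u i < q'" "\<forall>j. v j < q'" using * q less_le_trans by blast+
    moreover have "{..<H} \<times> {..<q} \<times> {..<q} \<times> {..<r} \<subseteq> {..<H} \<times> {..<q'} \<times> {..<q'} \<times> {..<r}"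
      using q by auto
    then have "W \<subseteq> {..<H} \<times> {..<q'} \<times> {..<q'} \<times> {..<r}" using *(4) by (rule order_trans[rotated])
    ultimately show "P \<in> patterns I J H q' r"
      unfolding patterns_def by (intro CollectI exI conjI)
  qed
qed

text \<open>A pattern is determined by \<open>u\<close> and \<open>v\<close> on at most \<open>n\<close> arguments each, by \<open>t\<close> on a grid with \<open>n/H + O(1)\<close> rows and \<open>n + H\<close>
  columns, and by the set \<open>W\<close> of keys, whose size is bounded independently of \<open>n\<close>.\<close>

lemma card_patterns:
  fixes a n H q r :: nat
  defines "I \<equiv> {a..<a + n}" and "J \<equiv> {a + n..<a + 2 * n}"
  assumes H: "H > 0" and q: "q > 0" and r: "r > 0"
  shows "finite (patterns I J H q r)"
    and "card (patterns I J H q r) \<le> q ^ n * q ^ n * r ^ ((n div H + 2) * (n + H)) * 2 ^ (H * q * q * r)"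
proof -
  define I0 where "I0 = (\<lambda>i. i - i mod H) ` I"
  define J' where "J' = {a + n..<a + 2 * n + H}"
  define Z where "Z = {..<H} \<times> {..<q} \<times> {..<q} \<times> {..<r}"
  define D where "D = PiE I0 (\<lambda>_. {..<q}) \<times> PiE J (\<lambda>_. {..<q}) \<times> PiE (I0 \<times> J') (\<lambda>_. {..<r}) \<times> Pow Z"
  define \<Phi> :: "(nat \<Rightarrow> nat) \<times> (nat \<Rightarrow> nat) \<times> (nat \<times> nat \<Rightarrow> nat) \<times> (nat \<times> nat \<times> nat \<times> nat) set \<Rightarrow> (nat \<times> nat) set"
    where "\<Phi> = (\<lambda>(u, v, t, W). {(i, j) \<in> I \<times> J. (i mod H, u (i - i mod H), v j, t (i - i mod H, j + i mod H)) \<in> W})"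
  have fin: "finite I0" "finite J" "finite J'" "finite Z"
    by (simp_all add: I0_def I_def J_def J'_def Z_def)
  then have finD: "finite D" by (auto simp: D_def intro!: finite_cartesian_product finite_PiE)
  have sub: "patterns I J H q r \<subseteq> \<Phi> ` D"
  proof
    fix P assume "P \<in> patterns I J H q r"
    then obtain u v t W where P: "P = {(i, j) \<in> I \<times> J. (i mod H, u (i - i mod H), v j, t (i - i mod H) (j + i mod H)) \<in> W}"
      and *: "\<forall>i. u i < q" "\<forall>j. v j < q" "\<forall>i j. t i j < r" "W \<subseteq> Z"
      unfolding patterns_def Z_def by blast
    have mem: "i - i mod H \<in> I0 \<and> j + i mod H \<in> J'" if "i \<in> I" "j \<in> J" for i j
      using that H by (auto simp: I0_def J_def J'_def intro: add_less_le_mono trans_le_add1 less_imp_le)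
    have "P = \<Phi> (restrict u I0, restrict v J, restrict (\<lambda>(i, j). t i j) (I0 \<times> J'), W)"
      unfolding P \<Phi>_def using mem by auto
    moreover have "(restrict u I0, restrict v J, restrict (\<lambda>(i, j). t i j) (I0 \<times> J'), W) \<in> D"
      using * by (auto simp: D_def restrict_PiE_iff)
    ultimately show "P \<in> \<Phi> ` D" by (rule image_eqI)
  qed
  show "finite (patterns I J H q r)" using sub finD by (meson finite_imageI finite_subset)
  have cI: "card I0 \<le> n"
    unfolding I0_def by (rule order_trans[OF card_image_le]) (auto simp: I_def)
  have cI': "card I0 \<le> n div H + 2"
  proof -
    have "I0 \<subseteq> (\<lambda>m. H * m) ` {a div H..(a + n) div H}"
      by (auto simp: I0_def I_def minus_mod_eq_mult_div intro!: imageI div_le_mono)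
    then have "card I0 \<le> card {a div H..(a + n) div H}"
      by (meson card_image_le card_mono finite_atLeastAtMost finite_imageI order_trans)
    also have "(a mod H + n mod H) div H \<le> 1"
    proof -
      have "a mod H + n mod H < 2 * H" using mod_less_divisor[OF H, of a] mod_less_divisor[OF H, of n] by linarith
      then show ?thesis using H less_mult_imp_div_less[of "a mod H + n mod H" 2 H] by simp
    qed
    then have "card {a div H..(a + n) div H} \<le> n div H + 2"
      by (simp add: div_add1_eq[of a n H])
    finally show ?thesis .
  qed
  have "card (patterns I J H q r) \<le> card D"
    using sub finD by (meson card_image_le card_mono finite_imageI order_trans)
  also have "card D = q ^ card I0 * q ^ n * r ^ (card I0 * (n + H)) * 2 ^ (H * q * q * r)"
    using fin unfolding D_def by (simp add: card_cartesian_product card_PiE card_Pow J_def J'_def Z_def mult.assoc)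
  also have "\<dots> \<le> q ^ n * q ^ n * r ^ ((n div H + 2) * (n + H)) * 2 ^ (H * q * q * r)"
    using cI cI' q r by (intro mult_mono power_increasing mult_le_mono) auto
  finally show "card (patterns I J H q r) \<le> q ^ n * q ^ n * r ^ ((n div H + 2) * (n + H)) * 2 ^ (H * q * q * r)" .
qed

lemma real_card_patterns:
  fixes a n H q r :: nat
  assumes H: "H > 0" and q: "q > 0" and r: "r > 0"
  shows "real (card (patterns {a..<a + n} {a + n..<a + 2 * n} H q r)) \<le>
         exp (2 * n * q + r * (n\<^sup>2 / H + 3 * n + 2 * H) + H * q * q * r)"
proof -
  have pow: "real x ^ m \<le> exp (real m * real x)" for x m :: nat
  proof -
    have "real x \<le> exp (real x)" using exp_ge_add_one_self[of "real x"] by linarith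
    then have "real x ^ m \<le> exp (real x) ^ m" by (intro power_mono) auto
    then show ?thesis by (simp add: exp_of_nat_mult)
  qed
  have two: "(2::real) ^ m \<le> exp (real m)" for m :: nat
  proof -
    have "(2::real) ^ m \<le> exp 1 ^ m" using exp_ge_add_one_self[of "1::real"] by (intro power_mono) auto
    then show ?thesis by (simp add: exp_of_nat_mult[symmetric])
  qed
  have "real ((n div H + 2) * (n + H)) \<le> (real n / H + 2) * (real n + H)"
    unfolding of_nat_mult of_nat_add using of_nat_div_le_of_nat[of n H, where 'a = real] by (intro mult_right_mono) auto
  also have "\<dots> = n\<^sup>2 / H + 3 * n + 2 * H"
    using H by (simp add: field_simps power2_eq_square)
  finally have e: "real ((n div H + 2) * (n + H)) * real r \<le> (n\<^sup>2 / H + 3 * n + 2 * H) * real r"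
    by (intro mult_right_mono) auto
  have "real (card (patterns {a..<a + n} {a + n..<a + 2 * n} H q r)) \<le>
      real q ^ n * real q ^ n * real r ^ ((n div H + 2) * (n + H)) * 2 ^ (H * q * q * r)"
    using of_nat_mono[OF card_patterns(2)[OF assms, of a n], where 'a = real]
    by (simp only: of_nat_mult of_nat_power of_nat_numeral)
  also have "\<dots> \<le> exp (real n * real q) * exp (real n * real q) * exp (real ((n div H + 2) * (n + H)) * real r) * exp (real (H * q * q * r))"
    by (intro mult_mono pow two) auto
  also have "\<dots> \<le> exp (real n * real q) * exp (real n * real q) * exp ((n\<^sup>2 / H + 3 * n + 2 * H) * real r) * exp (real (H * q * q * r))"
    using e by (intro mult_mono) auto
  also have "\<dots> = exp (2 * n * q + r * (n\<^sup>2 / H + 3 * n + 2 * H) + H * q * q * r)"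
    by (simp add: algebra_simps flip: exp_add)
  finally show ?thesis .
qed

lemma card_block: "card (block_rows n \<times> block_cols n) = n\<^sup>2" and finite_block: "finite (block_rows n \<times> block_cols n)"
  by (simp_all add: block_rows_def block_cols_def card_cartesian_product power2_eq_square)

text \<open>The step \<open>H = 8 L\<^sup>3\<close> is chosen in terms of the bound \<open>L\<close> for the number of labels \<open>t\<close> so that
  \<open>(n\<^sup>2/H) log L \<le> n\<^sup>2/(8 L\<^sup>2)\<close>, a quarter of the Hoeffding exponent \<open>n\<^sup>2/(2 L\<^sup>2)\<close> for deviations of size \<open>n\<^sup>2/L\<close>. The
  single parameter \<open>K\<close> bounds both \<open>L\<close> and the number \<open>q\<close> of the other labels.\<close>

definition balanced :: "nat \<Rightarrow> nat \<Rightarrow> (nat \<times> nat \<Rightarrow> real) \<Rightarrow> bool" where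
  "balanced K n s \<longleftrightarrow> (\<forall>L\<in>{1..K}. \<forall>P\<in>patterns (block_rows n) (block_cols n) (8 * L ^ 3) K L. \<bar>\<Sum>p\<in>P. s p\<bar> \<le> n\<^sup>2 / L)"

lemma balanced_antimono: "balanced K n s \<Longrightarrow> K' \<le> K \<Longrightarrow> balanced K' n s"
  unfolding balanced_def using patterns_mono[of K' K] by (meson atLeastAtMost_iff le_trans subsetD)

definition is_sign :: "('a \<Rightarrow> real) \<Rightarrow> bool" where "is_sign s \<longleftrightarrow> (\<forall>x. s x = 1 \<or> s x = -1)"

lemma eventually_balanced: "\<forall>\<^sub>F n in sequentially. \<exists>s. is_sign s \<and> balanced K n s"
proof -
  define T where "T = (\<lambda>L n :: nat. real (card (patterns (block_rows n) (block_cols n) (8 * L ^ 3) K L)) * (2 * exp (- ((1 / real L)\<^sup>2 * real (n\<^sup>2) / 2))))"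
  have T: "(\<lambda>n. T L n) \<longlonglongrightarrow> 0" if L: "L \<in> {1..K}" for L
  proof -
    define H where "H = 8 * L ^ 3"
    have H: "H > 0" using L by (simp add: H_def)
    define l where "l = real L"
    define c where "c = 2 * real K + 3 * l"
    define d where "d = 2 * l * H + real (H * K * K * L)"
    have l: "l > 0" using L by (simp add: l_def)
    have le: "T L n \<le> 2 * exp (c * n + d - 3 / (8 * l\<^sup>2) * real n ^ 2)" for n
    proof -
      have "T L n \<le> exp (2 * n * K + L * (n\<^sup>2 / H + 3 * n + 2 * H) + H * K * K * L) * (2 * exp (- ((1 / real L)\<^sup>2 * real (n\<^sup>2) / 2)))"
        unfolding T_def using real_card_patterns[OF H, of K L "n\<^sup>2" n] L
        by (intro mult_right_mono) (auto simp: H_def block_rows_def block_cols_def)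
      also have "\<dots> = 2 * exp ((2 * n * K + L * (n\<^sup>2 / H + 3 * n + 2 * H) + H * K * K * L) - ((1 / real L)\<^sup>2 * real (n\<^sup>2) / 2))"
        by (simp add: exp_diff exp_minus field_simps)
      also have "(2 * n * K + L * (n\<^sup>2 / H + 3 * n + 2 * H) + H * K * K * L) - ((1 / real L)\<^sup>2 * real (n\<^sup>2) / 2) =
           c * n + d - 3 / (8 * l\<^sup>2) * real n ^ 2"
      proof -
        have "l * (real n ^ 2 / H) = real n ^ 2 / (8 * l\<^sup>2)"
          using l by (simp add: H_def l_def power2_eq_square power3_eq_cube)
        then have "L * (n\<^sup>2 / H + 3 * n + 2 * H) = real n ^ 2 / (8 * l\<^sup>2) + 3 * l * n + 2 * l * H"
          by (simp add: distrib_left l_def)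
        moreover have "(1 / real L)\<^sup>2 * real (n\<^sup>2) / 2 = 4 * (real n ^ 2 / (8 * l\<^sup>2))"
          by (simp add: l_def power_divide)
        ultimately show ?thesis by (simp add: c_def d_def algebra_simps)
      qed
      finally show ?thesis .
    qed
    have "(\<lambda>n :: nat. 2 * exp (c * n + d - 3 / (8 * l\<^sup>2) * real n ^ 2)) \<longlonglongrightarrow> 0"
      using l by real_asymp
    moreover have "0 \<le> T L n" for n by (simp add: T_def)
    ultimately show ?thesis using le
      by (intro tendsto_sandwich[of "\<lambda>_. 0" "T L" sequentially "\<lambda>n. 2 * exp (c * n + d - 3 / (8 * l\<^sup>2) * real n ^ 2)"]) auto
  qed
  have "(\<lambda>n. \<Sum>L\<in>{1..K}. T L n) \<longlonglongrightarrow> (\<Sum>L\<in>{1..K}. 0)"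
    by (intro tendsto_sum T)
  then have "\<forall>\<^sub>F n in sequentially. (\<Sum>L\<in>{1..K}. T L n) < 1"
    by (intro order_tendstoD(2)) auto
  then show ?thesis
  proof eventually_elim
    case (elim n)
    let ?X = "block_rows n \<times> block_cols n"
    define Pt where "Pt = (\<lambda>L. patterns (block_rows n) (block_cols n) (8 * L ^ 3) K L)"
    define \<Q> where "\<Q> = (\<Union>L\<in>{1..K}. Pt L \<times> {1 / real L})"
    have fin: "finite (Pt L)" if "L \<in> {1..K}" for L
      using card_patterns(1)[of "8 * L ^ 3" K L "n\<^sup>2" n] that by (auto simp: Pt_def block_rows_def block_cols_def)
    have "(\<Sum>(P, \<eta>)\<in>\<Q>. 2 * exp (- (\<eta>\<^sup>2 * card ?X / 2))) =
        (\<Sum>L\<in>{1..K}. \<Sum>(P, \<eta>)\<in>Pt L \<times> {1 / real L}. 2 * exp (- (\<eta>\<^sup>2 * card ?X / 2)))"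
      unfolding \<Q>_def using fin by (intro sum.UNION_disjoint) auto
    also have "\<dots> = (\<Sum>L\<in>{1..K}. T L n)"
      by (intro sum.cong refl) (simp add: T_def Pt_def card_block flip: sum.cartesian_product)
    finally have small: "(\<Sum>(P, \<eta>)\<in>\<Q>. 2 * exp (- (\<eta>\<^sup>2 * card ?X / 2))) < 1" using elim by simp
    have "finite \<Q>" using fin by (simp add: \<Q>_def)
    moreover have "P \<subseteq> ?X \<and> \<eta> \<ge> 0" if "(P, \<eta>) \<in> \<Q>" for P \<eta>
      using that by (auto simp: \<Q>_def Pt_def patterns_def)
    ultimately obtain s where s: "\<forall>x. s x = 1 \<or> s x = -1" "\<forall>(P, \<eta>)\<in>\<Q>. \<bar>\<Sum>x\<in>P. s x\<bar> \<le> \<eta> * card ?X"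
      using exists_signs_small_sums[OF finite_block _ _ small] by blast
    have "\<bar>\<Sum>p\<in>P. s p\<bar> \<le> n\<^sup>2 / L" if "L \<in> {1..K}" "P \<in> Pt L" for L P
    proof -
      have "(P, 1 / real L) \<in> \<Q>" using that by (auto simp: \<Q>_def)
      with s(2) have "\<bar>\<Sum>x\<in>P. s x\<bar> \<le> 1 / real L * card ?X" by blast
      then show ?thesis by (simp add: card_block)
    qed
    then show ?case using s(1) unfolding balanced_def is_sign_def Pt_def by blast
  qed
qed

text \<open>Diagonal argument: in the \<open>n\<close>-th block take signs that are balanced for the largest \<open>K \<le> n\<close> for which this is possible.\<close>

lemma exists_universal_signs:
  shows "\<exists>s :: nat \<Rightarrow> nat \<times> nat \<Rightarrow> real. (\<forall>n. is_sign (s n)) \<and> (\<forall>K. \<forall>\<^sub>F n in sequentially. balanced K n (s n))"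
proof -
  have "\<exists>s. is_sign s \<and> (\<forall>K\<le>n. (\<exists>s'. is_sign s' \<and> balanced K n s') \<longrightarrow> balanced K n s)" for n
  proof -
    define A where "A = {K. K \<le> n \<and> (\<exists>s'. is_sign s' \<and> balanced K n s')}"
    have "is_sign (\<lambda>_::nat \<times> nat. 1)" "balanced 0 n (\<lambda>_. 1)" by (auto simp: is_sign_def balanced_def)
    then have "0 \<in> A" by (auto simp: A_def)
    moreover have "finite A" by (simp add: A_def)
    ultimately have M: "Max A \<in> A" "\<And>K. K \<in> A \<Longrightarrow> K \<le> Max A" by (auto intro: Max_in)
    then obtain s where "is_sign s" "balanced (Max A) n s" by (auto simp: A_def)
    then show ?thesis using M(2) balanced_antimono by (intro exI[of _ s]) (auto simp: A_def)
  qed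
  then obtain s where s: "\<And>n. is_sign (s n)" "\<And>n K. K \<le> n \<Longrightarrow> \<exists>s'. is_sign s' \<and> balanced K n s' \<Longrightarrow> balanced K n (s n)"
    by metis
  have "\<forall>\<^sub>F n in sequentially. balanced K n (s n)" for K
    using eventually_balanced[of K] eventually_ge_at_top[of K] by eventually_elim (rule s(2))
  then show ?thesis using s(1) by blast
qed

text \<open>For given \<open>\<epsilon>\<close>, first \<open>r\<close> is obtained from \<open>low_complexity\<close>, then \<open>L \<ge> r\<close> of order \<open>C/\<epsilon>\<close> and with it \<open>H\<close>, and only then \<open>q\<close>;
  finally \<open>K = max L q\<close>.\<close>

lemma low_complexity_average_tendsto_0:
  assumes b: "low_complexity b a" and s: "\<And>n. is_sign (s n)" "\<And>K. \<forall>\<^sub>F n in sequentially. balanced K n (s n)"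
  shows "(\<lambda>n. \<Sum>p\<in>block_rows n \<times> block_cols n. complex_of_real (s n p / n\<^sup>2) * a (int (b ^ fst p + b ^ snd p))) \<longlonglongrightarrow> 0"
proof (rule tendstoI)
  fix \<epsilon> :: real assume \<epsilon>: "\<epsilon> > 0"
  obtain C where C: "\<And>n. cmod (a n) \<le> C" using b unfolding low_complexity_def by blast
  have "\<epsilon> / 2 > 0" using \<epsilon> by simp
  with b obtain r where r: "\<And>H. \<exists>(q::nat) (u::nat\<Rightarrow>nat) (v::nat\<Rightarrow>nat) (t::nat\<Rightarrow>nat\<Rightarrow>nat).
        (\<forall>i. u i < q) \<and> (\<forall>j. v j < q) \<and> (\<forall>i j. t i j < r) \<and>
        (\<forall>h<H. \<forall>i j i' j'. u i = u i' \<and> v j = v j' \<and> t i (j + h) = t i' (j' + h) \<longrightarrow>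
           cmod (a (int (b ^ (i + h) + b ^ j)) - a (int (b ^ (i' + h) + b ^ j'))) \<le> \<epsilon> / 2)"
    unfolding low_complexity_def by blast
  define L where "L = max (max r 1) (nat \<lceil>4 * C / \<epsilon>\<rceil> + 1)"
  have L: "r \<le> L" "1 \<le> L" "real L > 4 * C / \<epsilon>" unfolding L_def by linarith+
  define H where "H = 8 * L ^ 3"
  have H: "H > 0" using L by (simp add: H_def)
  obtain q u v t where u: "\<forall>i. u i < (q::nat)" and v: "\<forall>j. v j < q" and t: "\<forall>i j. t i j < r"
    and close: "\<forall>h<H. \<forall>i j i' j'. u i = (u i' :: nat) \<and> v j = (v j' :: nat) \<and> t i (j + h) = t i' (j' + h) \<longrightarrow>
           cmod (a (int (b ^ (i + h) + b ^ j)) - a (int (b ^ (i' + h) + b ^ j'))) \<le> \<epsilon> / 2"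
    using r[of H] by (elim exE conjE)
  define K where "K = max L q"
  show "\<forall>\<^sub>F n in sequentially. dist (\<Sum>p\<in>block_rows n \<times> block_cols n. complex_of_real (s n p / n\<^sup>2) * a (int (b ^ fst p + b ^ snd p))) 0 < \<epsilon>"
    using s(2)[of K] eventually_gt_at_top[of 0]
  proof eventually_elim
    case (elim n)
    let ?X = "block_rows n \<times> block_cols n"
    define key where "key = (\<lambda>(i, j). (i mod H, u (i - i mod H), v j, t (i - i mod H) (j + i mod H)))"
    define Z where "Z = {..<H} \<times> {..<K} \<times> {..<K} \<times> {..<L}"
    define f where "f = (\<lambda>p. a (int (b ^ fst p + b ^ snd p)))"
    have uK: "u i < K" "v i < K" "t i j < L" for i j
      using u v less_le_trans[OF t[rule_format] L(1)] by (auto simp: K_def less_max_iff_disj)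
    have "cmod (\<Sum>p\<in>?X. complex_of_real (s n p) * f p) \<le> 2 * C * (n\<^sup>2 / L) + \<epsilon> / 2 * card ?X"
    proof (rule weighted_sum_le_of_patterns[where key = key and Z = Z])
      show "finite ?X" "finite Z" by (simp_all add: finite_block Z_def)
      show "key ` ?X \<subseteq> Z" using uK H by (auto simp: key_def Z_def)
      show "\<bar>s n p\<bar> \<le> 1" for p using s(1)[of n] unfolding is_sign_def by (metis abs_minus_cancel abs_one order_refl)
      show "cmod (f p) \<le> C" for p by (simp add: f_def C)
      show "cmod (f p - f p') \<le> \<epsilon> / 2" if "key p = key p'" for p p'
      proof -
        obtain i j i' j' where p: "p = (i, j)" "p' = (i', j')" by (cases p, cases p')
        define h where "h = i mod H"
        have h: "h < H" "i' mod H = h" "i - h + h = i" "i' - h + h = i'"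
          using that H by (auto simp: h_def key_def p) (metis le_add_diff_inverse2 mod_less_eq_dividend)
        then show ?thesis
          using that close[rule_format, of h "i - h" "i' - h" j j'] by (simp add: f_def p key_def flip: h_def)
      qed
      show "\<bar>\<Sum>p\<in>{p \<in> ?X. key p \<in> W}. s n p\<bar> \<le> n\<^sup>2 / L" if W: "W \<subseteq> Z" for W
      proof -
        have "{p \<in> ?X. key p \<in> W} \<in> patterns (block_rows n) (block_cols n) H K L"
          unfolding patterns_def
          by (rule CollectI, rule exI[of _ u], rule exI[of _ v], rule exI[of _ t], rule exI[of _ W])
             (use W uK in \<open>auto simp: key_def Z_def\<close>)
        then show ?thesis
          using elim(1) L unfolding balanced_def H_def K_def by auto
      qed
    qed
    also have "\<dots> = (2 * C / L + \<epsilon> / 2) * n\<^sup>2" by (simp add: card_block algebra_simps)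
    finally have "cmod (\<Sum>p\<in>?X. complex_of_real (s n p) * f p) \<le> (2 * C / L + \<epsilon> / 2) * n\<^sup>2" .
    moreover have "(\<Sum>p\<in>?X. complex_of_real (s n p / n\<^sup>2) * f p) = (\<Sum>p\<in>?X. complex_of_real (s n p) * f p) / n\<^sup>2"
      by (simp add: sum_divide_distrib)
    ultimately have "cmod (\<Sum>p\<in>?X. complex_of_real (s n p / n\<^sup>2) * f p) \<le> 2 * C / L + \<epsilon> / 2"
      using elim(2) by (simp add: norm_divide norm_power divide_le_eq)
    also have "2 * C / L < \<epsilon> / 2"
      using L \<epsilon> by (simp add: field_simps)
    finally show ?case by (simp add: f_def)
  qed
qed

section \<open>Integration against complex measures\<close>

lemma norm_suminf_le_ennreal:
  fixes f :: "nat \<Rightarrow> 'a::real_normed_vector"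
  assumes "f sums s"
  shows "ennreal (norm s) \<le> (\<Sum>i. ennreal (norm (f i)))"
proof (rule tendsto_upperbound)
  have "(\<lambda>n. \<Sum>i<n. f i) \<longlonglongrightarrow> s" using assms by (simp add: sums_def)
  then show "(\<lambda>n. ennreal (norm (\<Sum>i<n. f i))) \<longlonglongrightarrow> ennreal (norm s)"
    by (intro tendsto_ennrealI tendsto_norm)
  have "ennreal (norm (\<Sum>i<n. f i)) \<le> (\<Sum>i. ennreal (norm (f i)))" for n
  proof -
    have "ennreal (norm (\<Sum>i<n. f i)) \<le> ennreal (\<Sum>i<n. norm (f i))"
      by (intro ennreal_leI norm_sum)
    also have "\<dots> = (\<Sum>i<n. ennreal (norm (f i)))" by simp
    also have "\<dots> \<le> (\<Sum>i. ennreal (norm (f i)))" by (intro sum_le_suminf) auto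
    finally show ?thesis .
  qed
  then show "\<forall>\<^sub>F n in sequentially. ennreal (norm (\<Sum>i<n. f i)) \<le> (\<Sum>i. ennreal (norm (f i)))"
    by simp
qed simp

text \<open>The set function from which \<open>variation_measure\<close> is built has to be shown countably additive, since otherwise
  the measure generated by it would be zero by convention. For the Jordan parts only the upper
  bound by the variation is used, and it holds even if \<open>positive_part\<close> is zero by this convention.\<close>

definition partial_partitions :: "'m measure \<Rightarrow> 'm set \<Rightarrow> 'm set set set" where
  "partial_partitions N A = {P. finite P \<and> P \<subseteq> sets N \<and> disjoint P \<and> \<Union>P \<subseteq> A}"

definition total_variation :: "'m measure \<Rightarrow> ('m set \<Rightarrow> complex) \<Rightarrow> 'm set \<Rightarrow> ennreal" where
  "total_variation N \<sigma> A = (SUP P\<in>partial_partitions N A. \<Sum>B\<in>P. ennreal (cmod (\<sigma> B)))"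

lemma total_variation_mono: "A \<subseteq> B \<Longrightarrow> total_variation N \<sigma> A \<le> total_variation N \<sigma> B"
  unfolding total_variation_def partial_partitions_def by (rule SUP_subset_mono) auto

lemma total_variation_superadditive:
  assumes "\<sigma> {} = 0" and AB: "A \<inter> B = {}"
  shows "total_variation N \<sigma> A + total_variation N \<sigma> B \<le> total_variation N \<sigma> (A \<union> B)"
proof -
  let ?s = "\<lambda>P. \<Sum>C\<in>P. ennreal (cmod (\<sigma> C))"
  have ne: "partial_partitions N A \<noteq> {}" for A
    by (auto simp: partial_partitions_def intro!: exI[of _ "{}"])
  have 1: "?s P + ?s Q \<le> total_variation N \<sigma> (A \<union> B)"
    if P: "P \<in> partial_partitions N A" and Q: "Q \<in> partial_partitions N B" for P Q
  proof -
    have fin: "finite P" "finite Q" using P Q by (auto simp: partial_partitions_def)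
    have "P \<inter> Q \<subseteq> {{}}" using P Q AB by (fastforce simp: partial_partitions_def)
    then have "?s (P \<inter> Q) = 0" using assms(1) by (intro sum.neutral) auto
    then have "?s P + ?s Q = ?s (P \<union> Q)"
      using sum.union_inter[OF fin, of "\<lambda>C. ennreal (cmod (\<sigma> C))"] by simp
    also have "P \<union> Q \<in> partial_partitions N (A \<union> B)"
    proof -
      have "C \<inter> D = {}" if "C \<in> P" "D \<in> Q" for C D
      proof -
        have "C \<subseteq> A" "D \<subseteq> B" using that P Q by (auto simp: partial_partitions_def)
        then show ?thesis using AB by blast
      qed
      then have "disjoint (P \<union> Q)"
        using P Q unfolding partial_partitions_def disjoint_def by (simp add: ball_Un) (metis inf_commute)
      with P Q show ?thesis by (auto simp: partial_partitions_def)
    qed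
    then have "?s (P \<union> Q) \<le> total_variation N \<sigma> (A \<union> B)"
      unfolding total_variation_def by (rule SUP_upper)
    finally show ?thesis .
  qed
  have "?s P + total_variation N \<sigma> B \<le> total_variation N \<sigma> (A \<union> B)"
    if P: "P \<in> partial_partitions N A" for P
    unfolding total_variation_def[of N \<sigma> B] ennreal_SUP_add_right[OF ne]
    using 1[OF P] by (rule SUP_least)
  then show ?thesis
    unfolding total_variation_def[of N \<sigma> A] ennreal_SUP_add_left[OF ne, symmetric]
    by (rule SUP_least)
qed

text \<open>A partial partition of \<open>\<Union>A\<^sub>i\<close> is refined by intersecting its members with each \<open>A\<^sub>i\<close>.\<close>

lemma total_variation_subadditive:
  assumes \<sigma>: "complex_measure N \<sigma>" and A: "range A \<subseteq> sets N" "disjoint_family (A :: nat \<Rightarrow> _)"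
  shows "total_variation N \<sigma> (\<Union>i. A i) \<le> (\<Sum>i. total_variation N \<sigma> (A i))"
  unfolding total_variation_def[of N \<sigma> "\<Union>i. A i"]
proof (rule SUP_least)
  fix P assume "P \<in> partial_partitions N (\<Union>i. A i)"
  then have P: "finite P" "P \<subseteq> sets N" "disjoint P" "\<Union>P \<subseteq> (\<Union>i. A i)"
    by (auto simp: partial_partitions_def)
  have "ennreal (cmod (\<sigma> B)) \<le> (\<Sum>i. ennreal (cmod (\<sigma> (B \<inter> A i))))" if B: "B \<in> P" for B
  proof (rule norm_suminf_le_ennreal)
    have "range (\<lambda>i. B \<inter> A i) \<subseteq> sets N" using B P(2) A(1) by auto
    moreover have "disjoint_family (\<lambda>i. B \<inter> A i)"
      using A(2) unfolding disjoint_family_on_def by blast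
    ultimately have "(\<lambda>i. \<sigma> (B \<inter> A i)) sums \<sigma> (\<Union>i. B \<inter> A i)"
      using \<sigma> unfolding complex_measure_def by blast
    also have "(\<Union>i. B \<inter> A i) = B" using B P(4) by auto
    finally show "(\<lambda>i. \<sigma> (B \<inter> A i)) sums \<sigma> B" .
  qed
  then have "(\<Sum>B\<in>P. ennreal (cmod (\<sigma> B))) \<le> (\<Sum>B\<in>P. \<Sum>i. ennreal (cmod (\<sigma> (B \<inter> A i))))"
    by (intro sum_mono)
  also have "\<dots> = (\<Sum>i. \<Sum>B\<in>P. ennreal (cmod (\<sigma> (B \<inter> A i))))"
    by (rule suminf_sum[symmetric]) simp
  also have "\<dots> \<le> (\<Sum>i. total_variation N \<sigma> (A i))"
  proof (intro suminf_le)
    fix i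
    let ?Q = "{B \<in> P. B \<inter> A i \<noteq> {}}"
    have inj: "inj_on (\<lambda>B. B \<inter> A i) ?Q"
    proof (rule inj_onI)
      fix B C assume *: "B \<in> ?Q" "C \<in> ?Q" "B \<inter> A i = C \<inter> A i"
      then have "B \<inter> C \<noteq> {}" by blast
      with * P(3) show "B = C" by (auto simp: disjoint_def)
    qed
    have "(\<Sum>B\<in>P. ennreal (cmod (\<sigma> (B \<inter> A i)))) = (\<Sum>B\<in>?Q. ennreal (cmod (\<sigma> (B \<inter> A i))))"
      using P(1) \<sigma> by (intro sum.mono_neutral_right) (auto simp: complex_measure_def)
    also have "\<dots> = (\<Sum>C\<in>(\<lambda>B. B \<inter> A i) ` ?Q. ennreal (cmod (\<sigma> C)))"
      using inj by (simp add: sum.reindex)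
    also have "(\<lambda>B. B \<inter> A i) ` ?Q \<in> partial_partitions N (A i)"
      using P A by (auto simp: partial_partitions_def disjoint_def)
    then have "(\<Sum>C\<in>(\<lambda>B. B \<inter> A i) ` ?Q. ennreal (cmod (\<sigma> C))) \<le> total_variation N \<sigma> (A i)"
      unfolding total_variation_def by (rule SUP_upper)
    finally show "(\<Sum>B\<in>P. ennreal (cmod (\<sigma> (B \<inter> A i)))) \<le> total_variation N \<sigma> (A i)" .
  qed auto
  finally show "(\<Sum>B\<in>P. ennreal (cmod (\<sigma> B))) \<le> (\<Sum>i. total_variation N \<sigma> (A i))" .
qed

lemma emeasure_variation_measure:
  assumes \<sigma>: "complex_measure N \<sigma>" and A: "A \<in> sets N"
  shows "emeasure (variation_measure N \<sigma>) A = total_variation N \<sigma> A"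
proof -
  have eq: "variation_measure N \<sigma> = measure_of (space N) (sets N) (total_variation N \<sigma>)"
    by (simp add: variation_measure_def total_variation_def[abs_def] partial_partitions_def)
  have \<sigma>0: "\<sigma> {} = 0" using \<sigma> by (simp add: complex_measure_def)
  have empty: "total_variation N \<sigma> {} = 0"
  proof -
    have "(\<Sum>B\<in>P. ennreal (cmod (\<sigma> B))) \<le> 0" if "P \<in> partial_partitions N {}" for P
    proof -
      have "P \<subseteq> {{}}" using that by (auto simp: partial_partitions_def)
      then have "(\<Sum>B\<in>P. ennreal (cmod (\<sigma> B))) = 0" using \<sigma>0 by (intro sum.neutral) auto
      then show ?thesis by simp
    qed
    then have "total_variation N \<sigma> {} \<le> 0" unfolding total_variation_def by (rule SUP_least)
    then show ?thesis by simp
  qed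
  have "(\<Sum>i. total_variation N \<sigma> (F i)) = total_variation N \<sigma> (\<Union>i. F i)"
    if F: "range F \<subseteq> sets N" "disjoint_family F" for F :: "nat \<Rightarrow> _"
  proof (rule antisym)
    have "(\<Sum>i<n. total_variation N \<sigma> (F i)) \<le> total_variation N \<sigma> (\<Union>i<n. F i)" for n
    proof (induction n)
      case (Suc n)
      have "F i \<inter> F n = {}" if "i < n" for i
        using F(2) that unfolding disjoint_family_on_def by simp
      then have "(\<Union>i<n. F i) \<inter> F n = {}" by blast
      then have "total_variation N \<sigma> (\<Union>i<n. F i) + total_variation N \<sigma> (F n) \<le> total_variation N \<sigma> ((\<Union>i<n. F i) \<union> F n)"
        by (rule total_variation_superadditive[where \<sigma> = \<sigma>, OF \<sigma>0])
      also have "(\<Union>i<n. F i) \<union> F n = (\<Union>i<Suc n. F i)" by (auto simp: lessThan_Suc)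
      finally show ?case using Suc by (auto intro: order_trans add_right_mono)
    qed (simp add: empty)
    then have "(\<Sum>i<n. total_variation N \<sigma> (F i)) \<le> total_variation N \<sigma> (\<Union>i. F i)" for n
      by (rule order_trans) (intro total_variation_mono, auto)
    then show "(\<Sum>i. total_variation N \<sigma> (F i)) \<le> total_variation N \<sigma> (\<Union>i. F i)"
      by (intro suminf_le_const) auto
  qed (rule total_variation_subadditive[OF \<sigma> F])
  then have "countably_additive (sets N) (total_variation N \<sigma>)"
    by (auto simp: countably_additive_def)
  then have "emeasure (measure_of (space N) (sets N) (total_variation N \<sigma>)) A = total_variation N \<sigma> A"
    using A empty by (intro emeasure_measure_of_sigma) (auto simp: positive_def sets.sigma_algebra_axioms)
  then show ?thesis by (simp add: eq)
qed

lemma sets_variation_measure: "sets (variation_measure N \<sigma>) = sets N"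
  by (simp add: variation_measure_def)
lemma sets_positive_part: "sets (positive_part N \<nu>) = sets N"
  by (simp add: positive_part_def)
lemma space_positive_part: "space (positive_part N \<nu>) = space N"
  by (simp add: positive_part_def)

lemma positive_part_le_variation:
  assumes \<sigma>: "complex_measure N \<sigma>" and \<nu>: "\<And>B. \<nu> B \<le> cmod (\<sigma> B)"
  shows "positive_part N \<nu> \<le> variation_measure N \<sigma>"
proof (subst le_measure)
  show "sets (positive_part N \<nu>) = sets (variation_measure N \<sigma>)"
    by (simp add: sets_variation_measure sets_positive_part)
  show "\<forall>A\<in>sets (positive_part N \<nu>). emeasure (positive_part N \<nu>) A \<le> emeasure (variation_measure N \<sigma>) A"
  proof
    fix A assume "A \<in> sets (positive_part N \<nu>)"
    then have A: "A \<in> sets N" by (simp add: sets_positive_part)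
    have "emeasure (positive_part N \<nu>) A \<le> (SUP B\<in>{B \<in> sets N. B \<subseteq> A}. ennreal (\<nu> B))"
      by (simp add: positive_part_def emeasure_measure_of_conv)
    also have "\<dots> \<le> total_variation N \<sigma> A"
    proof (rule SUP_least)
      fix B assume "B \<in> {B \<in> sets N. B \<subseteq> A}"
      then have "{B} \<in> partial_partitions N A" by (simp add: partial_partitions_def)
      then have "(\<Sum>C\<in>{B}. ennreal (cmod (\<sigma> C))) \<le> total_variation N \<sigma> A"
        unfolding total_variation_def by (rule SUP_upper)
      then show "ennreal (\<nu> B) \<le> total_variation N \<sigma> A"
        using \<nu>[of B] by (auto intro: order_trans ennreal_leI)
    qed
    finally show "emeasure (positive_part N \<nu>) A \<le> emeasure (variation_measure N \<sigma>) A"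
      using emeasure_variation_measure[OF \<sigma> A] by simp
  qed
qed

lemma integral_tendsto_0_of_weighted_sums:
  fixes f :: "int \<Rightarrow> 'm \<Rightarrow> complex" and w :: "nat \<Rightarrow> 'p \<Rightarrow> complex"
  assumes meas: "\<And>n. f n \<in> borel_measurable M"
    and dom: "(\<integral>\<^sup>+ m. (SUP n. ennreal (cmod (f n m))) \<partial>M) < \<infinity>"
    and S: "\<And>n. finite (S n)" and w: "\<And>n. (\<Sum>p\<in>S n. cmod (w n p)) \<le> 1"
    and lim: "\<And>m. m \<in> space M \<Longrightarrow> (\<lambda>n. \<Sum>p\<in>S n. w n p * f (d p) m) \<longlonglongrightarrow> 0"
  shows "(\<lambda>n. \<Sum>p\<in>S n. w n p * (LINT m|M. f (d p) m)) \<longlonglongrightarrow> 0"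
proof -
  define g where "g = (\<lambda>m. SUP n. ennreal (cmod (f n m)))"
  have g_meas: "g \<in> borel_measurable M"
    unfolding g_def using meas by (intro borel_measurable_SUP) auto
  have g_fin: "AE m in M. g m \<noteq> \<infinity>"
    using dom g_meas by (intro nn_integral_PInf_AE) (auto simp: g_def)
  define G where "G = (\<lambda>m. enn2real (g m))"
  have "(\<integral>\<^sup>+ m. ennreal (G m) \<partial>M) \<le> (\<integral>\<^sup>+ m. g m \<partial>M)"
    unfolding G_def by (intro nn_integral_mono) (simp add: ennreal_enn2real_if)
  then have G_int: "integrable M G"
    using dom g_meas by (intro integrableI_nonneg) (auto simp: G_def g_def[symmetric])
  have f_le: "AE m in M. \<forall>n. cmod (f n m) \<le> G m"
    using g_fin
  proof eventually_elim
    case (elim m)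
    have "ennreal (cmod (f n m)) \<le> g m" for n unfolding g_def by (rule SUP_upper) simp
    then have "enn2real (ennreal (cmod (f n m))) \<le> G m" for n
      unfolding G_def using elim by (intro enn2real_mono) (auto simp: less_top)
    then show ?case by simp
  qed
  have f_int: "integrable M (f n)" for n
    by (rule Bochner_Integration.integrable_bound[OF G_int meas])
       (use f_le in \<open>auto simp: G_def elim!: eventually_mono\<close>)
  have eq: "(\<Sum>p\<in>S n. w n p * (LINT m|M. f (d p) m)) = (LINT m|M. (\<Sum>p\<in>S n. w n p * f (d p) m))" for n
    using f_int by (simp add: Bochner_Integration.integral_sum)
  have "(\<lambda>n. LINT m|M. (\<Sum>p\<in>S n. w n p * f (d p) m)) \<longlonglongrightarrow> (LINT m|M. 0)"
  proof (rule integral_dominated_convergence[where w = G])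
    show "AE m in M. (\<lambda>n. \<Sum>p\<in>S n. w n p * f (d p) m) \<longlonglongrightarrow> 0"
      using lim by (intro AE_I2)
    show "AE m in M. norm (\<Sum>p\<in>S n. w n p * f (d p) m) \<le> G m" for n
      using f_le
    proof eventually_elim
      case (elim m)
      have "norm (\<Sum>p\<in>S n. w n p * f (d p) m) \<le> (\<Sum>p\<in>S n. cmod (w n p) * G m)"
        by (rule sum_norm_le) (auto simp: norm_mult intro!: mult_left_mono elim[rule_format])
      also have "\<dots> \<le> 1 * G m"
        unfolding sum_distrib_right[symmetric] using w by (intro mult_right_mono) (auto simp: G_def)
      finally show ?case by simp
    qed
  qed (use meas G_int in auto)
  then show ?thesis by (simp add: eq)
qed

text \<open>A statement on averages of sequences passes from nilsequences to their integral combinations. The dominating function is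
  \<open>\<parallel>a\<^sub>m\<parallel>\<^sub>\<infinity>\<close>, which is integrable with respect to the four Jordan parts because they are bounded by the variation.\<close>

lemma integral_combination_weighted_sums:
  fixes w :: "nat \<Rightarrow> 'p \<Rightarrow> complex" and d :: "'p \<Rightarrow> int"
  assumes a: "integral_combination k a"
    and S: "\<And>n. finite (S n)" and w: "\<And>n. (\<Sum>p\<in>S n. cmod (w n p)) \<le> 1"
    and lim: "\<And>c. nilsequence k c \<Longrightarrow> (\<lambda>n. \<Sum>p\<in>S n. w n p * c (d p)) \<longlonglongrightarrow> 0"
  shows "(\<lambda>n. \<Sum>p\<in>S n. w n p * a (d p)) \<longlonglongrightarrow> 0"
proof -
  obtain M :: "real set" and dd N \<sigma> A where met: "Metric_space M dd" 
    and N: "N = borel_sigma (Metric_space.mtopology M dd)" and \<sigma>: "complex_measure N \<sigma>"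
    and nil: "\<And>m. m \<in> M \<Longrightarrow> nilsequence k (A m)"
    and meas: "\<And>n. (\<lambda>m. A m n) \<in> borel_measurable N"
    and dom: "(\<integral>\<^sup>+ m. (SUP n. ennreal (cmod (A m n))) \<partial>variation_measure N \<sigma>) < \<infinity>"
    and a: "\<And>n. a n = complex_integral N \<sigma> (\<lambda>m. A m n)"
    using a unfolding integral_combination_def by blast
  have space: "space N = M"
    unfolding N borel_sigma_def using Metric_space.topspace_mtopology[OF met] by (simp add: space_measure_of_conv)
  have *: "(\<lambda>n. \<Sum>p\<in>S n. w n p * (LINT m|positive_part N \<nu>. A m (d p))) \<longlonglongrightarrow> 0"
    if \<nu>: "\<And>B. \<nu> B \<le> cmod (\<sigma> B)" for \<nu>
  proof (rule integral_tendsto_0_of_weighted_sums[OF _ _ S w, where f = "\<lambda>n m. A m n"])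
    show "(\<lambda>m. A m n) \<in> borel_measurable (positive_part N \<nu>)" for n
      using meas[of n] measurable_cong_sets[OF sets_positive_part refl] by blast
    have "(\<integral>\<^sup>+ m. (SUP n. ennreal (cmod (A m n))) \<partial>positive_part N \<nu>) \<le>
          (\<integral>\<^sup>+ m. (SUP n. ennreal (cmod (A m n))) \<partial>variation_measure N \<sigma>)"
      by (intro nn_integral_mono_measure positive_part_le_variation \<sigma> \<nu>)
         (simp add: sets_variation_measure sets_positive_part)
    then show "(\<integral>\<^sup>+ m. (SUP n. ennreal (cmod (A m n))) \<partial>positive_part N \<nu>) < \<infinity>"
      using dom by simp
    show "(\<lambda>n. \<Sum>p\<in>S n. w n p * A m (d p)) \<longlonglongrightarrow> 0" if "m \<in> space (positive_part N \<nu>)" for m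
      using that nil lim by (simp add: space_positive_part space)
  qed
  have **: "(\<lambda>n. \<Sum>p\<in>S n. w n p * signed_integral N \<nu> (\<lambda>m. A m (d p))) \<longlonglongrightarrow> 0"
    if \<nu>: "\<And>B. \<bar>\<nu> B\<bar> \<le> cmod (\<sigma> B)" for \<nu>
    unfolding signed_integral_def right_diff_distrib sum_subtractf
    using tendsto_diff[OF *[of \<nu>] *[of "\<lambda>A. - \<nu> A"]] \<nu> by (simp add: abs_le_iff)
  have "(\<lambda>n. (\<Sum>p\<in>S n. w n p * signed_integral N (\<lambda>A. Re (\<sigma> A)) (\<lambda>m. A m (d p))) +
             \<i> * (\<Sum>p\<in>S n. w n p * signed_integral N (\<lambda>A. Im (\<sigma> A)) (\<lambda>m. A m (d p)))) \<longlonglongrightarrow> 0 + \<i> * 0"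
    by (intro tendsto_add tendsto_mult tendsto_const ** abs_Re_le_cmod abs_Im_le_cmod)
  then show ?thesis
    by (simp add: a complex_integral_def sum_distrib_left sum.distrib algebra_simps)
qed

section \<open>The odometer\<close>

text \<open>The odometer is addition of \<open>1\<close> with carry, the least significant digit coming first. On the sequence all of whose digits
  are \<open>b - 1\<close> it gives the zero sequence.\<close>

locale odometer =
  fixes b :: nat assumes b: "b \<ge> 2"
begin

definition digit :: "nat measure" where "digit = uniform_count_measure {..<b}"
definition digits :: "(nat \<Rightarrow> nat) measure" where "digits = PiM UNIV (\<lambda>_. digit)"
definition succ :: "(nat \<Rightarrow> nat) \<Rightarrow> nat \<Rightarrow> nat" where
  "succ x = (\<lambda>i. if \<forall>k<i. x k = b - 1 then (x i + 1) mod b else x i)"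
definition pred :: "(nat \<Rightarrow> nat) \<Rightarrow> nat \<Rightarrow> nat" where
  "pred x = (\<lambda>i. if \<forall>k<i. x k = 0 then (x i + (b - 1)) mod b else x i)"
definition cylinder :: "nat \<Rightarrow> (nat \<Rightarrow> nat) \<Rightarrow> (nat \<Rightarrow> nat) set" where
  "cylinder n w = {x \<in> space digits. \<forall>i<n. x i = w i}"

lemma prob_space_digit: "prob_space digit"
  unfolding digit_def using b by (intro prob_space_uniform_count_measure) (auto simp: lessThan_empty_iff)

lemma product_prob_space_digit: "product_prob_space (\<lambda>_::nat. digit)"
  by (rule product_prob_spaceI) (rule prob_space_digit)

lemma measurable_digit_iff: "f \<in> N \<rightarrow>\<^sub>M digit \<longleftrightarrow> f \<in> N \<rightarrow>\<^sub>M count_space {..<b}"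
  using measurable_cong_sets[of N N digit "count_space {..<b}"]
  by (simp add: digit_def sets_uniform_count_measure)

lemma add_1_mod: "v < b \<Longrightarrow> (v + 1) mod b = (if v = b - 1 then 0 else v + 1)"
  using b by (auto simp: mod_if)

lemma add_pred_mod:
  assumes "v < b" shows "(v + (b - 1)) mod b = (if v = 0 then b - 1 else v - 1)"
proof (cases "v = 0")
  case False
  then have "v + (b - 1) = (v - 1) + b" using b by linarith
  then show ?thesis using False assms by (simp only: mod_add_self2) simp
qed (use b in simp)

lemma prob_space_digits: "prob_space digits" unfolding digits_def by (rule prob_space_PiM) (rule prob_space_digit)

lemma space_digits: "space digits = {x. \<forall>i. x i < b}"
  by (auto simp: digits_def space_PiM digit_def space_uniform_count_measure PiE_def Pi_def)

lemma measurable_coordinate: "(\<lambda>x. x i) \<in> digits \<rightarrow>\<^sub>M count_space UNIV"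
proof -
  have "(\<lambda>x. x i) \<in> digits \<rightarrow>\<^sub>M digit" unfolding digits_def by (rule measurable_component_singleton) simp
  then show ?thesis unfolding measurable_digit_iff
    by (rule measurable_compose[where g = "\<lambda>v. v" and N = "count_space {..<b}"]) simp
qed

lemma sets_coordinate: "{x \<in> space digits. R (x i)} \<in> sets digits"
  using measurable_sets[OF measurable_coordinate, of "Collect R" i] by (simp add: vimage_def Collect_conj_eq Int_commute)

lemma sets_coordinates: "{x \<in> space digits. \<forall>k<n. R k (x k)} \<in> sets digits"
proof (induction n)
  case (Suc n)
  have "{x \<in> space digits. \<forall>k<Suc n. R k (x k)} = {x \<in> space digits. \<forall>k<n. R k (x k)} \<inter> {x \<in> space digits. R n (x n)}"
    by (auto simp: less_Suc_eq)
  then show ?case using Suc sets_coordinate[of "R n" n] by (simp only: sets.Int)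
qed simp

lemma succ_in_space: "x \<in> space digits \<Longrightarrow> succ x \<in> space digits"
  using b by (auto simp: space_digits succ_def)

lemma measurable_succ: "succ \<in> digits \<rightarrow>\<^sub>M digits"
proof -
  have 1: "(\<lambda>x. succ x i) \<in> digits \<rightarrow>\<^sub>M digit" for i
  proof -
    have "(\<lambda>x. succ x i) \<in> digits \<rightarrow>\<^sub>M count_space UNIV"
      unfolding succ_def
      by (intro measurable_If sets_coordinates measurable_coordinate)
         (rule measurable_compose[OF measurable_coordinate], simp)
    moreover have "(\<lambda>x. succ x i) \<in> space digits \<rightarrow> {..<b}"
      using succ_in_space by (auto simp: space_digits)
    ultimately show ?thesis unfolding measurable_digit_iff
      by (auto simp: measurable_count_space_eq2_countable intro: measurable_sets)
  qed
  have "(\<lambda>x i. succ x i) \<in> digits \<rightarrow>\<^sub>M PiM UNIV (\<lambda>_. digit)"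
    by (rule measurable_abs_UNIV) (rule 1)
  then show ?thesis by (simp add: digits_def)
qed

lemma sets_cylinder: "cylinder n w \<in> sets digits"
  unfolding cylinder_def by (rule sets_coordinates)

lemma emeasure_cylinder:
  assumes "\<And>i. i < n \<Longrightarrow> w i < b"
  shows "emeasure digits (cylinder n w) = ennreal ((1 / b) ^ n)"
proof -
  have "emeasure digits (cylinder n w) = emeasure (PiM UNIV (\<lambda>_. digit)) {x \<in> space (PiM UNIV (\<lambda>_. digit)). \<forall>i\<in>{..<n}. x i \<in> {w i}}"
    by (simp add: cylinder_def digits_def Ball_def)
  also have "\<dots> = (\<Prod>i\<in>{..<n}. emeasure digit {w i})"
    by (rule product_prob_space.emeasure_PiM_Collect[OF product_prob_space_digit]) (use assms in \<open>auto simp: digit_def sets_uniform_count_measure\<close>)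
  also have "\<dots> = (\<Prod>i\<in>{..<n}. ennreal (1 / b))"
    using assms by (intro prod.cong) (auto simp: digit_def emeasure_uniform_count_measure)
  finally show ?thesis by (simp add: ennreal_power)
qed

lemma succ_carry_iff:
  assumes "\<forall>i. x i < b" shows "(\<forall>k<i. succ x k = 0) \<longleftrightarrow> (\<forall>k<i. x k = b - 1)"
proof (induction i)
  case (Suc i)
  show ?case
  proof (cases "\<forall>k<i. x k = b - 1")
    case True
    then have "succ x i = (x i + 1) mod b" unfolding succ_def by (rule if_P)
    then have "succ x i = 0 \<longleftrightarrow> x i = b - 1" using add_1_mod[of "x i"] assms by (auto split: if_splits)
    then show ?thesis using Suc by (simp only: All_less_Suc)
  next
    case False
    with Suc have "\<not> (\<forall>k<i. succ x k = 0)" by (simp only: not_False_eq_True)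
    with False show ?thesis by (auto simp only: All_less_Suc)
  qed
qed simp

lemma pred_carry_iff:
  assumes "\<forall>i. x i < b" shows "(\<forall>k<i. pred x k = b - 1) \<longleftrightarrow> (\<forall>k<i. x k = 0)"
proof (induction i)
  case (Suc i)
  show ?case
  proof (cases "\<forall>k<i. x k = 0")
    case True
    then have "pred x i = (x i + (b - 1)) mod b" unfolding pred_def by (rule if_P)
    then have "pred x i = b - 1 \<longleftrightarrow> x i = 0"
      using add_pred_mod[of "x i"] assms[rule_format, of i] b by (auto split: if_splits)
    then show ?thesis using Suc by (simp only: All_less_Suc)
  next
    case False
    with Suc have "\<not> (\<forall>k<i. pred x k = b - 1)" by (simp only: not_False_eq_True)
    with False show ?thesis by (auto simp only: All_less_Suc)
  qed
qed simp

lemma pred_succ: assumes "\<forall>i. x i < b" shows "pred (succ x) = x"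
proof
  fix i
  show "pred (succ x) i = x i"
  proof (cases "\<forall>k<i. x k = b - 1")
    case True
    then have 1: "succ x i = (x i + 1) mod b" unfolding succ_def by (rule if_P)
    have "\<forall>k<i. succ x k = 0" using True by (simp only: succ_carry_iff[OF assms])
    then have "pred (succ x) i = (succ x i + (b - 1)) mod b" unfolding pred_def by (rule if_P)
    also have "\<dots> = x i"
      using 1 assms[rule_format, of i] b add_1_mod[of "x i"] add_pred_mod[of "succ x i"] by (auto split: if_splits)
    finally show ?thesis .
  next
    case False
    then have "succ x i = x i" unfolding succ_def by (rule if_not_P)
    moreover have "\<not> (\<forall>k<i. succ x k = 0)" using False by (simp only: succ_carry_iff[OF assms] not_False_eq_True)
    then have "pred (succ x) i = succ x i" unfolding pred_def by (rule if_not_P)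
    ultimately show ?thesis by simp
  qed
qed

lemma succ_pred: assumes "\<forall>i. x i < b" shows "succ (pred x) = x"
proof
  fix i
  show "succ (pred x) i = x i"
  proof (cases "\<forall>k<i. x k = 0")
    case True
    then have 1: "pred x i = (x i + (b - 1)) mod b" unfolding pred_def by (rule if_P)
    have "\<forall>k<i. pred x k = b - 1" using True by (simp only: pred_carry_iff[OF assms])
    then have "succ (pred x) i = (pred x i + 1) mod b" unfolding succ_def by (rule if_P)
    also have "\<dots> = x i"
      using 1 assms[rule_format, of i] b add_pred_mod[of "x i"] add_1_mod[of "pred x i"] by (auto split: if_splits)
    finally show ?thesis .
  next
    case False
    then have "pred x i = x i" unfolding pred_def by (rule if_not_P)
    moreover have "\<not> (\<forall>k<i. pred x k = b - 1)" using False by (simp only: pred_carry_iff[OF assms] not_False_eq_True)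
    then have "succ (pred x) i = pred x i" unfolding succ_def by (rule if_not_P)
    ultimately show ?thesis by simp
  qed
qed

lemma succ_cong:
  assumes "\<And>k. k \<le> i \<Longrightarrow> x k = y k" shows "succ x i = succ y i"
proof -
  have "(\<forall>k<i. x k = b - 1) \<longleftrightarrow> (\<forall>k<i. y k = b - 1)" and "x i = y i" using assms by auto
  then show ?thesis unfolding succ_def by (simp only:)
qed

lemma pred_cong:
  assumes "\<And>k. k \<le> i \<Longrightarrow> x k = y k" shows "pred x i = pred y i"
proof -
  have "(\<forall>k<i. x k = 0) \<longleftrightarrow> (\<forall>k<i. y k = 0)" and "x i = y i" using assms by auto
  then show ?thesis unfolding pred_def by (simp only:)
qed

text \<open>Since \<open>pred\<close> is inverse to \<open>succ\<close> and both compute the first \<open>n\<close> digits from the first \<open>n\<close> digits, \<open>succ\<close> permutes the cylinders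
  of length \<open>n\<close>, which all have the same measure.\<close>

lemma vimage_cylinder:
  assumes w: "\<forall>i. w i < b"
  shows "succ -` cylinder n w \<inter> space digits = cylinder n (pred w)"
proof (intro subset_antisym subsetI)
  fix x assume "x \<in> succ -` cylinder n w \<inter> space digits"
  then have x: "\<forall>i. x i < b" "\<forall>i<n. succ x i = w i" by (auto simp: cylinder_def space_digits)
  have "x i = pred w i" if "i < n" for i
  proof -
    have "x i = pred (succ x) i" using pred_succ[OF x(1)] by simp
    also have "\<dots> = pred w i" using x(2) that by (intro pred_cong) auto
    finally show ?thesis .
  qed
  then show "x \<in> cylinder n (pred w)" using x by (simp add: cylinder_def space_digits)
next
  fix x assume "x \<in> cylinder n (pred w)"
  then have x: "x \<in> space digits" "\<forall>i<n. x i = pred w i" by (auto simp: cylinder_def)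
  have "succ x i = w i" if "i < n" for i
  proof -
    have "succ x i = succ (pred w) i" using x(2) that by (intro succ_cong) auto
    also have "\<dots> = w i" using succ_pred[OF w] by simp
    finally show ?thesis .
  qed
  then show "x \<in> succ -` cylinder n w \<inter> space digits" using x succ_in_space by (simp add: cylinder_def)
qed

lemma distr_succ: "distr digits digits succ = digits"
proof -
  have eq: "emeasure (distr digits digits succ) (cylinder n w) = emeasure digits (cylinder n w)"
    if w: "\<forall>i. w i < b" for n w
  proof -
    have "pred w i < b" for i using w b by (auto simp: pred_def)
    then show ?thesis using w by (simp add: emeasure_distr measurable_succ sets_cylinder vimage_cylinder emeasure_cylinder)
  qed
  have "distr digits digits succ = PiM UNIV (\<lambda>_. digit)"
  proof (rule measure_eqI_PiM_infinite)
    show "sets (distr digits digits succ) = sets (PiM UNIV (\<lambda>_. digit))" by (simp add: digits_def)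
    show "finite_measure (distr digits digits succ)"
      by (intro prob_space.finite_measure prob_space.prob_space_distr prob_space_digits measurable_succ)
    fix A :: "nat \<Rightarrow> nat set" and J :: "nat set"
    assume J: "finite J" and A: "\<And>i. i \<in> J \<Longrightarrow> A i \<in> sets digit"
    obtain n where n: "J \<subseteq> {..<n}" using J finite_nat_iff_bounded by blast
    define W where "W = {w \<in> PiE {..<n} (\<lambda>_. {..<b}). \<forall>j\<in>J. w j \<in> A j}"
    define ext where "ext = (\<lambda>w i. if i < n then w i else (0::nat))"
    have extb: "\<forall>i. ext w i < b" if "w \<in> W" for w using that b by (auto simp: ext_def W_def)
    have finW: "finite W" by (rule finite_subset[of _ "PiE {..<n} (\<lambda>_. {..<b})"]) (auto simp: W_def intro: finite_PiE)
    have U: "prod_emb UNIV (\<lambda>_. digit) J (PiE J A) = (\<Union>w\<in>W. cylinder n (ext w))"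
    proof (intro subset_antisym subsetI)
      fix x assume "x \<in> prod_emb UNIV (\<lambda>_. digit) J (PiE J A)"
      then have x: "x \<in> space digits" "\<forall>j\<in>J. x j \<in> A j"
        by (auto simp: prod_emb_def digits_def space_PiM)
      then have "restrict x {..<n} \<in> W" using n by (auto simp: W_def space_digits)
      moreover have "x \<in> cylinder n (ext (restrict x {..<n}))" using x by (simp add: cylinder_def ext_def)
      ultimately show "x \<in> (\<Union>w\<in>W. cylinder n (ext w))" by blast
    next
      fix x assume "x \<in> (\<Union>w\<in>W. cylinder n (ext w))"
      then obtain w where "w \<in> W" "x \<in> cylinder n (ext w)" by blast
      then show "x \<in> prod_emb UNIV (\<lambda>_. digit) J (PiE J A)"
        using n by (auto simp: W_def cylinder_def ext_def prod_emb_def digits_def space_PiM subset_iff)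
    qed
    have disj: "disjoint_family_on (\<lambda>w. cylinder n (ext w)) W"
    proof (unfold disjoint_family_on_def, intro ballI impI)
      fix w w' assume w: "w \<in> W" "w' \<in> W" "w \<noteq> w'"
      then obtain i where "i < n" "w i \<noteq> w' i"
        by (auto simp: W_def) (metis PiE_ext lessThan_iff)
      then show "cylinder n (ext w) \<inter> cylinder n (ext w') = {}"
        by (auto simp: cylinder_def ext_def)
    qed
    have "emeasure (distr digits digits succ) (\<Union>w\<in>W. cylinder n (ext w)) = (\<Sum>w\<in>W. emeasure (distr digits digits succ) (cylinder n (ext w)))"
      using finW disj by (intro sum_emeasure[symmetric]) (auto simp: sets_cylinder)
    also have "\<dots> = (\<Sum>w\<in>W. emeasure digits (cylinder n (ext w)))"
      using eq extb by (intro sum.cong) auto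
    also have "\<dots> = emeasure digits (\<Union>w\<in>W. cylinder n (ext w))"
      using finW disj by (intro sum_emeasure) (auto simp: sets_cylinder)
    finally show "emeasure (distr digits digits succ) (prod_emb UNIV (\<lambda>_. digit) J (PiE J A)) =
          emeasure (PiM UNIV (\<lambda>_. digit)) (prod_emb UNIV (\<lambda>_. digit) J (PiE J A))"
      unfolding U by (simp add: digits_def)
  qed simp
  then show ?thesis by (simp add: digits_def)
qed

end

context odometer
begin

text \<open>Addition of \<open>b\<^sup>i\<close>: the carry starts at the digit \<open>i\<close>.\<close>

definition add_at :: "nat \<Rightarrow> (nat \<Rightarrow> nat) \<Rightarrow> nat \<Rightarrow> nat" where
  "add_at i x = (\<lambda>k. if k < i then x k else if \<forall>l\<in>{i..<k}. x l = b - 1 then (x k + 1) mod b else x k)"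

lemma add_at_0: "add_at 0 = succ"
  by (auto simp: add_at_def succ_def fun_eq_iff)

lemma add_at_no_carry:
  assumes "x i + 1 < b" shows "add_at i x = x(i := x i + 1)"
proof
  fix k
  have "add_at i x k = x k" if "i < k"
  proof -
    have "add_at i x k = (if \<forall>l\<in>{i..<k}. x l = b - 1 then (x k + 1) mod b else x k)"
      using that by (simp add: add_at_def)
    also have "\<dots> = x k" by (rule if_not_P) (use assms that in force)
    finally show ?thesis .
  qed
  then show "add_at i x k = (x(i := x i + 1)) k"
    using assms by (cases k i rule: linorder_cases) (simp_all add: add_at_def)
qed

lemma add_at_carry:
  assumes "x i = b - 1" shows "add_at i x = (add_at (Suc i) x)(i := 0)"
proof
  fix k
  have "(\<forall>l\<in>{i..<k}. x l = b - 1) \<longleftrightarrow> (\<forall>l\<in>{Suc i..<k}. x l = b - 1)" if "i < k"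
    using assms that by (metis Suc_leI atLeastLessThan_iff le_eq_less_or_eq Suc_le_eq)
  then show "add_at i x k = ((add_at (Suc i) x)(i := 0)) k"
    using assms b by (cases k i rule: linorder_cases) (simp_all add: add_at_def)
qed

lemma add_at_upd_less:
  assumes "i < j" shows "add_at j (x(i := c)) = (add_at j x)(i := c)"
proof
  fix k
  have "(\<forall>l\<in>{j..<k}. (x(i := c)) l = b - 1) \<longleftrightarrow> (\<forall>l\<in>{j..<k}. x l = b - 1)"
    using assms by auto
  then show "add_at j (x(i := c)) k = ((add_at j x)(i := c)) k"
    using assms by (cases "k = i") (simp_all add: add_at_def)
qed

lemma funpow_add_at_no_carry:
  "x i + t < b \<Longrightarrow> (add_at i ^^ t) x = x(i := x i + t)"
proof (induction t)
  case (Suc t)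
  then have "x i + t < b" by simp
  then have "(add_at i ^^ t) x = x(i := x i + t)" by (rule Suc.IH)
  then have "(add_at i ^^ Suc t) x = add_at i (x(i := x i + t))" by (simp only: funpow.simps o_apply)
  also have "\<dots> = x(i := x i + Suc t)" using Suc.prems by (subst add_at_no_carry) auto
  finally show ?case .
qed simp

text \<open>Adding \<open>b\<close> times \<open>b\<^sup>i\<close> produces exactly one carry from the digit \<open>i\<close>, which returns to its initial value: the sum is
  split at the moment of the carry.\<close>

lemma funpow_add_at:
  assumes "x i < b" shows "(add_at i ^^ b) x = add_at (Suc i) x"
proof -
  define c where "c = b - 1 - x i"
  have bc: "b = x i + (Suc c)" and "x i + c = b - 1" "x i + c < b" using assms b by (auto simp: c_def)
  have "(add_at i ^^ b) x = (add_at i ^^ x i) (add_at i ((add_at i ^^ c) x))"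
    by (subst bc) (simp only: funpow_add funpow.simps o_apply)
  also have "(add_at i ^^ c) x = x(i := b - 1)"
    using funpow_add_at_no_carry[of x i c] \<open>x i + c < b\<close> \<open>x i + c = b - 1\<close> by simp
  also have "add_at i (x(i := b - 1)) = (add_at (Suc i) x)(i := 0)"
    by (subst add_at_carry) (simp_all add: add_at_upd_less)
  also have "(add_at i ^^ x i) \<dots> = (add_at (Suc i) x)(i := x i)"
    using assms by (subst funpow_add_at_no_carry) auto
  also have "\<dots> = add_at (Suc i) x" by (simp add: add_at_def fun_eq_iff)
  finally show ?thesis .
qed

lemma add_at_in_space: "x \<in> space digits \<Longrightarrow> add_at i x \<in> space digits"
  using b by (auto simp: space_digits add_at_def)

lemma funpow_succ_power:
  "x \<in> space digits \<Longrightarrow> (succ ^^ (b ^ i)) x = add_at i x"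
proof (induction i arbitrary: x)
  case 0 then show ?case by (simp add: add_at_0)
next
  case (Suc i)
  have "((succ ^^ (b ^ i)) ^^ n) x = (add_at i ^^ n) x \<and> (add_at i ^^ n) x \<in> space digits" for n
    using Suc by (induction n) (auto intro: add_at_in_space)
  then have "((succ ^^ (b ^ i)) ^^ b) x = (add_at i ^^ b) x" by blast
  also have "\<dots> = add_at (Suc i) x" using Suc.prems by (intro funpow_add_at) (simp add: space_digits)
  finally show ?case by (simp add: funpow_mult mult.commute)
qed

lemma funpow_succ_no_carry:
  assumes x: "x \<in> space digits" and t: "x i + t < b"
  shows "(succ ^^ (t * b ^ i)) x = x(i := x i + t)"
proof -
  have "((succ ^^ (b ^ i)) ^^ t) x = (add_at i ^^ t) x \<and> (add_at i ^^ t) x \<in> space digits"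
    using x by (induction t) (auto intro: add_at_in_space simp: funpow_succ_power)
  then show ?thesis using funpow_add_at_no_carry[of x i t] t by (simp add: funpow_mult mult.commute)
qed

lemma funpow_succ_no_carry2:
  assumes x: "x \<in> space digits" and ij: "i \<noteq> j" and t: "x i + t < b" "x j + t < b"
  shows "(succ ^^ (t * (b ^ i + b ^ j))) x = x(i := x i + t, j := x j + t)"
proof -
  have x': "x(j := x j + t) \<in> space digits" using x t by (auto simp: space_digits)
  have "(succ ^^ (t * (b ^ i + b ^ j))) x = (succ ^^ (t * b ^ i)) ((succ ^^ (t * b ^ j)) x)"
    by (simp add: distrib_left funpow_add)
  also have "\<dots> = (x(j := x j + t))(i := x i + t)"
    using funpow_succ_no_carry[of x j t] x funpow_succ_no_carry[OF x', of i t] t ij by simp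
  finally show ?thesis using ij by (simp add: fun_upd_twist)
qed

lemma succ_eq_beyond_carry:
  assumes "x k0 \<noteq> b - 1" "k0 < k" shows "succ x k = x k"
  using assms unfolding succ_def by (auto intro!: if_not_P)

lemma AE_not_all_max: "AE x in digits. \<exists>k. x k \<noteq> b - 1"
proof -
  have 1: "emeasure digits (\<Inter>n. cylinder n (\<lambda>_. b - 1)) \<le> ennreal ((1 / b) ^ n)" for n
  proof -
    have "emeasure digits (\<Inter>n. cylinder n (\<lambda>_. b - 1)) \<le> emeasure digits (cylinder n (\<lambda>_. b - 1))"
      by (intro emeasure_mono sets_cylinder) auto
    then show ?thesis using b by (simp add: emeasure_cylinder)
  qed
  have "(\<lambda>n. ennreal ((1 / b) ^ n)) \<longlonglongrightarrow> ennreal 0"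
    using b by (intro tendsto_ennrealI LIMSEQ_power_zero) simp
  then have "emeasure digits (\<Inter>n. cylinder n (\<lambda>_. b - 1)) \<le> ennreal 0"
    by (rule tendsto_lowerbound) (use 1 in auto)
  then have "(\<Inter>n. cylinder n (\<lambda>_. b - 1)) \<in> null_sets digits"
    by (auto simp: null_sets_def intro!: sets.countable_INT sets_cylinder)
  then show ?thesis by (rule AE_I') (auto simp: cylinder_def)
qed

lemma distr_funpow_succ: "distr digits digits (succ ^^ n) = digits"
  and measurable_funpow_succ: "succ ^^ n \<in> digits \<rightarrow>\<^sub>M digits"
proof (induction n)
  case (Suc n)
  {
    case 1
    have "distr digits digits (succ \<circ> (succ ^^ n)) = distr (distr digits digits (succ ^^ n)) digits succ"
      using Suc(2) by (intro distr_distr[symmetric] measurable_succ)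
    then show ?case using Suc(1) by (simp add: distr_succ o_def)
  next
    case 2
    show ?case using measurable_comp[OF Suc(2) measurable_succ] by (simp add: o_def)
  }
qed (simp_all add: id_def distr_id2)

text \<open>The sequence of all digits \<open>b - 1\<close> is the only one from which the carry does not stop; it is a null set, and so are its
  preimages.\<close>

lemma AE_orbit_not_all_max: "AE x in digits. \<forall>n. \<exists>k. (succ ^^ n) x k \<noteq> b - 1"
proof (unfold AE_all_countable, intro allI)
  fix n
  have "AE x in distr digits digits (succ ^^ n). \<exists>k. x k \<noteq> b - 1"
    unfolding distr_funpow_succ by (rule AE_not_all_max)
  then show "AE x in digits. \<exists>k. (succ ^^ n) x k \<noteq> b - 1"
    by (rule AE_distrD[OF measurable_funpow_succ])
qed

lemma prob_near_carry: "measure digits {x \<in> space digits. x i + 2 \<ge> b} = 2 / b"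
proof -
  have "emeasure digits {x \<in> space digits. x i + 2 \<ge> b} =
      emeasure (PiM UNIV (\<lambda>_. digit)) {x \<in> space (PiM UNIV (\<lambda>_. digit)). x i \<in> {b - 2..<b}}"
    using b by (intro arg_cong2[where f = emeasure]) (auto simp: digits_def space_digits[unfolded digits_def])
  also have "\<dots> = emeasure digit {b - 2..<b}"
    by (rule product_prob_space.emeasure_PiM_Collect_single[OF product_prob_space_digit]) (auto simp: digit_def sets_uniform_count_measure)
  also have "\<dots> = ennreal (2 / b)"
    using b by (subst digit_def, subst emeasure_uniform_count_measure) auto
  finally show ?thesis by (simp add: measure_def)
qed

end

section \<open>A skew product with a formal quadratic form\<close>

definition roots4 :: "complex set" where "roots4 = {1, \<i>, -1, -\<i>}"

lemma roots4_mult: "z \<in> roots4 \<Longrightarrow> w \<in> roots4 \<Longrightarrow> z * w \<in> roots4"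
  by (auto simp: roots4_def)

lemma ii_power_in_roots4: "\<i> ^ n \<in> roots4"
  by (induction n) (auto simp: roots4_def)

lemma roots4_power4: "z \<in> roots4 \<Longrightarrow> z ^ 4 = 1"
  by (auto simp: roots4_def numeral_eq_Suc)

lemma norm_roots4: "z \<in> roots4 \<Longrightarrow> cmod z = 1"
  by (auto simp: roots4_def)

lemma finite_roots4: "finite roots4"
  by (simp add: roots4_def)

lemma ii_power_mult4: "\<i> ^ (4 * n) = 1"
  by (simp add: power_mult)

definition uniform_roots4 :: "complex measure" where
  "uniform_roots4 = uniform_count_measure roots4"

lemma emeasure_uniform_roots4_mult:
  assumes w: "w \<in> roots4" and A: "A \<subseteq> roots4"
  shows "emeasure uniform_roots4 {z \<in> roots4. z * w \<in> A} = emeasure uniform_roots4 A"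
proof -
  have w4: "w * w ^ 3 = 1" using roots4_power4[OF w] by (simp add: numeral_eq_Suc)
  have w3: "w ^ 3 \<in> roots4" using w by (auto simp: roots4_def numeral_eq_Suc)
  have "w \<noteq> 0" using w4 by auto
  have "bij_betw (\<lambda>z. z * w) {z \<in> roots4. z * w \<in> A} A"
  proof (rule bij_betw_imageI)
    show "inj_on (\<lambda>z. z * w) {z \<in> roots4. z * w \<in> A}" using \<open>w \<noteq> 0\<close> by (auto simp: inj_on_def)
    show "(\<lambda>z. z * w) ` {z \<in> roots4. z * w \<in> A} = A"
    proof (intro subset_antisym subsetI)
      fix y assume y: "y \<in> A"
      have e: "y * w ^ 3 * w = y" using w4 by (simp add: mult.assoc mult.commute[of "w ^ 3"])
      have "y * w ^ 3 \<in> roots4" using y A w3 roots4_mult by blast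
      then have "y * w ^ 3 \<in> {z \<in> roots4. z * w \<in> A}" using y by (simp only: mem_Collect_eq e)
      then have "y * w ^ 3 * w \<in> (\<lambda>z. z * w) ` {z \<in> roots4. z * w \<in> A}" by (rule imageI)
      then show "y \<in> (\<lambda>z. z * w) ` {z \<in> roots4. z * w \<in> A}" by (simp only: e)
    qed auto
  qed
  then have "card {z \<in> roots4. z * w \<in> A} = card A" by (rule bij_betw_same_card)
  then show ?thesis
    using A by (simp add: uniform_roots4_def emeasure_uniform_count_measure finite_roots4)
qed

lemma prob_space_uniform_roots4: "prob_space uniform_roots4"
  unfolding uniform_roots4_def by (rule prob_space_uniform_count_measure) (auto simp: finite_roots4 roots4_def)

lemma space_uniform_roots4: "space uniform_roots4 = roots4"
  and sets_uniform_roots4: "sets uniform_roots4 = Pow roots4"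
  by (simp_all add: uniform_roots4_def space_uniform_count_measure sets_uniform_count_measure)

lemma measurable_uniform_roots4_iff: "f \<in> N \<rightarrow>\<^sub>M uniform_roots4 \<longleftrightarrow> f \<in> N \<rightarrow>\<^sub>M count_space roots4"
  using measurable_cong_sets[of N N uniform_roots4 "count_space roots4"] by (simp add: sets_uniform_roots4)

text \<open>The formal quadratic form \<open>Q\<close> is the sum of the forms of all blocks; \<open>total_form\<close> is its truncation.\<close>

definition block_form :: "(nat \<Rightarrow> nat \<times> nat \<Rightarrow> nat) \<Rightarrow> nat \<Rightarrow> (nat \<Rightarrow> nat) \<Rightarrow> nat" where
  "block_form c n x = (\<Sum>i\<in>block_rows n. \<Sum>j\<in>block_cols n. c n (i, j) * x i * x j)"

definition total_form :: "(nat \<Rightarrow> nat \<times> nat \<Rightarrow> nat) \<Rightarrow> nat \<Rightarrow> (nat \<Rightarrow> nat) \<Rightarrow> nat" where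
  "total_form c m x = (\<Sum>n<m. block_form c n x)"

lemma block_form_cong:
  "(\<And>i. i \<in> block_rows n \<union> block_cols n \<Longrightarrow> x i = y i) \<Longrightarrow> block_form c n x = block_form c n y"
  unfolding block_form_def by (intro sum.cong refl) auto

lemma block_indices_ge: "i \<in> block_rows n \<union> block_cols n \<Longrightarrow> n \<le> i"
  by (auto simp: block_rows_def block_cols_def power2_eq_square intro: le_trans[OF le_square])

lemma block_disjoint:
  assumes "i \<in> block_rows n \<union> block_cols n" "i \<in> block_rows n' \<union> block_cols n'" shows "n = n'"
proof -
  have *: "n'' \<^sup>2 \<le> i \<and> i < (Suc n'')\<^sup>2" if "i \<in> block_rows n'' \<union> block_cols n''" for n''
    using that by (auto simp: block_rows_def block_cols_def power2_eq_square)
  have "n < Suc n'" "n' < Suc n"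
    using *[OF assms(1)] *[OF assms(2)] by (meson le_less_trans power_less_imp_less_base zero_le)+
  then show ?thesis by simp
qed

lemma block_form_upd:
  assumes i: "i \<in> block_rows n" and j: "j \<in> block_cols n"
  shows "block_form c n (x(i := x i + t, j := x j + t)) =
         block_form c n x + t * ((\<Sum>j'\<in>block_cols n. c n (i, j') * x j') + (\<Sum>i'\<in>block_rows n. c n (i', j) * x i')) + t * t * c n (i, j)"
proof -
  let ?y = "x(i := x i + t, j := x j + t)"
  have ni: "i \<notin> block_cols n" and nj: "j \<notin> block_rows n" using i j by (auto simp: block_rows_def block_cols_def)
  have fin: "finite (block_rows n)" "finite (block_cols n)" by (auto simp: block_rows_def block_cols_def)
  have yr: "?y i' = x i' + (if i' = i then t else 0)" if "i' \<in> block_rows n" for i' using that nj by auto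
  have yc: "?y j' = x j' + (if j' = j then t else 0)" if "j' \<in> block_cols n" for j' using that ni by auto
  have "block_form c n ?y = (\<Sum>i'\<in>block_rows n. \<Sum>j'\<in>block_cols n. c n (i', j') * x i' * x j' +
      (if i' = i then t * (c n (i', j') * x j') else 0) + (if j' = j then t * (c n (i', j') * x i') else 0) +
      (if i' = i then if j' = j then t * t * c n (i', j') else 0 else 0))"
    unfolding block_form_def by (intro sum.cong refl) (simp only: yr yc, simp add: algebra_simps)
  also have "\<dots> = block_form c n x + (\<Sum>j'\<in>block_cols n. t * (c n (i, j') * x j')) + (\<Sum>i'\<in>block_rows n. t * (c n (i', j) * x i')) + t * t * c n (i, j)"
  proof -
    have 1: "(\<Sum>i'\<in>block_rows n. \<Sum>j'\<in>block_cols n. (if i' = i then t * (c n (i', j') * x j') else 0)) = (\<Sum>j'\<in>block_cols n. t * (c n (i, j') * x j'))"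
      using i fin by (subst sum.swap) (simp add: sum.delta)
    have 2: "(\<Sum>i'\<in>block_rows n. \<Sum>j'\<in>block_cols n. (if j' = j then t * (c n (i', j') * x i') else 0)) = (\<Sum>i'\<in>block_rows n. t * (c n (i', j) * x i'))"
      using j fin by (simp add: sum.delta)
    have 3: "(\<Sum>i'\<in>block_rows n. \<Sum>j'\<in>block_cols n. (if i' = i then if j' = j then t * t * c n (i', j') else 0 else 0)) = t * t * c n (i, j)"
      using i j fin by (subst sum.swap) (simp add: sum.delta)
    show ?thesis unfolding sum.distrib 1 2 3 block_form_def ..
  qed
  finally show ?thesis by (simp add: sum_distrib_left distrib_left)
qed

lemma measurable_nat_op:
  fixes f g :: "'a \<Rightarrow> nat"
  assumes f: "f \<in> M \<rightarrow>\<^sub>M count_space UNIV" and g: "g \<in> M \<rightarrow>\<^sub>M count_space UNIV"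
  shows "(\<lambda>x. h (f x) (g x) :: nat) \<in> M \<rightarrow>\<^sub>M count_space UNIV"
  by (rule measurable_compose_countable[where f = "\<lambda>i x. h i (g x)", OF measurable_compose[OF g] f]) simp

lemma measurable_nat_sum:
  fixes f :: "'i \<Rightarrow> 'a \<Rightarrow> nat"
  assumes "\<And>i. f i \<in> M \<rightarrow>\<^sub>M count_space UNIV"
  shows "(\<lambda>x. \<Sum>i\<in>I. f i x) \<in> M \<rightarrow>\<^sub>M count_space UNIV"
proof (induction I rule: infinite_finite_induct)
  case (insert i I)
  then show ?case using measurable_nat_op[OF assms[of i] insert.IH, of "(+)"] by simp
qed simp_all

context odometer
begin

text \<open>Unless all digits of \<open>x\<close> are \<open>b - 1\<close>, \<open>carry x\<close> is the last digit that changes under \<open>succ\<close>. As the digits of the blocks \<open>n > carry x\<close> do not change, the exponent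
  \<open>Q(x + 1) - Q(x)\<close> may be computed from the truncation to the blocks \<open>n \<le> carry x\<close>. Modulo \<open>4\<close> it is
  \<open>Q(x + 1) + 3 Q(x)\<close>, which avoids negative exponents.\<close>

definition carry :: "(nat \<Rightarrow> nat) \<Rightarrow> nat" where
  "carry x = (LEAST k. x k \<noteq> b - 1)"

definition cocycle :: "(nat \<Rightarrow> nat \<times> nat \<Rightarrow> nat) \<Rightarrow> (nat \<Rightarrow> nat) \<Rightarrow> complex" where
  "cocycle c x = \<i> ^ (total_form c (Suc (carry x)) (succ x) + 3 * total_form c (Suc (carry x)) x)"

definition skew :: "(nat \<Rightarrow> nat \<times> nat \<Rightarrow> nat) \<Rightarrow> (nat \<Rightarrow> nat) \<times> complex \<Rightarrow> (nat \<Rightarrow> nat) \<times> complex" where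
  "skew c = (\<lambda>(x, z). (succ x, z * cocycle c x))"

definition skew_space :: "((nat \<Rightarrow> nat) \<times> complex) measure" where
  "skew_space = digits \<Otimes>\<^sub>M uniform_roots4"

lemma cocycle_in_roots4: "cocycle c x \<in> roots4"
  unfolding cocycle_def by (rule ii_power_in_roots4)

lemma cocycle_eq:
  assumes "x k \<noteq> b - 1" "carry x < m"
  shows "cocycle c x = \<i> ^ (total_form c m (succ x) + 3 * total_form c m x)"
proof -
  define k0 where "k0 = carry x"
  have k0: "x k0 \<noteq> b - 1" unfolding k0_def carry_def by (rule LeastI[of "\<lambda>k. x k \<noteq> b - 1", OF assms(1)])
  define R where "R = (\<Sum>n\<in>{Suc k0..<m}. block_form c n x)"
  have "block_form c n (succ x) = block_form c n x" if "n \<in> {Suc k0..<m}" for n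
  proof (rule block_form_cong)
    fix i assume "i \<in> block_rows n \<union> block_cols n"
    then have "k0 < i" using block_indices_ge[of i n] that by auto
    then show "succ x i = x i" using succ_eq_beyond_carry[of x k0 i] k0 by blast
  qed
  then have R': "(\<Sum>n\<in>{Suc k0..<m}. block_form c n (succ x)) = R" by (simp add: R_def)
  have eq: "{..<Suc k0} \<union> {Suc k0..<m} = {..<m}" using assms(2) by (auto simp: k0_def)
  have split: "total_form c m y = total_form c (Suc k0) y + (\<Sum>n\<in>{Suc k0..<m}. block_form c n y)" for y
  proof -
    have "(\<Sum>n\<in>{..<Suc k0} \<union> {Suc k0..<m}. block_form c n y) =
        (\<Sum>n\<in>{..<Suc k0}. block_form c n y) + (\<Sum>n\<in>{Suc k0..<m}. block_form c n y)"
      by (rule sum.union_disjoint) auto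
    then show ?thesis unfolding eq total_form_def .
  qed
  have "total_form c m (succ x) + 3 * total_form c m x =
      total_form c (Suc k0) (succ x) + 3 * total_form c (Suc k0) x + 4 * R"
    unfolding split R' by (simp add: R_def)
  then show ?thesis
    by (simp only: cocycle_def k0_def[symmetric] power_add ii_power_mult4 mult_1_right)
qed

lemma funpow_skew:
  "(skew c ^^ t) (x, z) = ((succ ^^ t) x, z * (\<Prod>s<t. cocycle c ((succ ^^ s) x)))"
  by (induction t) (simp_all add: skew_def mult_ac)

text \<open>Along an orbit the differences telescope. The truncation must exceed the carries of all the steps; for the computation of
  the correlation any sufficiently large one will do.\<close>

lemma prod_cocycle:
  assumes good: "\<forall>n. \<exists>k. (succ ^^ n) x k \<noteq> b - 1"
  shows "\<exists>m0. \<forall>m\<ge>m0. (\<Prod>s<t. cocycle c ((succ ^^ s) x)) =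
           \<i> ^ (total_form c m ((succ ^^ t) x) + 3 * total_form c m x)"
proof (induction t)
  case 0
  have "\<i> ^ (total_form c m x + 3 * total_form c m x) = 1" for m
    using ii_power_mult4[of "total_form c m x"] by simp
  then show ?case by simp
next
  case (Suc t)
  then obtain m0 where m0: "\<And>m. m \<ge> m0 \<Longrightarrow> (\<Prod>s<t. cocycle c ((succ ^^ s) x)) =
           \<i> ^ (total_form c m ((succ ^^ t) x) + 3 * total_form c m x)" by blast
  obtain k where k: "(succ ^^ t) x k \<noteq> b - 1" using good by blast
  show ?case
  proof (intro exI[of _ "max m0 (Suc (carry ((succ ^^ t) x)))"] allI impI)
    fix m assume m: "m \<ge> max m0 (Suc (carry ((succ ^^ t) x)))"
    let ?q = "total_form c m"
    have "(\<Prod>s<Suc t. cocycle c ((succ ^^ s) x)) =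
        \<i> ^ (?q ((succ ^^ t) x) + 3 * ?q x) * \<i> ^ (?q (succ ((succ ^^ t) x)) + 3 * ?q ((succ ^^ t) x))"
      using m0[of m] m cocycle_eq[of "(succ ^^ t) x" k m c] k by simp
    also have "\<dots> = \<i> ^ (?q ((succ ^^ Suc t) x) + 3 * ?q x + 4 * ?q ((succ ^^ t) x))"
      unfolding power_add[symmetric] by (rule arg_cong[where f = "\<lambda>n. \<i> ^ n"]) simp
    also have "\<dots> = \<i> ^ (?q ((succ ^^ Suc t) x) + 3 * ?q x)"
      by (simp only: power_add[of _ _ "4 * _"] ii_power_mult4 mult_1_right)
    finally show "(\<Prod>s<Suc t. cocycle c ((succ ^^ s) x)) = \<i> ^ (?q ((succ ^^ Suc t) x) + 3 * ?q x)" .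
  qed
qed

lemma total_form_upd:
  assumes ij: "i \<in> block_rows n" "j \<in> block_cols n" and m: "n < m"
  shows "\<exists>\<alpha>. \<forall>t. total_form c m (x(i := x i + t, j := x j + t)) = total_form c m x + t * \<alpha> + t * t * c n (i, j)"
proof -
  define \<alpha> where "\<alpha> = (\<Sum>j'\<in>block_cols n. c n (i, j') * x j') + (\<Sum>i'\<in>block_rows n. c n (i', j) * x i')"
  have "total_form c m (x(i := x i + t, j := x j + t)) = total_form c m x + t * \<alpha> + t * t * c n (i, j)" for t
  proof -
    let ?y = "x(i := x i + t, j := x j + t)"
    have other: "block_form c n' ?y = block_form c n' x" if "n' \<noteq> n" for n'
    proof (rule block_form_cong)
      fix k assume "k \<in> block_rows n' \<union> block_cols n'"
      then have "k \<noteq> i" "k \<noteq> j" using block_disjoint[of k n' n] ij that by auto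
      then show "?y k = x k" by simp
    qed
    have split: "total_form c m z = block_form c n z + (\<Sum>n'\<in>{..<m} - {n}. block_form c n' z)" for z
      unfolding total_form_def using m by (subst sum.remove[of _ n]) auto
    show ?thesis
      unfolding split using block_form_upd[OF ij, of c x t, folded \<alpha>_def] other by simp
  qed
  then show ?thesis by blast
qed

text \<open>The exponent of \<open>\<i>\<close> is the second difference \<open>Q(x) - 2 Q(x + d) + Q(x + 2 d)\<close> modulo \<open>4\<close>. If no carry occurs, adding \<open>t d\<close>
  adds \<open>t\<close> to the digits \<open>i\<close> and \<open>j\<close>, so \<open>Q(x + t d)\<close> is a quadratic polynomial in \<open>t\<close> with leading coefficient
  \<open>c n (i, j)\<close>, and its second difference is twice this coefficient.\<close>

lemma skew_product_value:
  assumes x: "x \<in> space digits" "\<forall>n. \<exists>k. (succ ^^ n) x k \<noteq> b - 1" and z: "z \<in> roots4"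
    and ij: "i \<in> block_rows n" "j \<in> block_cols n" and nc: "x i + 2 < b" "x j + 2 < b"
  defines "d \<equiv> b ^ i + b ^ j"
  shows "z * (snd ((skew c ^^ d) (x, z)))\<^sup>2 * snd ((skew c ^^ (2 * d)) (x, z)) = (-1) ^ c n (i, j)"
proof -
  have neq: "i \<noteq> j" using ij by (auto simp: block_rows_def block_cols_def)
  obtain m1 where m1: "\<And>m. m \<ge> m1 \<Longrightarrow> (\<Prod>s<d. cocycle c ((succ ^^ s) x)) =
           \<i> ^ (total_form c m ((succ ^^ d) x) + 3 * total_form c m x)"
    using prod_cocycle[OF x(2), where t = d and c = c] by blast
  obtain m2 where m2: "\<And>m. m \<ge> m2 \<Longrightarrow> (\<Prod>s<2 * d. cocycle c ((succ ^^ s) x)) =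
           \<i> ^ (total_form c m ((succ ^^ (2 * d)) x) + 3 * total_form c m x)"
    using prod_cocycle[OF x(2), where t = "2 * d" and c = c] by blast
  define m where "m = max (Suc n) (max m1 m2)"
  have m: "n < m" "m1 \<le> m" "m2 \<le> m" by (auto simp: m_def)
  define q where "q = total_form c m x"
  obtain \<alpha> where \<alpha>: "\<And>t. total_form c m (x(i := x i + t, j := x j + t)) = q + t * \<alpha> + t * t * c n (i, j)"
    using total_form_upd[OF ij m(1), of c x] unfolding q_def by blast
  have "(succ ^^ d) x = x(i := x i + 1, j := x j + 1)"
    using funpow_succ_no_carry2[OF x(1) neq, of 1] nc by (simp add: d_def)
  then have 1: "snd ((skew c ^^ d) (x, z)) = z * \<i> ^ (q + \<alpha> + c n (i, j) + 3 * q)"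
    using m1[OF m(2)] \<alpha>[of 1] by (simp add: funpow_skew q_def)
  have "(succ ^^ (2 * d)) x = x(i := x i + 2, j := x j + 2)"
    using funpow_succ_no_carry2[OF x(1) neq, of 2] nc by (simp add: d_def)
  then have 2: "snd ((skew c ^^ (2 * d)) (x, z)) = z * \<i> ^ (q + 2 * \<alpha> + 4 * c n (i, j) + 3 * q)"
    using m2[OF m(3)] \<alpha>[of 2] by (simp add: funpow_skew q_def)
  have "z * (snd ((skew c ^^ d) (x, z)))\<^sup>2 * snd ((skew c ^^ (2 * d)) (x, z)) =
      z ^ 4 * (\<i> ^ ((q + \<alpha> + c n (i, j) + 3 * q) * 2) * \<i> ^ (q + 2 * \<alpha> + 4 * c n (i, j) + 3 * q))"
    unfolding 1 2 power_mult by (simp add: power_mult_distrib power2_eq_square power4_eq_xxxx mult_ac)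
  also have "z ^ 4 = 1" using z by (rule roots4_power4)
  also have "\<i> ^ ((q + \<alpha> + c n (i, j) + 3 * q) * 2) * \<i> ^ (q + 2 * \<alpha> + 4 * c n (i, j) + 3 * q) =
      \<i> ^ (2 * c n (i, j) + 4 * (3 * q + \<alpha> + c n (i, j)))"
    unfolding power_add[symmetric] by (rule arg_cong[where f = "\<lambda>n. \<i> ^ n"]) simp
  also have "\<dots> = \<i> ^ (2 * c n (i, j))"
    by (simp only: power_add ii_power_mult4 mult_1_right)
  also have "\<dots> = (-1) ^ c n (i, j)" by (simp add: power_mult)
  finally show ?thesis by simp
qed

lemma measurable_block_form: "block_form c n \<in> digits \<rightarrow>\<^sub>M count_space UNIV"
proof -
  have "(\<lambda>x. c n (i, j) * x i * x j) \<in> digits \<rightarrow>\<^sub>M count_space UNIV" for i j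
    using measurable_nat_op[OF measurable_coordinate[of i] measurable_coordinate[of j], of "\<lambda>u v. c n (i, j) * u * v"] .
  then show ?thesis unfolding block_form_def[abs_def] by (intro measurable_nat_sum)
qed

lemma measurable_total_form: "total_form c m \<in> digits \<rightarrow>\<^sub>M count_space UNIV"
  unfolding total_form_def[abs_def] by (intro measurable_nat_sum measurable_block_form)

lemma measurable_cocycle: "cocycle c \<in> digits \<rightarrow>\<^sub>M count_space UNIV"
proof -
  have carry: "carry \<in> digits \<rightarrow>\<^sub>M count_space UNIV"
    unfolding carry_def[abs_def]
    by (intro measurable_Least) (use sets_coordinate in \<open>simp add: pred_def\<close>)
  have "(\<lambda>x. total_form c (Suc k) (succ x) + 3 * total_form c (Suc k) x) \<in> digits \<rightarrow>\<^sub>M count_space UNIV" for k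
    using measurable_nat_op[OF measurable_compose[OF measurable_succ measurable_total_form] measurable_total_form, of "\<lambda>u v. u + 3 * v"] .
  from measurable_compose_countable[OF this carry]
  have "(\<lambda>x. total_form c (Suc (carry x)) (succ x) + 3 * total_form c (Suc (carry x)) x) \<in> digits \<rightarrow>\<^sub>M count_space UNIV" .
  from measurable_compose[OF this, of "\<lambda>n. \<i> ^ n" "count_space UNIV"]
  show ?thesis unfolding cocycle_def[abs_def] by simp
qed

lemma measurable_skew: "skew c \<in> skew_space \<rightarrow>\<^sub>M skew_space"
proof -
  have snd: "snd \<in> skew_space \<rightarrow>\<^sub>M count_space roots4"
    unfolding measurable_uniform_roots4_iff[symmetric] skew_space_def by (rule measurable_snd)
  have fst: "fst \<in> skew_space \<rightarrow>\<^sub>M digits" unfolding skew_space_def by (rule measurable_fst)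
  have "(\<lambda>p. w * cocycle c (fst p)) \<in> skew_space \<rightarrow>\<^sub>M count_space roots4" if "w \<in> roots4" for w
  proof -
    have "(\<lambda>p. cocycle c (fst p)) \<in> skew_space \<rightarrow>\<^sub>M count_space UNIV"
      by (rule measurable_compose[OF fst measurable_cocycle])
    then have "(\<lambda>p. w * cocycle c (fst p)) \<in> skew_space \<rightarrow>\<^sub>M count_space UNIV"
      by (rule measurable_compose) simp
    moreover have "w * cocycle c (fst p) \<in> roots4" for p
      using that cocycle_in_roots4 by (rule roots4_mult)
    ultimately show ?thesis
      by (auto simp: measurable_count_space_eq2 finite_roots4 intro: measurable_sets)
  qed
  from measurable_compose_countable'[OF this snd]
  have "(\<lambda>p. snd p * cocycle c (fst p)) \<in> skew_space \<rightarrow>\<^sub>M uniform_roots4"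
    unfolding measurable_uniform_roots4_iff by (simp add: finite_roots4 countable_finite)
  with measurable_compose[OF fst measurable_succ]
  show ?thesis
    unfolding skew_def skew_space_def case_prod_beta by (rule measurable_Pair)
qed

lemma space_skew_space: "space skew_space = space digits \<times> roots4"
  by (simp add: skew_space_def space_pair_measure space_uniform_roots4)

lemma prob_space_skew_space: "prob_space skew_space"
proof -
  interpret pair_prob_space digits uniform_roots4
    unfolding pair_prob_space_def pair_sigma_finite_def
    by (simp add: prob_space_digits prob_space_uniform_roots4 prob_space_imp_sigma_finite)
  show ?thesis unfolding skew_space_def by (rule prob_space_axioms)
qed

text \<open>By Fubini: the section of the preimage of \<open>A\<close> over \<open>x\<close> is a rotation of the section of \<open>A\<close> over \<open>succ x\<close>.\<close>

lemma measure_preserving_skew: "measure_preserving_system skew_space (skew c)"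
  unfolding measure_preserving_system_def
proof (intro conjI ballI prob_space_skew_space measurable_skew)
  fix A assume A: "A \<in> sets skew_space"
  interpret U: prob_space uniform_roots4 by (rule prob_space_uniform_roots4)
  have sec: "Pair x -` A \<subseteq> roots4" for x
    using sets.sets_into_space[OF A] by (auto simp: space_skew_space)
  have g: "(\<lambda>x. emeasure uniform_roots4 (Pair x -` A)) \<in> borel_measurable digits"
    using A unfolding skew_space_def by (rule U.measurable_emeasure_Pair)
  have "emeasure skew_space (skew c -` A \<inter> space skew_space) =
     (\<integral>\<^sup>+x. emeasure uniform_roots4 (Pair x -` (skew c -` A \<inter> space skew_space)) \<partial>digits)"
    using measurable_sets[OF measurable_skew A] unfolding skew_space_def by (rule U.emeasure_pair_measure_alt)
  also have "\<dots> = (\<integral>\<^sup>+x. emeasure uniform_roots4 (Pair (succ x) -` A) \<partial>digits)"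
  proof (rule nn_integral_cong)
    fix x assume "x \<in> space digits"
    then have "Pair x -` (skew c -` A \<inter> space skew_space) = {z \<in> roots4. z * cocycle c x \<in> Pair (succ x) -` A}"
      by (auto simp: skew_def space_skew_space)
    then show "emeasure uniform_roots4 (Pair x -` (skew c -` A \<inter> space skew_space)) = emeasure uniform_roots4 (Pair (succ x) -` A)"
      using emeasure_uniform_roots4_mult[OF cocycle_in_roots4 sec] by simp
  qed
  also have "\<dots> = (\<integral>\<^sup>+x. emeasure uniform_roots4 (Pair x -` A) \<partial>distr digits digits succ)"
    using g by (intro nn_integral_distr[symmetric] measurable_succ) simp
  also have "\<dots> = emeasure skew_space A"
    using A unfolding distr_succ skew_space_def by (rule U.emeasure_pair_measure_alt[symmetric])
  finally show "emeasure skew_space (skew c -` A \<inter> space skew_space) = emeasure skew_space A" .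
qed

lemma funpow_skew_in_space:
  assumes "p \<in> space skew_space" shows "(skew c ^^ t) p \<in> space skew_space"
  using assms by (induction t) (auto simp: measurable_space[OF measurable_skew])

lemma measurable_funpow_skew: "skew c ^^ t \<in> skew_space \<rightarrow>\<^sub>M skew_space"
proof (induction t)
  case (Suc t) then show ?case using measurable_comp[OF Suc measurable_skew] by (simp add: o_def)
qed (simp add: id_def)

lemma borel_measurable_snd_skew_space: "snd \<in> borel_measurable skew_space"
proof -
  have "snd \<in> skew_space \<rightarrow>\<^sub>M count_space roots4"
    unfolding measurable_uniform_roots4_iff[symmetric] skew_space_def by (rule measurable_snd)
  then have "(\<lambda>p. snd p) \<in> borel_measurable skew_space" by (rule measurable_compose) simp
  then show ?thesis .
qed

text \<open>The integrand has absolute value \<open>1\<close> and equals the prescribed sign unless one of the digits \<open>i\<close>, \<open>j\<close> is at least \<open>b - 2\<close>,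
  which has probability at most \<open>4/b\<close>.\<close>

theorem skew_correlation:
  assumes ij: "i \<in> block_rows n" "j \<in> block_cols n"
  shows "cmod (correlation skew_space (skew c) snd (\<lambda>p. (snd p)\<^sup>2) snd (b ^ i + b ^ j) - (-1) ^ c n (i, j)) \<le> 8 / b"
proof -
  define d where "d = b ^ i + b ^ j"
  define f where "f = (\<lambda>p. snd p * (snd ((skew c ^^ d) p))\<^sup>2 * snd ((skew c ^^ (2 * d)) p))"
  define v where "v = ((-1) ^ c n (i, j) :: complex)"
  interpret P: prob_space skew_space by (rule prob_space_skew_space)
  interpret U: prob_space uniform_roots4 by (rule prob_space_uniform_roots4)
  interpret Dg: prob_space digits by (rule prob_space_digits)
  define bad where "bad = {x \<in> space digits. x i + 2 \<ge> b} \<union> {x \<in> space digits. x j + 2 \<ge> b}"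
  have bad_sets: "bad \<in> sets digits" unfolding bad_def
    using sets_coordinate[of "\<lambda>v. v + 2 \<ge> b" i] sets_coordinate[of "\<lambda>v. v + 2 \<ge> b" j] by (rule sets.Un)
  have f_meas: "f \<in> borel_measurable skew_space"
    unfolding f_def
    by (intro borel_measurable_times borel_measurable_power measurable_compose[OF measurable_funpow_skew borel_measurable_snd_skew_space] borel_measurable_snd_skew_space)
  have f_norm: "cmod (f p) = 1" if "p \<in> space skew_space" for p
  proof -
    have "snd ((skew c ^^ t) p) \<in> roots4" for t
      using funpow_skew_in_space[OF that, where c = c and t = t] by (auto simp: space_skew_space)
    then show ?thesis using norm_roots4 that by (auto simp: f_def norm_mult norm_power space_skew_space)
  qed
  have f_int: "integrable skew_space f"
    using f_meas f_norm by (intro P.integrable_const_bound[where B = 1]) auto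
  have "AE x in distr skew_space digits fst. \<forall>n. \<exists>k. (succ ^^ n) x k \<noteq> b - 1"
    unfolding skew_space_def U.distr_pair_fst by (rule AE_orbit_not_all_max)
  then have good: "AE p in skew_space. \<forall>n. \<exists>k. (succ ^^ n) (fst p) k \<noteq> b - 1"
    by (rule AE_distrD[rotated]) (simp add: skew_space_def)
  have le: "AE p in skew_space. cmod (f p - v) \<le> 2 * indicat_real (bad \<times> roots4) p"
    using good AE_space
  proof eventually_elim
    case (elim p)
    obtain x z where p: "p = (x, z)" by (cases p)
    have xz: "x \<in> space digits" "z \<in> roots4" using elim(2) by (auto simp: p space_skew_space)
    show ?case
    proof (cases "x \<in> bad")
      case True
      have "cmod (f p - v) \<le> cmod (f p) + cmod v" by (rule norm_triangle_ineq4)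
      also have "\<dots> = 2" using f_norm[OF elim(2)] by (simp add: v_def norm_power)
      finally show ?thesis using True xz by (simp add: p)
    next
      case False
      then have "f p = v"
        using skew_product_value[OF xz(1) _ xz(2) ij, where c = c] elim(1) xz(1)
        by (simp add: f_def v_def d_def p bad_def)
      then show ?thesis by (simp add: p)
    qed
  qed
  have R: "bad \<times> roots4 \<in> sets skew_space"
    unfolding skew_space_def using bad_sets by (intro pair_measureI) (simp_all add: sets_uniform_roots4)
  have "measure digits bad \<le> measure digits {x \<in> space digits. x i + 2 \<ge> b} + measure digits {x \<in> space digits. x j + 2 \<ge> b}"
    unfolding bad_def
    using sets_coordinate[of "\<lambda>v. v + 2 \<ge> b" i] sets_coordinate[of "\<lambda>v. v + 2 \<ge> b" j] by (rule measure_Un_le)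
  then have "measure digits bad \<le> 2 / b + 2 / b" by (simp only: prob_near_carry)
  moreover have "measure skew_space (bad \<times> roots4) = measure digits bad"
    using U.emeasure_pair_measure_Times[OF bad_sets, of roots4] U.emeasure_space_1
    by (simp add: measure_def skew_space_def sets_uniform_roots4 space_uniform_roots4)
  ultimately have mb: "measure skew_space (bad \<times> roots4) \<le> 4 / b" by simp
  have "correlation skew_space (skew c) snd (\<lambda>p. (snd p)\<^sup>2) snd d = (LINT p|skew_space. f p)"
    by (simp add: correlation_def f_def)
  then have "correlation skew_space (skew c) snd (\<lambda>p. (snd p)\<^sup>2) snd d - v = (LINT p|skew_space. f p - v)"
    using f_int by (simp add: P.prob_space)
  also have "cmod \<dots> \<le> (LINT p|skew_space. cmod (f p - v))"
    by (rule integral_norm_bound)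
  also have "\<dots> \<le> (LINT p|skew_space. 2 * indicat_real (bad \<times> roots4) p)"
    using le f_int R by (intro integral_mono_AE) (auto simp: P.emeasure_eq_measure)
  also have "\<dots> = 2 * measure skew_space (bad \<times> roots4)"
    using R by (simp add: P.emeasure_eq_measure)
  also have "\<dots> \<le> 8 / b" using mb by simp
  finally show ?thesis by (simp add: d_def v_def)
qed

end

section \<open>Transport of systems and the counterexample\<close>

text \<open>The system and its correlation sequences can be moved along an arbitrary injection, with the image \<open>\<sigma>\<close>-algebra; this puts the
  skew product on the type \<^typ>\<open>nat \<Rightarrow> real\<close>.\<close>

lemma transport_system:
  fixes M :: "'a measure" and J :: "'a \<Rightarrow> 'b"
  assumes inj: "inj J" and sys: "measure_preserving_system M T"
    and F: "F0 \<in> L_infinity M" "F1 \<in> L_infinity M" "F2 \<in> L_infinity M"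
  defines "N \<equiv> embed_measure M J" and "S \<equiv> J \<circ> T \<circ> inv_into UNIV J"
  shows "measure_preserving_system N S"
    and "F0 \<circ> inv_into UNIV J \<in> L_infinity N" "F1 \<circ> inv_into UNIV J \<in> L_infinity N" "F2 \<circ> inv_into UNIV J \<in> L_infinity N"
    and "correlation N S (F0 \<circ> inv_into UNIV J) (F1 \<circ> inv_into UNIV J) (F2 \<circ> inv_into UNIV J) n = correlation M T F0 F1 F2 n"
proof -
  interpret M: prob_space M using sys by (simp add: measure_preserving_system_def)
  have T: "T \<in> M \<rightarrow>\<^sub>M M" using sys by (simp add: measure_preserving_system_def)
  have J: "J \<in> M \<rightarrow>\<^sub>M N" unfolding N_def using inj by (rule measurable_embed_measure2)
  have N: "N = distr M N J" unfolding N_def using inj by (rule embed_measure_eq_distr)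
  have inv: "inv_into UNIV J \<in> N \<rightarrow>\<^sub>M M"
    unfolding N_def by (rule measurable_embed_measure1) (simp add: inv_f_f[OF inj])
  have S: "S \<in> N \<rightarrow>\<^sub>M N"
    unfolding S_def by (intro measurable_comp[OF inv] measurable_comp[OF T] J measurable_comp)
  have "prob_space N" by (subst N) (rule M.prob_space_distr[OF J])
  moreover have "emeasure N (S -` A \<inter> space N) = emeasure N A" if A: "A \<in> sets N" for A
  proof -
    have "emeasure N (S -` A \<inter> space N) = emeasure M (J -` (S -` A \<inter> space N) \<inter> space M)"
      by (subst N) (rule emeasure_distr[OF J measurable_sets[OF S A]])
    also have "J -` (S -` A \<inter> space N) \<inter> space M = T -` (J -` A \<inter> space M) \<inter> space M"
      using measurable_space[OF J] measurable_space[OF T] by (auto simp: S_def inv_f_f[OF inj])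
    also have "emeasure M \<dots> = emeasure M (J -` A \<inter> space M)"
      using sys measurable_sets[OF J A] unfolding measure_preserving_system_def by blast
    also have "\<dots> = emeasure N A"
      by (subst N) (rule emeasure_distr[OF J A, symmetric])
    finally show ?thesis .
  qed
  ultimately show "measure_preserving_system N S"
    using S by (simp add: measure_preserving_system_def)
  have L: "F \<circ> inv_into UNIV J \<in> L_infinity N" if F: "F \<in> L_infinity M" for F
  proof -
    obtain C where C: "AE x in M. cmod (F x) \<le> C" and Fm: "F \<in> borel_measurable M"
      using F by (auto simp: L_infinity_def)
    have m: "F \<circ> inv_into UNIV J \<in> borel_measurable N" using measurable_comp[OF inv Fm] .
    have "AE x in distr M N J. cmod ((F \<circ> inv_into UNIV J) x) \<le> C"
    proof (subst AE_distr_iff[OF J])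
      show "{x \<in> space N. cmod ((F \<circ> inv_into UNIV J) x) \<le> C} \<in> sets N" using m by measurable
      show "AE x in M. cmod ((F \<circ> inv_into UNIV J) (J x)) \<le> C" using C by (simp add: inv_f_f[OF inj])
    qed
    then have "AE x in N. cmod ((F \<circ> inv_into UNIV J) x) \<le> C" unfolding N[symmetric] .
    then show ?thesis using m by (auto simp: L_infinity_def)
  qed
  show "F0 \<circ> inv_into UNIV J \<in> L_infinity N" "F1 \<circ> inv_into UNIV J \<in> L_infinity N" "F2 \<circ> inv_into UNIV J \<in> L_infinity N"
    using L F by auto
  have pow: "(S ^^ k) (J x) = J ((T ^^ k) x)" for k x
    by (induction k) (simp_all add: S_def inv_f_f[OF inj])
  have powm: "S ^^ k \<in> N \<rightarrow>\<^sub>M N" for k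
  proof (induction k)
    case (Suc k) then show ?case using measurable_comp[OF Suc S] by (simp add: o_def)
  qed (simp add: id_def)
  have Fm: "F \<circ> inv_into UNIV J \<in> borel_measurable N" if "F \<in> {F0, F1, F2}" for F
    using that F measurable_comp[OF inv] by (auto simp: L_infinity_def)
  let ?f = "\<lambda>y. (F0 \<circ> inv_into UNIV J) y * (F1 \<circ> inv_into UNIV J) ((S ^^ n) y) * (F2 \<circ> inv_into UNIV J) ((S ^^ (2 * n)) y)"
  have "?f \<in> borel_measurable N"
    by (intro borel_measurable_times measurable_compose[OF powm] Fm) auto
  then have "(LINT y|distr M N J. ?f y) = (LINT x|M. ?f (J x))"
    by (rule integral_distr[OF J])
  then show "correlation N S (F0 \<circ> inv_into UNIV J) (F1 \<circ> inv_into UNIV J) (F2 \<circ> inv_into UNIV J) n = correlation M T F0 F1 F2 n"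
    unfolding correlation_def N[symmetric] by (simp add: pow inv_f_f[OF inj])
qed

lemma inj_digits_complex:
  "inj (\<lambda>p :: (nat \<Rightarrow> nat) \<times> complex. case_nat (Re (snd p)) (case_nat (Im (snd p)) (\<lambda>k. real (fst p k))))"
proof (rule injI)
  fix p q :: "(nat \<Rightarrow> nat) \<times> complex"
  assume eq: "case_nat (Re (snd p)) (case_nat (Im (snd p)) (\<lambda>k. real (fst p k))) =
              case_nat (Re (snd q)) (case_nat (Im (snd q)) (\<lambda>k. real (fst q k)))"
  have "fst p k = fst q k" for k using fun_cong[OF eq, of "Suc (Suc k)"] by simp
  moreover have "snd p = snd q"
    using fun_cong[OF eq, of 0] fun_cong[OF eq, of "Suc 0"] by (simp add: complex_eq_iff)
  ultimately show "p = q" by (auto simp: prod_eq_iff)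
qed

theorem theorem1p2:
  shows "\<exists>(M :: (nat \<Rightarrow> real) measure) T F0 F1 F2 (\<epsilon> :: real).
    measure_preserving_system M T \<and>
    F0 \<in> L_infinity M \<and> F1 \<in> L_infinity M \<and> F2 \<in> L_infinity M \<and>
    \<epsilon> > 0 \<and>
    \<not> (\<exists>(a :: int \<Rightarrow> complex) (b :: nat \<Rightarrow> complex).
          integral_combination 2 a \<and>
          (\<forall>n. cmod (b n) \<le> \<epsilon>) \<and>
          (\<forall>n. correlation M T F0 F1 F2 n = a (int n) + b n))"
proof -
  \<comment> \<open>The base \<open>32\<close> makes the error \<open>8/b\<close> of the correlation equal to \<open>1/4\<close>.\<close>
  interpret odometer 32 by unfold_locales simp
  obtain s :: "nat \<Rightarrow> nat \<times> nat \<Rightarrow> real" where sign: "\<And>n. is_sign (s n)"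
    and bal: "\<And>K. \<forall>\<^sub>F n in sequentially. balanced K n (s n)"
    using exists_universal_signs by blast
  have s1: "s n p = 1 \<or> s n p = -1" for n p using sign[of n] unfolding is_sign_def by (rule spec)
  then have abs_s: "\<bar>s n p\<bar> = 1" and sq_s: "s n p * s n p = 1" for n p
    by (metis abs_one abs_minus_cancel, metis mult_1 minus_mult_minus)
  define c where "c = (\<lambda>n p. if s n p = 1 then 0 else 1 :: nat)"
  have c: "(-1) ^ c n p = complex_of_real (s n p)" for n p
    using s1[of n p] by (auto simp: c_def)
  define S where "S = (\<lambda>n. block_rows n \<times> block_cols n)"
  define w where "w = (\<lambda>n p. complex_of_real (s n p / n\<^sup>2))"
  define d where "d = (\<lambda>p :: nat \<times> nat. 32 ^ fst p + 32 ^ snd p :: nat)"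
  define Cor where "Cor = correlation skew_space (skew c) snd (\<lambda>p. (snd p)\<^sup>2) snd"
  have fin: "finite (S n)" and card: "card (S n) = n\<^sup>2" for n
    by (simp_all add: S_def finite_block card_block)
  have cmod_w: "cmod (w n p) = 1 / n\<^sup>2" for n p
    by (simp add: w_def norm_divide norm_power abs_s)
  have sum_w: "(\<Sum>p\<in>S n. cmod (w n p)) \<le> 1" for n
    by (cases "n = 0") (simp_all add: cmod_w card)
  have avg: "cmod (\<Sum>p\<in>S n. w n p * x p) \<le> B" if n: "n > 0" and x: "\<And>p. p \<in> S n \<Longrightarrow> cmod (x p) \<le> B" for n x B
  proof -
    have "cmod (\<Sum>p\<in>S n. w n p * x p) \<le> (\<Sum>p\<in>S n. 1 / n\<^sup>2 * B)"
      by (rule sum_norm_le) (auto simp: norm_mult cmod_w intro!: divide_right_mono x)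
    also have "\<dots> = B" using n by (simp add: card)
    finally show ?thesis .
  qed
  have cor: "cmod (Cor (d p) - complex_of_real (s n p)) \<le> 1 / 4" if "p \<in> S n" for n p
    using skew_correlation[of "fst p" n "snd p" c] that by (auto simp: Cor_def d_def c S_def)
  have no_decomposition: False
    if a: "integral_combination 2 a" and b: "\<And>n. cmod (b n) \<le> 1 / 4" and ab: "\<And>n. Cor n = a (int n) + b n"
    for a :: "int \<Rightarrow> complex" and b :: "nat \<Rightarrow> complex"
  proof -
    have "(\<lambda>n. \<Sum>p\<in>S n. w n p * a (int (d p))) \<longlonglongrightarrow> 0"
    proof (rule integral_combination_weighted_sums[OF a fin sum_w])
      fix f assume "nilsequence 2 f"
      then have "low_complexity 32 f" by (rule nilsequence_low_complexity)
      then show "(\<lambda>n. \<Sum>p\<in>S n. w n p * f (int (d p))) \<longlonglongrightarrow> 0"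
        unfolding S_def w_def d_def by (rule low_complexity_average_tendsto_0[OF _ sign bal])
    qed
    then have "\<forall>\<^sub>F n in sequentially. dist (\<Sum>p\<in>S n. w n p * a (int (d p))) 0 < 1 / 2"
      by (rule tendstoD) simp
    then have "\<forall>\<^sub>F n in sequentially. 0 < n \<and> dist (\<Sum>p\<in>S n. w n p * a (int (d p))) 0 < 1 / 2"
      by (intro eventually_conj eventually_gt_at_top)
    from eventually_happens'[OF sequentially_bot this]
    obtain n where n: "n > 0" "cmod (\<Sum>p\<in>S n. w n p * a (int (d p))) < 1 / 2" by auto
    have b_avg: "cmod (\<Sum>p\<in>S n. w n p * b (d p)) \<le> 1 / 4"
      by (rule avg[OF n(1)]) (rule b)
    have cor_avg: "cmod (\<Sum>p\<in>S n. w n p * (Cor (d p) - s n p)) \<le> 1 / 4"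
      by (rule avg[OF n(1)]) (rule cor)
    let ?A = "\<Sum>p\<in>S n. w n p * a (int (d p))" and ?B = "\<Sum>p\<in>S n. w n p * b (d p)"
    let ?E = "\<Sum>p\<in>S n. w n p * (Cor (d p) - s n p)"
    \<comment> \<open>Averaged against the signs, the correlation sequence would be close to \<open>1\<close>, but \<open>a\<close> and \<open>b\<close> contribute at most \<open>3/4\<close>.\<close>
    have one: "(\<Sum>p\<in>S n. w n p * s n p) = 1"
      using n(1) by (simp add: w_def sq_s card flip: of_real_mult of_real_sum)
    have split: "(\<Sum>p\<in>S n. w n p * s n p) = ?A + ?B - ?E"
      by (simp add: ab algebra_simps sum.distrib sum_subtractf)
    have "cmod (?A + ?B - ?E) = 1" unfolding split[symmetric] one by simp
    moreover have "cmod (?A + ?B - ?E) \<le> cmod (?A + ?B) + cmod ?E" by (rule norm_triangle_ineq4)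
    moreover have "cmod (?A + ?B) \<le> cmod ?A + cmod ?B" by (rule norm_triangle_ineq)
    ultimately show False using n(2) b_avg cor_avg by linarith
  qed
  define J :: "(nat \<Rightarrow> nat) \<times> complex \<Rightarrow> nat \<Rightarrow> real" where
    "J = (\<lambda>p. case_nat (Re (snd p)) (case_nat (Im (snd p)) (\<lambda>k. real (fst p k))))"
  have inj: "inj J" unfolding J_def by (rule inj_digits_complex)
  have bd: "AE p in skew_space. cmod (snd p) = 1"
    by (rule AE_I2) (auto simp: space_skew_space norm_roots4)
  have F: "snd \<in> L_infinity skew_space" "(\<lambda>p. (snd p)\<^sup>2) \<in> L_infinity skew_space"
    using bd borel_measurable_snd_skew_space by (auto simp: L_infinity_def norm_power intro!: exI[of _ 1] elim: eventually_mono)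
  note sys = transport_system[OF inj measure_preserving_skew[of c] F(1) F(2) F(1)]
  show ?thesis
    by (rule exI[of _ "embed_measure skew_space J"], rule exI[of _ "J \<circ> skew c \<circ> inv_into UNIV J"],
        rule exI[of _ "snd \<circ> inv_into UNIV J"], rule exI[of _ "(\<lambda>p. (snd p)\<^sup>2) \<circ> inv_into UNIV J"],
        rule exI[of _ "snd \<circ> inv_into UNIV J"], rule exI[of _ "1 / 4"])
       (intro conjI sys(1-4) notI, simp, elim exE conjE, rule no_decomposition[unfolded Cor_def, folded sys(5)],
         assumption, erule spec, erule spec)
qed

end
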